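(* Let $(M,K)$ be a Cartan space with constant flag curvature $c\in\mathbb{R}$, let $\alpha,\beta>0$ be real constants, and let $v$ be the constant function $v=-c\alpha\beta^2$. Put $\tau=\frac12K^2$, $G_{ij}=\frac1\beta g_{ij}+\frac{v}{\alpha\beta}p_ip_j$, and, where $\alpha+2\tau v>0$, let $(G^{ij})=(G_{ij})^{-1}$, $G=G_{ij}dx^idx^j+G^{ij}\delta p_i\delta p_j$, and $J(\delta_i)=G_{ik}\dot\partial^k$, $J(\dot\partial^i)=-G^{ik}\delta_k$. Then: (i) if $c<0$, then $(T^{*}M_0,G,J)$ is a Kähler manifold; (ii) if $c>0$, then the tube around the zero section defined by $2\tau=K^2<\frac1{c\beta^2}$, i.e. $\{(x,p)\in T^{*}M_0: K(x,p)^2<\frac{1}{c\beta^2}\}$, with $G$ and $J$, is a Kähler manifold.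
   Context: $M$ is a smooth $n$-dimensional manifold, $T^{*}M_0$ is its cotangent bundle with the zero section removed, $(x^i,p_i)$ are the induced local coordinates, $\partial_i=\partial/\partial x^i$, $\dot\partial^i=\partial/\partial p_i$; the summation convention is used. A Cartan space $(M,K)$ is a manifold $M$ with a function $K:T^{*}M\to[0,\infty)$ that is $C^\infty$ on $T^{*}M_0$, satisfies $K(x,\lambda p)=\lambda K(x,p)$ for $\lambda>0$, and for which $g^{ij}(x,p)=\frac12\dot\partial^i\dot\partial^jK^2$ is positive definite on $T^{*}M_0$. Let $(g_{ij})=(g^{ij})^{-1}$ and $p^i=g^{ij}p_j=\frac12\dot\partial^iK^2$, so $K^2=g^{ij}p_ip_j$. Nonlinear connection: with $\gamma^i_{jk}=\frac12g^{is}(\partial_kg_{js}+\partial_jg_{sk}-\partial_sg_{jk})$, $\gamma^\circ_{jk}=\gamma^i_{jk}p_i$ and $\gamma^\circ_{j\circ}=\gamma^i_{jk}p_ip^k$, put $N_{ij}=\gamma^\circ_{ij}-\frac12\gamma^\circ_{h\circ}\dot\partial^hg_{ij}$ (symmetric in $i,j$). Then $\delta_i=\partial_i+N_{ij}\dot\partial^j$ and $\dot\partial^i$ form a local frame of $T(T^{*}M_0)$ with dual coframe $dx^i$, $\delta p_i=dp_i-N_{ji}dx^j$. Define $R_{kij}$ by $[\delta_i,\delta_j]=R_{kij}\dot\partial^k$, i.e. $R_{kij}=\delta_iN_{jk}-\delta_jN_{ik}$. $(M,K)$ has constant flag curvature $c$ if $R_{hjk}p^j=c\,(K^2g_{hk}-p_hp_k)$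 on $T^{*}M_0$ for all $h,k$. The matrix $(G_{ij})$ is positive definite exactly where $\alpha+2\tau v>0$ (given $\alpha,\beta>0$). Kähler manifold means: $J$ is an integrable almost complex structure, $G$ is a $J$-Hermitian Riemannian metric, and the 2-form $G(X,JY)$ is closed. *)

theory Defs
  imports "HOL-Analysis.Analysis"
begin

section \<open>Smooth maps between open subsets of Euclidean spaces\<close>

abbreviation D ::
    "('e::euclidean_space \<Rightarrow> 'f::euclidean_space) \<Rightarrow> 'e \<Rightarrow> 'e \<Rightarrow> 'f" where
  "D f z \<equiv> frechet_derivative f (at z)"

(* To be used on open sets only: the derivatives are two-sided. *)
fun times_cont_diff_on ::
    "nat \<Rightarrow> 'e::euclidean_space set \<Rightarrow> ('e \<Rightarrow> 'f::euclidean_space) \<Rightarrow> bool" where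
  "times_cont_diff_on 0 S f \<longleftrightarrow> continuous_on S f"
| "times_cont_diff_on (Suc k) S f \<longleftrightarrow>
     (\<forall>z\<in>S. f differentiable (at z)) \<and> (\<forall>v. times_cont_diff_on k S (\<lambda>z. D f z v))"

definition smooth_on :: "'e::euclidean_space set \<Rightarrow> ('e \<Rightarrow> 'f::euclidean_space) \<Rightarrow> bool" where
  "smooth_on S f \<longleftrightarrow> (\<forall>k. times_cont_diff_on k S f)"


section \<open>Smooth manifolds\<close>

(* A manifold is given by an atlas on its set of points.  A chart is a pair (U, \<phi>) of its
   domain and its coordinate map; the values of \<phi> outside U are irrelevant. *)
type_synonym ('a, 'e) chart = "'a set \<times> ('a \<Rightarrow> 'e)"

definition points :: "('a, 'e) chart set \<Rightarrow> 'a set" where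
  "points A = (\<Union>c\<in>A. fst c)"

definition coord_range :: "('a, 'e) chart \<Rightarrow> 'e set" where
  "coord_range c = snd c ` fst c"

definition coord_inv :: "('a, 'e) chart \<Rightarrow> 'e \<Rightarrow> 'a" where
  "coord_inv c = inv_into (fst c) (snd c)"

definition overlap :: "('a, 'e) chart \<Rightarrow> ('a, 'e) chart \<Rightarrow> 'e set" where
  "overlap c d = snd c ` (fst c \<inter> fst d)"

definition transition :: "('a, 'e) chart \<Rightarrow> ('a, 'e) chart \<Rightarrow> 'e \<Rightarrow> 'e" where
  "transition c d = snd d \<circ> coord_inv c"

(* The topology for which all chart domains are open and all charts are homeomorphisms onto
   their ranges. *)
definition atlas_topology :: "('a, 'e::euclidean_space) chart set \<Rightarrow> 'a topology" where
  "atlas_topology A = topology_generated_by {fst c \<inter> snd c -` V | c V. c \<in> A \<and> open V}"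

definition smooth_manifold :: "('a, 'e::euclidean_space) chart set \<Rightarrow> bool" where
  "smooth_manifold A \<longleftrightarrow>
     (\<forall>c\<in>A. inj_on (snd c) (fst c) \<and> open (coord_range c)) \<and>
     (\<forall>c\<in>A. \<forall>d\<in>A. open (overlap c d) \<and> smooth_on (overlap c d) (transition c d)) \<and>
     Hausdorff_space (atlas_topology A) \<and>
     second_countable (atlas_topology A)"

(* The induced atlas on a subset W of the points; meant for open W. *)
definition restrict_atlas :: "('a, 'e) chart set \<Rightarrow> 'a set \<Rightarrow> ('a, 'e) chart set" where
  "restrict_atlas A W = {(U \<inter> W, \<phi>) | U \<phi>. (U, \<phi>) \<in> A}"

definition smooth_function :: "('a, 'e::euclidean_space) chart set \<Rightarrow> ('a \<Rightarrow> real) \<Rightarrow> bool" where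
  "smooth_function A f \<longleftrightarrow> (\<forall>c\<in>A. smooth_on (coord_range c) (f \<circ> coord_inv c))"


section \<open>The cotangent bundle\<close>

(* A covector at x is the family of its component vectors p in all charts around x, subject to
   the transformation law p_i = (\<partial>y^j / \<partial>x^i) q_j; components in the remaining charts are set to 0. *)
type_synonym ('a, 'e) covector = "('a, 'e) chart \<Rightarrow> 'e"

definition cotangent_space ::
    "('a, 'e::euclidean_space) chart set \<Rightarrow> 'a \<Rightarrow> ('a, 'e) covector set" where
  "cotangent_space A x = {\<omega>.
     (\<forall>c. \<not> (c \<in> A \<and> x \<in> fst c) \<longrightarrow> \<omega> c = 0) \<and>
     (\<forall>c\<in>A. \<forall>d\<in>A. x \<in> fst c \<longrightarrow> x \<in> fst d \<longrightarrow>
        (\<forall>v. \<omega> c \<bullet> v = \<omega> d \<bullet> D (transition c d) (snd c x) v))}"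

definition cotangent_bundle ::
    "('a, 'e::euclidean_space) chart set \<Rightarrow> ('a \<times> ('a, 'e) covector) set" where
  "cotangent_bundle A = {(x, \<omega>). x \<in> points A \<and> \<omega> \<in> cotangent_space A x}"

definition slit_cotangent_bundle ::
    "('a, 'e::euclidean_space) chart set \<Rightarrow> ('a \<times> ('a, 'e) covector) set" where
  "slit_cotangent_bundle A = {(x, \<omega>) \<in> cotangent_bundle A. \<omega> \<noteq> (\<lambda>_. 0)}"

definition cotangent_chart ::
    "('a, 'e::euclidean_space) chart set \<Rightarrow> ('a, 'e) chart
      \<Rightarrow> ('a \<times> ('a, 'e) covector, 'e \<times> 'e) chart" where
  "cotangent_chart A c = ({(x, \<omega>) \<in> cotangent_bundle A. x \<in> fst c}, \<lambda>(x, \<omega>). (snd c x, \<omega> c))"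

definition cotangent_atlas ::
    "('a, 'e::euclidean_space) chart set
      \<Rightarrow> ('a \<times> ('a, 'e) covector, 'e \<times> 'e) chart set" where
  "cotangent_atlas A = cotangent_chart A ` A"

definition slit_cotangent_atlas ::
    "('a, 'e::euclidean_space) chart set
      \<Rightarrow> ('a \<times> ('a, 'e) covector, 'e \<times> 'e) chart set" where
  "slit_cotangent_atlas A = restrict_atlas (cotangent_atlas A) (slit_cotangent_bundle A)"


section \<open>Local geometry of a Cartan space\<close>

(* Below, F is the expression of K in induced coordinates z = (x, p) on the cotangent bundle. *)
type_synonym 'n phase = "(real^'n) \<times> (real^'n)"

definition dx :: "'n::finite \<Rightarrow> ('n phase \<Rightarrow> real) \<Rightarrow> 'n phase \<Rightarrow> real" where
  "dx i f z = D f z (axis i 1, 0)"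

definition dp :: "'n::finite \<Rightarrow> ('n phase \<Rightarrow> real) \<Rightarrow> 'n phase \<Rightarrow> real" where
  "dp i f z = D f z (0, axis i 1)"

definition g_up :: "('n::finite phase \<Rightarrow> real) \<Rightarrow> 'n phase \<Rightarrow> real^'n^'n" where
  "g_up F z = (\<chi> i j. 1/2 * dp i (dp j (\<lambda>y. (F y)^2)) z)"

definition g_low :: "('n::finite phase \<Rightarrow> real) \<Rightarrow> 'n phase \<Rightarrow> real^'n^'n" where
  "g_low F z = matrix_inv (g_up F z)"

definition p_low :: "'n::finite phase \<Rightarrow> 'n \<Rightarrow> real" where
  "p_low z i = snd z $ i"

definition p_up :: "('n::finite phase \<Rightarrow> real) \<Rightarrow> 'n phase \<Rightarrow> 'n \<Rightarrow> real" where
  "p_up F z i = (\<Sum>j\<in>UNIV. g_up F z $ i $ j * p_low z j)"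

(* christoffel F i j k = \<gamma>^i_{jk} *)
definition christoffel ::
    "('n::finite phase \<Rightarrow> real) \<Rightarrow> 'n \<Rightarrow> 'n \<Rightarrow> 'n \<Rightarrow> 'n phase \<Rightarrow> real" where
  "christoffel F i j k z = 1/2 * (\<Sum>s\<in>UNIV. g_up F z $ i $ s *
     (dx k (\<lambda>y. g_low F y $ j $ s) z + dx j (\<lambda>y. g_low F y $ s $ k) z
      - dx s (\<lambda>y. g_low F y $ j $ k) z))"

definition christoffel0 ::
    "('n::finite phase \<Rightarrow> real) \<Rightarrow> 'n \<Rightarrow> 'n \<Rightarrow> 'n phase \<Rightarrow> real" where
  "christoffel0 F j k z = (\<Sum>i\<in>UNIV. christoffel F i j k z * p_low z i)"

definition christoffel00 ::
    "('n::finite phase \<Rightarrow> real) \<Rightarrow> 'n \<Rightarrow> 'n phase \<Rightarrow> real" where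
  "christoffel00 F j z = (\<Sum>k\<in>UNIV. christoffel0 F j k z * p_up F z k)"

definition nonlin_conn ::
    "('n::finite phase \<Rightarrow> real) \<Rightarrow> 'n \<Rightarrow> 'n \<Rightarrow> 'n phase \<Rightarrow> real" where
  "nonlin_conn F i j z = christoffel0 F i j z
     - 1/2 * (\<Sum>h\<in>UNIV. christoffel00 F h z * dp h (\<lambda>y. g_low F y $ i $ j) z)"

(* The adapted frame, as tangent vectors in coordinates: \<delta>_i = \<partial>_i + N_ij \<partial>/\<partial>p_j and \<partial>/\<partial>p_i. *)
definition delta_vec ::
    "('n::finite phase \<Rightarrow> real) \<Rightarrow> 'n \<Rightarrow> 'n phase \<Rightarrow> 'n phase" where
  "delta_vec F i z = (axis i 1, 0) + (\<Sum>j\<in>UNIV. nonlin_conn F i j z *\<^sub>R (0, axis j 1))"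

definition vert_vec :: "'n::finite \<Rightarrow> 'n phase" where
  "vert_vec i = (0, axis i 1)"

definition delta ::
    "('n::finite phase \<Rightarrow> real) \<Rightarrow> 'n \<Rightarrow> ('n phase \<Rightarrow> real)
      \<Rightarrow> 'n phase \<Rightarrow> real" where
  "delta F i f z = dx i f z + (\<Sum>j\<in>UNIV. nonlin_conn F i j z * dp j f z)"

(* The coframe dual to (\<delta>_i, \<partial>/\<partial>p_i), evaluated on a tangent vector X. *)
definition dx_form :: "'n::finite \<Rightarrow> 'n phase \<Rightarrow> real" where
  "dx_form i X = fst X $ i"

definition deltap_form ::
    "('n::finite phase \<Rightarrow> real) \<Rightarrow> 'n \<Rightarrow> 'n phase \<Rightarrow> 'n phase \<Rightarrow> real" where
  "deltap_form F i z X = snd X $ i - (\<Sum>j\<in>UNIV. nonlin_conn F j i z * dx_form j X)"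

(* curv F k i j = R_{kij}, the components of [\<delta>_i, \<delta>_j] *)
definition curv ::
    "('n::finite phase \<Rightarrow> real) \<Rightarrow> 'n \<Rightarrow> 'n \<Rightarrow> 'n \<Rightarrow> 'n phase \<Rightarrow> real" where
  "curv F k i j z = delta F i (nonlin_conn F j k) z - delta F j (nonlin_conn F i k) z"


section \<open>Cartan spaces\<close>

type_synonym ('a, 'n) cotangent = "'a \<times> ('a, real^'n) covector"

definition cartan_space ::
    "('a, real^'n) chart set \<Rightarrow> (('a, 'n) cotangent \<Rightarrow> real) \<Rightarrow> bool" where
  "cartan_space A K \<longleftrightarrow>
     smooth_manifold A \<and>
     (\<forall>u\<in>cotangent_bundle A. 0 \<le> K u) \<and>
     smooth_function (slit_cotangent_atlas A) K \<and>
     (\<forall>(x, \<omega>)\<in>cotangent_bundle A. \<forall>t>0. K (x, \<lambda>c. t *\<^sub>R \<omega> c) = t * K (x, \<omega>)) \<and>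
     (\<forall>c\<in>slit_cotangent_atlas A. \<forall>z\<in>coord_range c. \<forall>v. v \<noteq> 0 \<longrightarrow>
        0 < v \<bullet> (g_up (K \<circ> coord_inv c) z *v v))"

definition constant_flag_curvature ::
    "('a, real^'n) chart set \<Rightarrow> (('a, 'n) cotangent \<Rightarrow> real) \<Rightarrow> real \<Rightarrow> bool" where
  "constant_flag_curvature A K \<kappa> \<longleftrightarrow>
     (\<forall>c\<in>slit_cotangent_atlas A. \<forall>z\<in>coord_range c. \<forall>h k.
        let F = K \<circ> coord_inv c in
          (\<Sum>j\<in>UNIV. curv F h j k z * p_up F z j)
            = \<kappa> * ((F z)^2 * g_low F z $ h $ k - p_low z h * p_low z k))"


section \<open>Kaehler manifolds\<close>

(* Tensor fields are given by their expressions in the charts of the atlas, subject to the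
   transformation law. *)
type_synonym ('a, 'e) tensor02 = "('a, 'e) chart \<Rightarrow> 'e \<Rightarrow> 'e \<Rightarrow> 'e \<Rightarrow> real"
type_synonym ('a, 'e) tensor11 = "('a, 'e) chart \<Rightarrow> 'e \<Rightarrow> 'e \<Rightarrow> 'e"

definition smooth_tensor02 ::
    "('a, 'e::euclidean_space) chart set \<Rightarrow> ('a, 'e) tensor02 \<Rightarrow> bool" where
  "smooth_tensor02 A G \<longleftrightarrow>
     (\<forall>c\<in>A. (\<forall>z\<in>coord_range c. bilinear (G c z)) \<and>
             (\<forall>v w. smooth_on (coord_range c) (\<lambda>z. G c z v w))) \<and>
     (\<forall>c\<in>A. \<forall>d\<in>A. \<forall>z\<in>overlap c d. \<forall>v w.
        G d (transition c d z) (D (transition c d) z v) (D (transition c d) z w) = G c z v w)"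

definition smooth_tensor11 ::
    "('a, 'e::euclidean_space) chart set \<Rightarrow> ('a, 'e) tensor11 \<Rightarrow> bool" where
  "smooth_tensor11 A J \<longleftrightarrow>
     (\<forall>c\<in>A. (\<forall>z\<in>coord_range c. linear (J c z)) \<and>
             (\<forall>v. smooth_on (coord_range c) (\<lambda>z. J c z v))) \<and>
     (\<forall>c\<in>A. \<forall>d\<in>A. \<forall>z\<in>overlap c d. \<forall>v.
        J d (transition c d z) (D (transition c d) z v) = D (transition c d) z (J c z v))"

definition riemannian_metric ::
    "('a, 'e::euclidean_space) chart set \<Rightarrow> ('a, 'e) tensor02 \<Rightarrow> bool" where
  "riemannian_metric A G \<longleftrightarrow> smooth_tensor02 A G \<and>
     (\<forall>c\<in>A. \<forall>z\<in>coord_range c.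
        (\<forall>v w. G c z v w = G c z w v) \<and> (\<forall>v. v \<noteq> 0 \<longrightarrow> 0 < G c z v v))"

definition almost_complex_structure ::
    "('a, 'e::euclidean_space) chart set \<Rightarrow> ('a, 'e) tensor11 \<Rightarrow> bool" where
  "almost_complex_structure A J \<longleftrightarrow> smooth_tensor11 A J \<and>
     (\<forall>c\<in>A. \<forall>z\<in>coord_range c. \<forall>v. J c z (J c z v) = - v)"

definition lie_bracket ::
    "('e::euclidean_space \<Rightarrow> 'e) \<Rightarrow> ('e \<Rightarrow> 'e) \<Rightarrow> 'e \<Rightarrow> 'e" where
  "lie_bracket X Y z = D Y z (X z) - D X z (Y z)"

definition nijenhuis ::
    "('e::euclidean_space \<Rightarrow> 'e \<Rightarrow> 'e) \<Rightarrow> ('e \<Rightarrow> 'e) \<Rightarrow> ('e \<Rightarrow> 'e) \<Rightarrow> 'e \<Rightarrow> 'e" where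
  "nijenhuis j X Y z =
     lie_bracket (\<lambda>y. j y (X y)) (\<lambda>y. j y (Y y)) z
     - j z (lie_bracket (\<lambda>y. j y (X y)) Y z)
     - j z (lie_bracket X (\<lambda>y. j y (Y y)) z)
     + j z (j z (lie_bracket X Y z))"

(* Integrability is the vanishing of the Nijenhuis tensor. *)
definition integrable_structure ::
    "('a, 'e::euclidean_space) chart set \<Rightarrow> ('a, 'e) tensor11 \<Rightarrow> bool" where
  "integrable_structure A J \<longleftrightarrow>
     (\<forall>c\<in>A. \<forall>X Y. smooth_on (coord_range c) X \<longrightarrow> smooth_on (coord_range c) Y \<longrightarrow>
        (\<forall>z\<in>coord_range c. nijenhuis (J c) X Y z = 0))"

definition hermitian ::
    "('a, 'e::euclidean_space) chart set \<Rightarrow> ('a, 'e) tensor02 \<Rightarrow> ('a, 'e) tensor11 \<Rightarrow> bool" where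
  "hermitian A G J \<longleftrightarrow>
     (\<forall>c\<in>A. \<forall>z\<in>coord_range c. \<forall>v w. G c z (J c z v) (J c z w) = G c z v w)"

definition ext_deriv2 ::
    "('e::euclidean_space \<Rightarrow> 'e \<Rightarrow> 'e \<Rightarrow> real) \<Rightarrow> 'e \<Rightarrow> 'e \<Rightarrow> 'e \<Rightarrow> 'e \<Rightarrow> real" where
  "ext_deriv2 \<Omega> z u v w =
     D (\<lambda>y. \<Omega> y v w) z u - D (\<lambda>y. \<Omega> y u w) z v + D (\<lambda>y. \<Omega> y u v) z w"

definition closed_2form ::
    "('a, 'e::euclidean_space) chart set \<Rightarrow> ('a, 'e) tensor02 \<Rightarrow> bool" where
  "closed_2form A \<Omega> \<longleftrightarrow> smooth_tensor02 A \<Omega> \<and>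
     (\<forall>c\<in>A. \<forall>z\<in>coord_range c.
        (\<forall>v w. \<Omega> c z v w = - \<Omega> c z w v) \<and> (\<forall>u v w. ext_deriv2 (\<Omega> c) z u v w = 0))"

definition kaehler_manifold ::
    "('a, 'e::euclidean_space) chart set \<Rightarrow> ('a, 'e) tensor02 \<Rightarrow> ('a, 'e) tensor11 \<Rightarrow> bool" where
  "kaehler_manifold A G J \<longleftrightarrow>
     smooth_manifold A \<and>
     almost_complex_structure A J \<and> integrable_structure A J \<and>
     riemannian_metric A G \<and> hermitian A G J \<and>
     closed_2form A (\<lambda>c z v w. G c z v (J c z w))"


section \<open>The metric and the almost complex structure on the cotangent bundle\<close>

definition G_low ::
    "real \<Rightarrow> real \<Rightarrow> real \<Rightarrow> ('n::finite phase \<Rightarrow> real) \<Rightarrow> 'n phase \<Rightarrow> real^'n^'n" where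
  "G_low \<alpha> \<beta> v F z =
     (\<chi> i j. 1/\<beta> * g_low F z $ i $ j + v/(\<alpha>*\<beta>) * p_low z i * p_low z j)"

definition G_up ::
    "real \<Rightarrow> real \<Rightarrow> real \<Rightarrow> ('n::finite phase \<Rightarrow> real) \<Rightarrow> 'n phase \<Rightarrow> real^'n^'n" where
  "G_up \<alpha> \<beta> v F z = matrix_inv (G_low \<alpha> \<beta> v F z)"

definition G_metric ::
    "real \<Rightarrow> real \<Rightarrow> real \<Rightarrow> (('a, 'n::finite) cotangent \<Rightarrow> real)
      \<Rightarrow> (('a, 'n) cotangent, 'n phase) tensor02" where
  "G_metric \<alpha> \<beta> v K c z X Y = (let F = K \<circ> coord_inv c in
     (\<Sum>i\<in>UNIV. \<Sum>j\<in>UNIV. G_low \<alpha> \<beta> v F z $ i $ j * dx_form i X * dx_form j Y)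
     + (\<Sum>i\<in>UNIV. \<Sum>j\<in>UNIV.
          G_up \<alpha> \<beta> v F z $ i $ j * deltap_form F i z X * deltap_form F j z Y))"

(* The linear map with \<delta>_i \<mapsto> G_ik \<partial>/\<partial>p_k and \<partial>/\<partial>p_i \<mapsto> - G^ik \<delta>_k. *)
definition J_structure ::
    "real \<Rightarrow> real \<Rightarrow> real \<Rightarrow> (('a, 'n::finite) cotangent \<Rightarrow> real)
      \<Rightarrow> (('a, 'n) cotangent, 'n phase) tensor11" where
  "J_structure \<alpha> \<beta> v K c z X = (let F = K \<circ> coord_inv c in
     (\<Sum>i\<in>UNIV. dx_form i X *\<^sub>R (\<Sum>k\<in>UNIV. G_low \<alpha> \<beta> v F z $ i $ k *\<^sub>R vert_vec k))
     + (\<Sum>i\<in>UNIV. deltap_form F i z X *\<^sub>R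
          (- (\<Sum>k\<in>UNIV. G_up \<alpha> \<beta> v F z $ i $ k *\<^sub>R delta_vec F k z))))"

end

theory Submission
  imports Defs
begin

text \<open>
  In a chart put \<open>H = K\<^sup>2/2\<close>, let \<open>S\<close> be the Hamiltonian field of \<open>H\<close>, \<open>C\<close> the Liouville field and
  \<open>V\<^sub>j = g\<^sub>j\<^sub>k \<partial>/\<partial>p\<^sub>k\<close>. In the coordinates \<open>(x\<^sup>i, p\<^sup>i)\<close> the \<open>V\<^sub>j\<close> and the remaining coordinate fields \<open>E\<^sub>j\<close>
  commute, and \<open>2 \<delta>\<^sub>j = E\<^sub>j + [V\<^sub>j, S]\<close>. The Jacobi identity then shows that \<open>[\<delta>\<^sub>i, V\<^sub>j]\<close> is symmetric in
  \<open>i, j\<close> and that \<open>[C, \<delta>\<^sub>i] = 0\<close>, hence the cyclic sum of \<open>[[\<delta>\<^sub>i, \<delta>\<^sub>j], V\<^sub>l]\<close> vanishes. Contracted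
  with the Liouville direction, this identity turns constant flag curvature into
  \<open>[\<delta>\<^sub>i, \<delta>\<^sub>j] = c (p\<^sub>i V\<^sub>j - p\<^sub>j V\<^sub>i)\<close>, which for \<open>v = - c \<alpha> \<beta>\<^sup>2\<close> equals \<open>[J \<delta>\<^sub>i, J \<delta>\<^sub>j]\<close>; together with the
  symmetry of \<open>[\<delta>\<^sub>i, J \<delta>\<^sub>j]\<close> this makes the Nijenhuis tensor vanish. The fundamental form is
  \<open>dp\<^sub>i \<and> dx\<^sup>i\<close> because \<open>N\<^sub>i\<^sub>j\<close> is symmetric, and \<open>G\<close> is positive on the tube by the Cauchy-Schwarz
  inequality for \<open>g\<close>.
\<close>

section \<open>Calculus of smooth maps\<close>

text \<open>The obstacle is the explicit formula for \<open>nonlin_conn\<close>: a direct check of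
  the symmetry of \<open>[\<delta>_i, V_j]\<close> would run through fourth derivatives of
  \<open>F^2\<close>. The way out is that the formula hides the derivative of \<open>g_ij\<close>
  along \<open>S\<close>; this makes the connection a bracket with \<open>S\<close> and leaves only
  Jacobi identities. The coordinates \<open>(x^i, p^i)\<close> are never set up as a chart. A
  vertical vector is recovered from the derivative of the Legendre map along it, so their coordinate
  fields are handled inside \<open>(x, p)\<close>. The origin of \<open>v\<close>: \<open>J
  \<delta>_u = (1/\<beta>) V_u + (v/(\<alpha>\<beta>)) (p.u) C\<close>. The \<open>V_u\<close>
  commute and \<open>[C, V_u] = - V_u\<close>, so brackets of these fields see only the product
  \<open>v/(\<alpha>\<beta>^2)\<close>, which has to be \<open>- c\<close>. Then
  \<open>\<alpha> + 2 \<tau> v = \<alpha> (1 - c \<beta>^2 K^2)\<close>, which is the tube condition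
  for \<open>c > 0\<close> and automatic for \<open>c < 0\<close>. Since \<open>G\<close> and
  \<open>J\<close> are given chart by chart, their consistency has to be proved. It rests on the
  invariance of \<open>S\<close>, from which the inhomogeneous transformation law of
  \<open>N_ij\<close> follows.\<close>

lemma D_eqI: "(f has_derivative f') (at z) \<Longrightarrow> D f z = f'"
  using frechet_derivative_at by blast

lemma D_cong_open:
  assumes "open S" "z \<in> S" "\<And>y. y \<in> S \<Longrightarrow> f y = g y" "f differentiable at z"
  shows "D f z = D g z"
  using assms frechet_derivative_transform_within_open by blast

lemma differentiable_cong_open:
  assumes "open S" "z \<in> S" "\<And>y. y \<in> S \<Longrightarrow> f y = g y" "f differentiable at z"
  shows "g differentiable at z"
  using assms has_derivative_transform_within_open unfolding differentiable_def by metis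

text \<open>Openness of \<open>S\<close> lets agreement on \<open>S\<close> pass to the two-sided
  directional derivatives, at every order.\<close>

lemma cont_diff_cong:
  assumes "open S" "times_cont_diff_on k S f" "\<And>z. z \<in> S \<Longrightarrow> f z = g z"
  shows "times_cont_diff_on k S g"
  using assms(2,3)
proof (induction k arbitrary: f g)
  case 0
  then show ?case by (simp cong: continuous_on_cong)
next
  case (Suc k)
  have "times_cont_diff_on k S (\<lambda>z. D g z v)" for v
  proof (rule Suc.IH)
    show "times_cont_diff_on k S (\<lambda>z. D f z v)" using Suc.prems by simp
    show "D f z v = D g z v" if "z \<in> S" for z
      using D_cong_open[OF assms(1) that, of f g] Suc.prems that by simp
  qed
  moreover have "g differentiable at z" if "z \<in> S" for z
    using differentiable_cong_open[OF assms(1) that, of f g] Suc.prems that by simp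
  ultimately show ?case by simp
qed

lemma cont_diff_subset:
  "times_cont_diff_on k S f \<Longrightarrow> T \<subseteq> S \<Longrightarrow> times_cont_diff_on k T f"
  by (induction k arbitrary: f) (auto intro: continuous_on_subset)

lemma cont_diff_Suc_D: "times_cont_diff_on (Suc k) S f \<Longrightarrow> times_cont_diff_on k S f"
  by (induction k arbitrary: f)
    (auto intro!: differentiable_imp_continuous_on differentiable_at_imp_differentiable_on)

lemma cont_diff_const: "times_cont_diff_on k S (\<lambda>z. a)"
  by (induction k arbitrary: a) auto

lemma cont_diff_linear:
  assumes "bounded_linear L" "open S" "times_cont_diff_on k S f"
  shows "times_cont_diff_on k S (\<lambda>z. L (f z))"
  using assms(3)
proof (induction k arbitrary: f)
  case 0
  then show ?case using assms(1) by (simp add: bounded_linear.continuous_on)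
next
  case (Suc k)
  have der: "((\<lambda>z. L (f z)) has_derivative (\<lambda>v. L (D f z v))) (at z)" if "z \<in> S" for z
    using Suc.prems that
    by (intro bounded_linear.has_derivative[OF assms(1)]) (auto simp: frechet_derivative_works)
  have "times_cont_diff_on k S (\<lambda>z. D (\<lambda>z. L (f z)) z v)" for v
  proof (rule cont_diff_cong[OF assms(2)])
    show "times_cont_diff_on k S (\<lambda>z. L (D f z v))" using Suc by simp
    show "L (D f z v) = D (\<lambda>z. L (f z)) z v" if "z \<in> S" for z
      using D_eqI[OF der[OF that]] by simp
  qed
  then show ?case using der by (auto simp: differentiable_def)
qed

lemma cont_diff_add:
  assumes "open S" "times_cont_diff_on k S f" "times_cont_diff_on k S g"
  shows "times_cont_diff_on k S (\<lambda>z. f z + g z)"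
  using assms(2,3)
proof (induction k arbitrary: f g)
  case 0
  then show ?case by (simp add: continuous_on_add)
next
  case (Suc k)
  have der: "((\<lambda>z. f z + g z) has_derivative (\<lambda>v. D f z v + D g z v)) (at z)" if "z \<in> S" for z
    using Suc.prems that by (intro has_derivative_add) (auto simp: frechet_derivative_works)
  have "times_cont_diff_on k S (\<lambda>z. D (\<lambda>z. f z + g z) z v)" for v
  proof (rule cont_diff_cong[OF assms(1)])
    show "times_cont_diff_on k S (\<lambda>z. D f z v + D g z v)" using Suc by simp
    show "D f z v + D g z v = D (\<lambda>z. f z + g z) z v" if "z \<in> S" for z
      using D_eqI[OF der[OF that]] by simp
  qed
  then show ?case using der by (auto simp: differentiable_def)
qed

lemma cont_diff_sum:
  assumes "open S" "\<And>i. i \<in> I \<Longrightarrow> times_cont_diff_on k S (f i)"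
  shows "times_cont_diff_on k S (\<lambda>z. \<Sum>i\<in>I. f i z)"
  using assms(2)
  by (induction I rule: infinite_finite_induct)
    (auto intro!: cont_diff_add assms(1) cont_diff_const)

text \<open>The Leibniz rule gives two values of \<open>B\<close>, each pairing a derivative with an
  undifferentiated function; hence both functions must vary in the induction.\<close>

lemma cont_diff_bilinear:
  assumes "bounded_bilinear B" "open S" "times_cont_diff_on k S f" "times_cont_diff_on k S g"
  shows "times_cont_diff_on k S (\<lambda>z. B (f z) (g z))"
  using assms(3,4)
proof (induction k arbitrary: f g)
  case 0
  then show ?case using assms(1) by (simp add: bounded_bilinear.continuous_on)
next
  case (Suc k)
  have der: "((\<lambda>z. B (f z) (g z)) has_derivative (\<lambda>v. B (f z) (D g z v) + B (D f z v) (g z))) (at z)"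
    if "z \<in> S" for z
    using Suc.prems that
    by (intro bounded_bilinear.FDERIV[OF assms(1)]) (auto simp: frechet_derivative_works)
  have "times_cont_diff_on k S (\<lambda>z. D (\<lambda>z. B (f z) (g z)) z v)" for v
  proof (rule cont_diff_cong[OF assms(2)])
    show "times_cont_diff_on k S (\<lambda>z. B (f z) (D g z v) + B (D f z v) (g z))"
      using Suc.prems Suc.prems[THEN cont_diff_Suc_D]
      by (intro cont_diff_add Suc.IH assms(2)) auto
    show "B (f z) (D g z v) + B (D f z v) (g z) = D (\<lambda>z. B (f z) (g z)) z v" if "z \<in> S" for z
      using D_eqI[OF der[OF that]] by simp
  qed
  then show ?case using der by (auto simp: differentiable_def)
qed

lemma linear_expand_Basis:
  fixes L :: "'e::euclidean_space \<Rightarrow> 'f::real_vector"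
  assumes "linear L"
  shows "L v = (\<Sum>b\<in>Basis. (v \<bullet> b) *\<^sub>R L b)"
  by (metis (no_types, lifting) assms euclidean_representation linear_cmul linear_sum sum.cong)

text \<open>The class is defined by derivatives in fixed directions, but the chain rule produces the
  moving direction \<open>D g z v\<close>. Expanding it in \<open>Basis\<close> reduces it to
  fixed-direction derivatives of \<open>f\<close>.\<close>

lemma cont_diff_compose:
  assumes "open S" "open T" "times_cont_diff_on k T f" "times_cont_diff_on k S g"
    and "\<And>z. z \<in> S \<Longrightarrow> g z \<in> T"
  shows "times_cont_diff_on k S (\<lambda>z. f (g z))"
  using assms(3,4)
proof (induction k arbitrary: f)
  case 0
  then show ?case
    using assms(5) by (auto intro: continuous_on_compose2)
next
  case (Suc k)
  have der: "((\<lambda>z. f (g z)) has_derivative (\<lambda>v. D f (g z) (D g z v))) (at z)" if "z \<in> S" for z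
    using Suc.prems that assms(5)
    by (intro has_derivative_compose[where f = g and g = f])
      (auto simp: frechet_derivative_works)
  have "times_cont_diff_on k S (\<lambda>z. D (\<lambda>z. f (g z)) z v)" for v
  proof (rule cont_diff_cong[OF assms(1)])
    have "times_cont_diff_on k S (\<lambda>z. D g z v \<bullet> b)" for b
      using Suc.prems by (intro cont_diff_linear[OF bounded_linear_inner_left assms(1)]) simp
    then show "times_cont_diff_on k S (\<lambda>z. \<Sum>b\<in>Basis. (D g z v \<bullet> b) *\<^sub>R D f (g z) b)"
      using Suc.prems Suc.prems(2)[THEN cont_diff_Suc_D]
      by (intro cont_diff_sum cont_diff_bilinear[OF bounded_bilinear_scaleR]
          Suc.IH assms(1)) auto
    show "(\<Sum>b\<in>Basis. (D g z v \<bullet> b) *\<^sub>R D f (g z) b) = D (\<lambda>z. f (g z)) z v" if "z \<in> S" for z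
      using D_eqI[OF der[OF that]] Suc.prems(1) assms(5)[OF that]
        linear_expand_Basis[OF linear_frechet_derivative, of f "at (g z)" "D g z v"] by simp
  qed
  then show ?case using der by (auto simp: differentiable_def)
qed

text \<open>The derivative contains the inverse again, so the induction hypothesis is used for the
  same \<open>f\<close>, one order lower.\<close>

lemma cont_diff_inverse:
  fixes f :: "'e::euclidean_space \<Rightarrow> real"
  assumes "open S" "times_cont_diff_on k S f" "\<And>z. z \<in> S \<Longrightarrow> f z \<noteq> 0"
  shows "times_cont_diff_on k S (\<lambda>z. inverse (f z))"
  using assms(2)
proof (induction k)
  case 0
  then show ?case using assms(3) by (auto intro: continuous_on_inverse)
next
  case (Suc k)
  have der: "((\<lambda>z. inverse (f z)) has_derivative (\<lambda>v. - (inverse (f z) * D f z v * inverse (f z)))) (at z)"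
    if "z \<in> S" for z
    using Suc.prems that assms(3)
    by (intro Deriv.has_derivative_inverse) (auto simp: frechet_derivative_works)
  have "times_cont_diff_on k S (\<lambda>z. D (\<lambda>z. inverse (f z)) z v)" for v
  proof (rule cont_diff_cong[OF assms(1)])
    have "times_cont_diff_on k S (\<lambda>z. (-1) * (inverse (f z) * D f z v * inverse (f z)))"
      using Suc.prems Suc.IH[OF cont_diff_Suc_D[OF Suc.prems]]
      by (intro cont_diff_bilinear[OF bounded_bilinear_mult] assms(1) cont_diff_const)
        auto
    then show "times_cont_diff_on k S (\<lambda>z. - (inverse (f z) * D f z v * inverse (f z)))" by simp
    show "- (inverse (f z) * D f z v * inverse (f z)) = D (\<lambda>z. inverse (f z)) z v" if "z \<in> S" for z
      using D_eqI[OF der[OF that]] by simp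
  qed
  then show ?case using der by (auto simp: differentiable_def)
qed

lemma cont_diff_bounded_linear:
  "bounded_linear L \<Longrightarrow> open S \<Longrightarrow> times_cont_diff_on k S L"
  by (cases k) (auto simp: linear_continuous_on D_eqI[OF bounded_linear_imp_has_derivative]
      cont_diff_const intro: bounded_linear_imp_differentiable)

lemma smooth_on_cong:
  "open S \<Longrightarrow> smooth_on S f \<Longrightarrow> (\<And>z. z \<in> S \<Longrightarrow> f z = g z) \<Longrightarrow> smooth_on S g"
  unfolding smooth_on_def using cont_diff_cong by blast

lemma smooth_on_subset: "smooth_on S f \<Longrightarrow> T \<subseteq> S \<Longrightarrow> smooth_on T f"
  unfolding smooth_on_def using cont_diff_subset by blast

lemma smooth_on_const [simp]: "smooth_on S (\<lambda>z. a)"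
  unfolding smooth_on_def using cont_diff_const by blast

lemma smooth_on_bounded_linear: "open S \<Longrightarrow> bounded_linear L \<Longrightarrow> smooth_on S L"
  unfolding smooth_on_def using cont_diff_bounded_linear by blast

lemma smooth_on_linear:
  "open S \<Longrightarrow> bounded_linear L \<Longrightarrow> smooth_on S f \<Longrightarrow> smooth_on S (\<lambda>z. L (f z))"
  unfolding smooth_on_def using cont_diff_linear by blast

lemma smooth_on_add:
  "open S \<Longrightarrow> smooth_on S f \<Longrightarrow> smooth_on S g \<Longrightarrow> smooth_on S (\<lambda>z. f z + g z)"
  unfolding smooth_on_def using cont_diff_add by blast

lemma smooth_on_sum:
  "open S \<Longrightarrow> (\<And>i. i \<in> I \<Longrightarrow> smooth_on S (f i)) \<Longrightarrow> smooth_on S (\<lambda>z. \<Sum>i\<in>I. f i z)"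
  unfolding smooth_on_def by (auto intro!: cont_diff_sum)

lemma smooth_on_bilinear:
  "open S \<Longrightarrow> bounded_bilinear B \<Longrightarrow> smooth_on S f \<Longrightarrow> smooth_on S g
    \<Longrightarrow> smooth_on S (\<lambda>z. B (f z) (g z))"
  unfolding smooth_on_def using cont_diff_bilinear by blast

lemmas smooth_on_scaleR = smooth_on_bilinear[OF _ bounded_bilinear_scaleR]
lemmas smooth_on_mult = smooth_on_bilinear[OF _ bounded_bilinear_mult]
  for f g :: "'e::euclidean_space \<Rightarrow> real"
lemmas smooth_on_inner = smooth_on_bilinear[OF _ bounded_bilinear_inner]

lemma smooth_on_uminus: "open S \<Longrightarrow> smooth_on S f \<Longrightarrow> smooth_on S (\<lambda>z. - f z)"
  using smooth_on_linear[OF _ bounded_linear_minus[OF bounded_linear_ident]] by blast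

lemma smooth_on_diff:
  "open S \<Longrightarrow> smooth_on S f \<Longrightarrow> smooth_on S g \<Longrightarrow> smooth_on S (\<lambda>z. f z - g z)"
  using smooth_on_add[of S f "\<lambda>z. - g z"] smooth_on_uminus by auto

lemma smooth_on_prod:
  fixes f :: "'i \<Rightarrow> 'e::euclidean_space \<Rightarrow> real"
  assumes "open S" "\<And>i. i \<in> I \<Longrightarrow> smooth_on S (f i)"
  shows "smooth_on S (\<lambda>z. \<Prod>i\<in>I. f i z)"
  using assms(2)
  by (induction I rule: infinite_finite_induct) (auto intro!: smooth_on_mult assms(1))

lemma smooth_on_inverse:
  fixes f :: "'e::euclidean_space \<Rightarrow> real"
  shows "open S \<Longrightarrow> smooth_on S f \<Longrightarrow> (\<And>z. z \<in> S \<Longrightarrow> f z \<noteq> 0) \<Longrightarrow> smooth_on S (\<lambda>z. inverse (f z))"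
  unfolding smooth_on_def using cont_diff_inverse by blast

lemma smooth_on_compose:
  "open S \<Longrightarrow> open T \<Longrightarrow> smooth_on T f \<Longrightarrow> smooth_on S g \<Longrightarrow> (\<And>z. z \<in> S \<Longrightarrow> g z \<in> T)
    \<Longrightarrow> smooth_on S (\<lambda>z. f (g z))"
  unfolding smooth_on_def using cont_diff_compose by blast

lemma smooth_on_fst: "open S \<Longrightarrow> smooth_on S f \<Longrightarrow> smooth_on S (\<lambda>z. fst (f z))"
  using smooth_on_linear[OF _ bounded_linear_fst] by blast

lemma smooth_on_snd: "open S \<Longrightarrow> smooth_on S f \<Longrightarrow> smooth_on S (\<lambda>z. snd (f z))"
  using smooth_on_linear[OF _ bounded_linear_snd] by blast

lemma smooth_on_ident: "open S \<Longrightarrow> smooth_on S (\<lambda>z. z)"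
  using smooth_on_bounded_linear[OF _ bounded_linear_ident] by blast

lemma smooth_on_Pair:
  assumes "open S" "smooth_on S f" "smooth_on S g"
  shows "smooth_on S (\<lambda>z. (f z, g z))"
proof -
  have "smooth_on S (\<lambda>z. (f z, 0) + (0, g z))"
    using assms by (intro smooth_on_add smooth_on_linear[of S "\<lambda>x. (x, 0)"]
        smooth_on_linear[of S "\<lambda>x. (0, x)"] bounded_linear_Pair bounded_linear_ident bounded_linear_zero)
  then show ?thesis by simp
qed

lemma smooth_on_nth: "open S \<Longrightarrow> smooth_on S f \<Longrightarrow> smooth_on S (\<lambda>z. f z $ i)"
  using smooth_on_linear[OF _ bounded_linear_vec_nth] by blast

lemma smooth_on_vec:
  fixes f :: "'n::finite \<Rightarrow> 'e::euclidean_space \<Rightarrow> 'f::euclidean_space"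
  assumes "open S" "\<And>i. smooth_on S (f i)"
  shows "smooth_on S (\<lambda>z. \<chi> i. f i z)"
proof -
  have lin: "bounded_linear (axis i :: 'f \<Rightarrow> 'f^'n)" for i
    by (intro linear_conv_bounded_linear[THEN iffD1] linearI) (auto simp: vec_eq_iff axis_def)
  have "smooth_on S (\<lambda>z. \<Sum>i\<in>UNIV. axis i (f i z))"
    using assms by (intro smooth_on_sum smooth_on_linear[OF _ lin])
  moreover have "(\<Sum>i\<in>UNIV. axis i (f i z)) = (\<chi> i. f i z)" for z
    by (simp add: vec_eq_iff axis_def if_distrib cong: if_cong)
  ultimately show ?thesis by simp
qed

lemma smooth_on_matrixI:
  fixes M :: "'e::euclidean_space \<Rightarrow> real^'n^'m"
  assumes "open S" "\<And>i j. smooth_on S (\<lambda>z. M z $ i $ j)"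
  shows "smooth_on S M"
proof -
  have "smooth_on S (\<lambda>z. \<chi> i j. M z $ i $ j)"
    using assms by (intro smooth_on_vec)
  then show ?thesis by simp
qed

section \<open>Smooth matrix fields and their inverses\<close>

lemma bounded_bilinear_matrix_vector_mult:
  "bounded_bilinear ((*v) :: real^'n^'m \<Rightarrow> _)"
  by (intro bilinear_conv_bounded_bilinear[THEN iffD1])
    (auto simp: bilinear_def intro!: linearI simp: vec_eq_iff matrix_vector_mult_def
      sum.distrib sum_distrib_left algebra_simps)

lemmas smooth_matrix_vector_mult = smooth_on_bilinear[OF _ bounded_bilinear_matrix_vector_mult]

lemma smooth_on_det:
  fixes M :: "'e::euclidean_space \<Rightarrow> real^'n^'n"
  assumes "open S" "smooth_on S M"
  shows "smooth_on S (\<lambda>z. det (M z))"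
  unfolding det_def using assms
  by (intro smooth_on_sum smooth_on_mult smooth_on_prod smooth_on_const smooth_on_nth)

lemma matrix_inv_mult:
  fixes A :: "real^'n^'n"
  assumes "invertible A"
  shows "A ** matrix_inv A = mat 1" "matrix_inv A ** A = mat 1"
  using assms unfolding invertible_def matrix_inv_def by (metis (mono_tags, lifting) someI_ex)+

lemma matrix_inv_vector_mult:
  fixes A :: "real^'n^'n"
  assumes "invertible A"
  shows "A *v (matrix_inv A *v x) = x" "matrix_inv A *v (A *v x) = x"
  using matrix_inv_mult[OF assms] by (simp_all add: matrix_vector_mul_assoc)

text \<open>Cramer's rule: every entry of the inverse is a quotient of determinants, which are
  polynomials in the entries.\<close>

lemma smooth_on_matrix_inv:
  fixes M :: "'e::euclidean_space \<Rightarrow> real^'n^'n"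
  assumes "open S" "smooth_on S M" "\<And>z. z \<in> S \<Longrightarrow> invertible (M z)"
  shows "smooth_on S (\<lambda>z. matrix_inv (M z))"
proof (rule smooth_on_matrixI[OF assms(1)])
  fix k l
  \<comment> \<open>Column \<open>k\<close> of \<open>M\<close> is replaced by
    \<open>axis l 1\<close>, so that Cramer's rule solves for entry \<open>(k, l)\<close> of the
    inverse.\<close>
  define B where "B = (\<lambda>z. (\<chi> i j. if j = k then axis l 1 $ i else M z $ i $ j) :: real^'n^'n)"
  have "smooth_on S B"
  proof (unfold B_def, intro smooth_on_vec assms(1))
    show "smooth_on S (\<lambda>z. if j = k then axis l 1 $ i else M z $ i $ j)" for i j
      using smooth_on_nth[OF assms(1) smooth_on_nth[OF assms(1,2)]] by (cases "j = k") simp_all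
  qed
  then have sm: "smooth_on S (\<lambda>z. det (B z) * inverse (det (M z)))"
    using assms by (intro smooth_on_mult smooth_on_inverse smooth_on_det)
      (auto simp: invertible_det_nz)
  have "det (B z) * inverse (det (M z)) = matrix_inv (M z) $ k $ l" if "z \<in> S" for z
  proof -
    have "M z *v (matrix_inv (M z) *v axis l 1) = axis l 1"
      using matrix_inv_vector_mult assms(3)[OF that] by blast
    then have "(matrix_inv (M z) *v axis l 1) $ k = det (B z) / det (M z)"
      using cramer[of "M z" "matrix_inv (M z) *v axis l 1" "axis l 1"] assms(3)[OF that]
      by (simp add: invertible_det_nz B_def vec_eq_iff)
    then show ?thesis by (simp add: matrix_vector_mul_component inner_axis divide_inverse)
  qed
  then show "smooth_on S (\<lambda>z. matrix_inv (M z) $ k $ l)"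
    by (rule smooth_on_cong[OF assms(1) sm])
qed

lemma smooth_differentiable: "smooth_on S f \<Longrightarrow> z \<in> S \<Longrightarrow> f differentiable at z"
  unfolding smooth_on_def using times_cont_diff_on.simps(2) by blast

lemma smooth_has_derivative: "smooth_on S f \<Longrightarrow> z \<in> S \<Longrightarrow> (f has_derivative D f z) (at z)"
  using smooth_differentiable frechet_derivative_works by blast

lemma linear_D: "smooth_on S f \<Longrightarrow> z \<in> S \<Longrightarrow> linear (D f z)"
  using smooth_differentiable linear_frechet_derivative by blast

lemma smooth_on_D: "smooth_on S f \<Longrightarrow> smooth_on S (\<lambda>z. D f z v)"
  unfolding smooth_on_def using times_cont_diff_on.simps(2) by blast

lemma smooth_on_continuous: "smooth_on S f \<Longrightarrow> continuous_on S f"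
  unfolding smooth_on_def using times_cont_diff_on.simps(1) by blast

lemma smooth_on_D_field:
  assumes "open S" "smooth_on S f" "smooth_on S X"
  shows "smooth_on S (\<lambda>z. D f z (X z))"
proof (rule smooth_on_cong[OF assms(1)])
  show "smooth_on S (\<lambda>z. \<Sum>b\<in>Basis. (X z \<bullet> b) *\<^sub>R D f z b)"
    using assms by (intro smooth_on_sum smooth_on_scaleR smooth_on_inner smooth_on_const smooth_on_D)
  show "(\<Sum>b\<in>Basis. (X z \<bullet> b) *\<^sub>R D f z b) = D f z (X z)" if "z \<in> S" for z
    using linear_expand_Basis[OF linear_D[OF assms(2) that]] by metis
qed

text \<open>The first summand keeps \<open>X\<close> frozen at \<open>z\<close>; it is a pure second
  derivative of \<open>f\<close> and therefore open to the symmetry of mixed derivatives.\<close>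

lemma D_D_field:
  assumes "smooth_on S f" "smooth_on S X" "z \<in> S" "open S"
  shows "D (\<lambda>y. D f y (X y)) z v = D (\<lambda>y. D f y (X z)) z v + D f z (D X z v)"
proof -
  have lin: "linear (D f y)" if "y \<in> S" for y
    using assms(1) that by (rule linear_D)
  have expand: "D f y w = (\<Sum>b\<in>Basis. (w \<bullet> b) *\<^sub>R D f y b)" if "y \<in> S" for y w
    using linear_expand_Basis[OF lin[OF that]] by metis
  have 1: "((\<lambda>y. \<Sum>b\<in>Basis. (X y \<bullet> b) *\<^sub>R D f y b) has_derivative
      (\<lambda>v. \<Sum>b\<in>Basis. (X z \<bullet> b) *\<^sub>R D (\<lambda>y. D f y b) z v + (D X z v \<bullet> b) *\<^sub>R D f z b)) (at z)"
    using smooth_has_derivative[OF assms(2,3)] smooth_has_derivative[OF smooth_on_D[OF assms(1)] assms(3)]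
    by (auto intro!: derivative_eq_intros)
  have 2: "((\<lambda>y. \<Sum>b\<in>Basis. (X z \<bullet> b) *\<^sub>R D f y b) has_derivative
      (\<lambda>v. \<Sum>b\<in>Basis. (X z \<bullet> b) *\<^sub>R D (\<lambda>y. D f y b) z v)) (at z)"
    using smooth_has_derivative[OF smooth_on_D[OF assms(1)] assms(3)]
    by (auto intro!: derivative_eq_intros)
  have 3: "((\<lambda>y. D f y (X y)) has_derivative
      (\<lambda>v. \<Sum>b\<in>Basis. (X z \<bullet> b) *\<^sub>R D (\<lambda>y. D f y b) z v + (D X z v \<bullet> b) *\<^sub>R D f z b)) (at z)"
    by (rule has_derivative_transform_within_open[OF 1 assms(4,3)]) (simp add: expand[symmetric])
  have 4: "((\<lambda>y. D f y (X z)) has_derivative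
      (\<lambda>v. \<Sum>b\<in>Basis. (X z \<bullet> b) *\<^sub>R D (\<lambda>y. D f y b) z v)) (at z)"
    by (rule has_derivative_transform_within_open[OF 2 assms(4,3)]) (simp add: expand[symmetric])
  show ?thesis
    unfolding D_eqI[OF 3] D_eqI[OF 4] using expand[OF assms(3), of "D X z v"] by (simp add: sum.distrib)
qed

text \<open>The mean value theorem is applied twice: in direction \<open>u\<close> to the increment
  along \<open>v\<close>, then in direction \<open>v\<close> to the derivative along
  \<open>u\<close>. The bound on \<open>t\<close> keeps the parallelogram inside the ball.\<close>

lemma second_difference_mvt:
  fixes f :: "'e::euclidean_space \<Rightarrow> real"
  assumes "smooth_on (ball z r) f" "t > 0" "t * (norm u + norm v) < r"
  shows "\<exists>x\<in>ball z r. f (z + t *\<^sub>R u + t *\<^sub>R v) - f (z + t *\<^sub>R u) - (f (z + t *\<^sub>R v) - f z)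
           = t * t * D (\<lambda>y. D f y u) x v"
proof -
  have inball: "z + a *\<^sub>R u + b *\<^sub>R v \<in> ball z r" if "0 \<le> a" "a \<le> t" "0 \<le> b" "b \<le> t" for a b
  proof -
    have "norm (a *\<^sub>R u + b *\<^sub>R v) \<le> norm (a *\<^sub>R u) + norm (b *\<^sub>R v)" by (rule norm_triangle_ineq)
    also have "\<dots> \<le> t * norm u + t * norm v"
      using that by (intro add_mono) (auto intro: mult_right_mono)
    finally show ?thesis using assms(3)
      by (metis (no_types, lifting) add.assoc add_diff_cancel_left' dist_commute dist_norm
          distrib_left le_less_trans mem_ball)
  qed
  have line: "((\<lambda>s. h (z + s *\<^sub>R u + b *\<^sub>R v)) has_real_derivative D h (z + s *\<^sub>R u + b *\<^sub>R v) u) (at s)"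
    if "smooth_on (ball z r) h" "z + s *\<^sub>R u + b *\<^sub>R v \<in> ball z r" for h :: "'e \<Rightarrow> real" and s b
  proof -
    have "((\<lambda>s. h (z + s *\<^sub>R u + b *\<^sub>R v)) has_derivative
        (\<lambda>k. D h (z + s *\<^sub>R u + b *\<^sub>R v) (k *\<^sub>R u))) (at s)"
      by (rule has_derivative_compose[where f = "\<lambda>s. z + s *\<^sub>R u + b *\<^sub>R v" and g = h])
        (auto intro!: derivative_eq_intros smooth_has_derivative[OF that])
    then show ?thesis
      using linear_scale[OF linear_D[OF that]]
      by (simp add: has_field_derivative_def mult.commute[of _ "D h _ _"] mult_commute_abs)
  qed
  have "\<exists>s>0. s < t \<and>
      (f (z + t *\<^sub>R u + t *\<^sub>R v) - f (z + t *\<^sub>R u + 0 *\<^sub>R v)) - (f (z + 0 *\<^sub>R u + t *\<^sub>R v) - f (z + 0 *\<^sub>R u + 0 *\<^sub>R v))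
      = (t - 0) * (D f (z + s *\<^sub>R u + t *\<^sub>R v) u - D f (z + s *\<^sub>R u + 0 *\<^sub>R v) u)"
    using assms
    by (intro MVT2[where f = "\<lambda>s. f (z + s *\<^sub>R u + t *\<^sub>R v) - f (z + s *\<^sub>R u + 0 *\<^sub>R v)"]
        DERIV_diff line inball) auto
  then obtain s where s: "0 < s" "s < t"
    "f (z + t *\<^sub>R u + t *\<^sub>R v) - f (z + t *\<^sub>R u) - (f (z + t *\<^sub>R v) - f z)
       = t * (D f (z + s *\<^sub>R u + t *\<^sub>R v) u - D f (z + s *\<^sub>R u) u)"
    by auto
  have line': "((\<lambda>b. D f (z + s *\<^sub>R u + b *\<^sub>R v) u) has_real_derivative
      D (\<lambda>y. D f y u) (z + s *\<^sub>R u + b *\<^sub>R v) v) (at b)" if "0 \<le> b" "b \<le> t" for b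
  proof -
    have mem: "z + s *\<^sub>R u + b *\<^sub>R v \<in> ball z r" using inball that s by simp
    note sm = smooth_on_D[OF assms(1), of u]
    have "((\<lambda>b. D f (z + s *\<^sub>R u + b *\<^sub>R v) u) has_derivative
        (\<lambda>k. D (\<lambda>y. D f y u) (z + s *\<^sub>R u + b *\<^sub>R v) (k *\<^sub>R v))) (at b)"
      by (rule has_derivative_compose[where f = "\<lambda>b. z + s *\<^sub>R u + b *\<^sub>R v" and g = "\<lambda>y. D f y u"])
        (auto intro!: derivative_eq_intros smooth_has_derivative[OF sm mem])
    then show ?thesis
      using linear_scale[OF linear_D[OF sm mem]]
      by (simp add: has_field_derivative_def mult_commute_abs)
  qed
  have "\<exists>b>0. b < t \<and> D f (z + s *\<^sub>R u + t *\<^sub>R v) u - D f (z + s *\<^sub>R u + 0 *\<^sub>R v) u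
      = (t - 0) * D (\<lambda>y. D f y u) (z + s *\<^sub>R u + b *\<^sub>R v) v"
    using assms by (intro MVT2[where f = "\<lambda>b. D f (z + s *\<^sub>R u + b *\<^sub>R v) u"] line') auto
  then obtain b where "0 < b" "b < t"
    "D f (z + s *\<^sub>R u + t *\<^sub>R v) u - D f (z + s *\<^sub>R u) u = t * D (\<lambda>y. D f y u) (z + s *\<^sub>R u + b *\<^sub>R v) v"
    by auto
  then show ?thesis using s inball by (intro bexI[of _ "z + s *\<^sub>R u + b *\<^sub>R v"]) auto
qed

text \<open>The second difference of \<open>f\<close> is symmetric in \<open>u\<close> and
  \<open>v\<close>, so the two mixed derivatives take a common value at points arbitrarily near
  \<open>z\<close>; continuity forces equality at \<open>z\<close>.\<close>

lemma D_D_commute_real: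
  fixes f :: "'e::euclidean_space \<Rightarrow> real"
  assumes "open S" "smooth_on S f" "z \<in> S"
  shows "D (\<lambda>y. D f y u) z v = D (\<lambda>y. D f y v) z u"
proof (rule ccontr)
  define A where "A = (\<lambda>y. D (\<lambda>y. D f y u) y v)"
  define B where "B = (\<lambda>y. D (\<lambda>y. D f y v) y u)"
  assume "\<not> ?thesis"
  then have e: "dist (A z) (B z) / 2 > 0" by (simp add: A_def B_def)
  have "smooth_on S A" "smooth_on S B"
    unfolding A_def B_def using assms(2) by (auto intro: smooth_on_D)
  then have "continuous (at z) A" "continuous (at z) B"
    using assms continuous_on_eq_continuous_at smooth_on_continuous by blast+
  then obtain r1 r2 where r: "r1 > 0" "\<And>y. dist y z < r1 \<Longrightarrow> dist (A y) (A z) < dist (A z) (B z) / 2"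
    "r2 > 0" "\<And>y. dist y z < r2 \<Longrightarrow> dist (B y) (B z) < dist (A z) (B z) / 2"
    using e unfolding continuous_at_eps_delta by metis
  obtain r3 where r3: "r3 > 0" "ball z r3 \<subseteq> S" using assms open_contains_ball by blast
  define r where "r = min r1 (min r2 r3)"
  \<comment> \<open>The summand 1 keeps the divisor positive when \<open>u\<close> and
    \<open>v\<close> both vanish.\<close>
  define m where "m = norm u + norm v + 1"
  define t where "t = r / m / 2"
  have "r > 0" using r r3 by (simp add: r_def)
  have n: "m > 0" by (simp add: m_def add_nonneg_pos)
  have t: "t > 0" using \<open>r > 0\<close> n by (simp add: t_def)
  have "t * (norm u + norm v) \<le> t * m" using t by (simp add: m_def)
  also have "\<dots> = r / 2" using n by (simp add: t_def)
  also have "\<dots> < r" using \<open>r > 0\<close> by simp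
  finally have small: "t * (norm u + norm v) < r" .
  have sm: "smooth_on (ball z r) f"
    using r3 by (intro smooth_on_subset[OF assms(2)]) (auto simp: r_def)
  obtain x where x: "x \<in> ball z r"
    "f (z + t *\<^sub>R u + t *\<^sub>R v) - f (z + t *\<^sub>R u) - (f (z + t *\<^sub>R v) - f z) = t * t * A x"
    using second_difference_mvt[OF sm t small] unfolding A_def by blast
  obtain y where y: "y \<in> ball z r"
    "f (z + t *\<^sub>R v + t *\<^sub>R u) - f (z + t *\<^sub>R v) - (f (z + t *\<^sub>R u) - f z) = t * t * B y"
    using second_difference_mvt[OF sm t, of v u] small unfolding B_def by (auto simp: add.commute)
  have swap: "z + t *\<^sub>R v + t *\<^sub>R u = z + t *\<^sub>R u + t *\<^sub>R v" by simp
  have "t * t * A x = t * t * B y" using x(2) y(2)[unfolded swap] by linarith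
  then have "A x = B y" using t by simp
  moreover have "dist (A x) (A z) < dist (A z) (B z) / 2" "dist (B y) (B z) < dist (A z) (B z) / 2"
    using x(1) y(1) by (intro r(2) r(4); simp add: r_def dist_commute)+
  ultimately show False
    by (metis dist_commute dist_triangle_half_r order_less_irrefl)
qed

lemma D_inner:
  assumes "f differentiable at z"
  shows "D (\<lambda>y. f y \<bullet> b) z v = D f z v \<bullet> b"
proof -
  have "((\<lambda>y. f y \<bullet> b) has_derivative (\<lambda>v. D f z v \<bullet> b)) (at z)"
    using assms by (auto simp: frechet_derivative_works intro!: derivative_eq_intros)
  then show ?thesis by (simp add: D_eqI)
qed

lemma D_D_commute:
  assumes "open S" "smooth_on S f" "z \<in> S"
  shows "D (\<lambda>y. D f y u) z v = D (\<lambda>y. D f y v) z u"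
proof (rule euclidean_eqI)
  fix b :: 'b assume "b \<in> Basis"
  have sm: "smooth_on S (\<lambda>y. f y \<bullet> b)"
    using assms by (intro smooth_on_inner) auto
  have *: "D (\<lambda>y. D (\<lambda>y. f y \<bullet> b) y u) z v = D (\<lambda>y. D f y u) z v \<bullet> b" for u v
  proof -
    have "D (\<lambda>y. D (\<lambda>y. f y \<bullet> b) y u) z = D (\<lambda>y. D f y u \<bullet> b) z"
      using assms smooth_differentiable[OF smooth_on_D[OF sm] assms(3)]
      by (intro D_cong_open[OF assms(1,3)]) (auto intro!: D_inner smooth_differentiable)
    then show ?thesis
      using D_inner[OF smooth_differentiable[OF smooth_on_D[OF assms(2)] assms(3)]] by simp
  qed
  show "D (\<lambda>y. D f y u) z v \<bullet> b = D (\<lambda>y. D f y v) z u \<bullet> b"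
    using D_D_commute_real[OF assms(1) sm assms(3)] by (simp add: *)
qed

section \<open>Lie brackets and the Nijenhuis tensor\<close>

lemma D_add:
  "f differentiable at z \<Longrightarrow> g differentiable at z
    \<Longrightarrow> D (\<lambda>y. f y + g y) z v = D f z v + D g z v"
  by (simp add: D_eqI[OF has_derivative_add] frechet_derivative_works)

lemma D_diff:
  "f differentiable at z \<Longrightarrow> g differentiable at z
    \<Longrightarrow> D (\<lambda>y. f y - g y) z v = D f z v - D g z v"
  by (simp add: D_eqI[OF has_derivative_diff] frechet_derivative_works)

lemma D_uminus: "f differentiable at z \<Longrightarrow> D (\<lambda>y. - f y) z v = - D f z v"
  by (simp add: D_eqI[OF has_derivative_minus] frechet_derivative_works)

lemma D_linear:
  "bounded_linear L \<Longrightarrow> f differentiable at z \<Longrightarrow> D (\<lambda>y. L (f y)) z v = L (D f z v)"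
  by (simp add: D_eqI[OF bounded_linear.has_derivative] frechet_derivative_works)

lemma D_bounded_linear: "bounded_linear L \<Longrightarrow> D L z v = L v"
  by (simp add: D_eqI[OF bounded_linear_imp_has_derivative])

lemma D_bilinear:
  "bounded_bilinear B \<Longrightarrow> f differentiable at z \<Longrightarrow> g differentiable at z
    \<Longrightarrow> D (\<lambda>y. B (f y) (g y)) z v = B (f z) (D g z v) + B (D f z v) (g z)"
  by (simp add: D_eqI[OF bounded_bilinear.FDERIV] frechet_derivative_works)

lemmas D_scaleR = D_bilinear[OF bounded_bilinear_scaleR]
lemmas D_matrix_vector_mult = D_bilinear[OF bounded_bilinear_matrix_vector_mult]

lemma D_Pair:
  "f differentiable at z \<Longrightarrow> g differentiable at z
    \<Longrightarrow> D (\<lambda>y. (f y, g y)) z v = (D f z v, D g z v)"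
  by (simp add: D_eqI[OF has_derivative_Pair] frechet_derivative_works)

lemma D_compose:
  "g differentiable at z \<Longrightarrow> f differentiable at (g z)
    \<Longrightarrow> D (\<lambda>y. f (g y)) z v = D f (g z) (D g z v)"
  by (simp add: D_eqI[OF has_derivative_compose] frechet_derivative_works)

lemma smooth_on_lie_bracket:
  "open S \<Longrightarrow> smooth_on S X \<Longrightarrow> smooth_on S Y \<Longrightarrow> smooth_on S (lie_bracket X Y)"
  unfolding lie_bracket_def[abs_def] by (intro smooth_on_diff smooth_on_D_field)

lemma D_cong_smooth:
  "open S \<Longrightarrow> smooth_on S f \<Longrightarrow> z \<in> S \<Longrightarrow> (\<And>y. y \<in> S \<Longrightarrow> f y = g y) \<Longrightarrow> D g z = D f z"
  using D_cong_open smooth_differentiable by metis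

lemma lie_bracket_cong:
  assumes "open S" "smooth_on S X" "smooth_on S Y" "z \<in> S"
    and "\<And>y. y \<in> S \<Longrightarrow> X y = X' y" "\<And>y. y \<in> S \<Longrightarrow> Y y = Y' y"
  shows "lie_bracket X' Y' z = lie_bracket X Y z"
  unfolding lie_bracket_def
  using D_cong_smooth[OF assms(1,2,4), of X'] D_cong_smooth[OF assms(1,3,4), of Y'] assms(4-6)
  by simp

lemma lie_bracket_commute: "lie_bracket X Y z = - lie_bracket Y X z"
  by (simp add: lie_bracket_def)

lemma lie_bracket_add_left:
  assumes "smooth_on S X" "smooth_on S X'" "smooth_on S Y" "z \<in> S"
  shows "lie_bracket (\<lambda>y. X y + X' y) Y z = lie_bracket X Y z + lie_bracket X' Y z"
  using assms by (simp add: lie_bracket_def D_add smooth_differentiable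
      linear_add[OF linear_D])

lemma lie_bracket_add_right:
  assumes "smooth_on S X" "smooth_on S X'" "smooth_on S Y" "z \<in> S"
  shows "lie_bracket Y (\<lambda>y. X y + X' y) z = lie_bracket Y X z + lie_bracket Y X' z"
  using lie_bracket_add_left[OF assms]
  unfolding lie_bracket_commute[of Y "\<lambda>y. X y + X' y"] lie_bracket_commute[of Y X]
    lie_bracket_commute[of Y X'] by simp

lemma lie_bracket_scaleR_right:
  assumes "smooth_on S X" "smooth_on S Y" "smooth_on S f" "z \<in> S"
  shows "lie_bracket X (\<lambda>y. f y *\<^sub>R Y y) z = f z *\<^sub>R lie_bracket X Y z + D f z (X z) *\<^sub>R Y z"
  unfolding lie_bracket_def
    D_scaleR[OF smooth_differentiable[OF assms(3,4)] smooth_differentiable[OF assms(2,4)]]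
    linear_scale[OF linear_D[OF assms(1,4)]]
  by (simp add: scaleR_diff_right)

text \<open>The second derivatives of \<open>f\<close> cancel by symmetry. With
  \<open>f = velocity F\<close> this evaluates a bracket through the Legendre map instead of through
  its components.\<close>

lemma D_lie_bracket:
  assumes "open S" "smooth_on S X" "smooth_on S Y" "smooth_on S f" "z \<in> S"
  shows "D f z (lie_bracket X Y z)
    = D (\<lambda>y. D f y (Y y)) z (X z) - D (\<lambda>y. D f y (X y)) z (Y z)"
  unfolding lie_bracket_def D_D_field[OF assms(4,2,5,1)] D_D_field[OF assms(4,3,5,1)]
    linear_diff[OF linear_D[OF assms(4,5)]]
  using D_D_commute[OF assms(1,4,5), of "Y z" "X z"] by simp

text \<open>Compositions of first derivatives cancel in pairs; what remains is one pair of mixed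
  second derivatives for each field.\<close>

lemma lie_bracket_jacobi:
  assumes "open S" "smooth_on S X" "smooth_on S Y" "smooth_on S Z" "z \<in> S"
  shows "lie_bracket X (lie_bracket Y Z) z + lie_bracket Y (lie_bracket Z X) z
    + lie_bracket Z (lie_bracket X Y) z = 0"
proof -
  have d: "(\<lambda>y. D f y (g y)) differentiable at z" if "smooth_on S f" "smooth_on S g"
    for f g :: "'a \<Rightarrow> 'a"
    using smooth_differentiable[OF smooth_on_D_field[OF assms(1) that] assms(5)] .
  have outer: "D (lie_bracket f g) z v = D (\<lambda>y. D g y (f z)) z v + D g z (D f z v)
      - (D (\<lambda>y. D f y (g z)) z v + D f z (D g z v))"
    if "smooth_on S f" "smooth_on S g" for f g :: "'a \<Rightarrow> 'a" and v
    unfolding lie_bracket_def[abs_def] D_diff[OF d[OF that(2,1)] d[OF that]]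
      D_D_field[OF that(2,1) assms(5,1)] D_D_field[OF that assms(5,1)] ..
  show ?thesis
    unfolding lie_bracket_def[of X "lie_bracket Y Z"] lie_bracket_def[of Y "lie_bracket Z X"]
      lie_bracket_def[of Z "lie_bracket X Y"] outer[OF assms(2,3)] outer[OF assms(3,4)]
      outer[OF assms(4,2)]
    unfolding lie_bracket_def linear_diff[OF linear_D[OF assms(2,5)]]
      linear_diff[OF linear_D[OF assms(3,5)]] linear_diff[OF linear_D[OF assms(4,5)]]
    using D_D_commute[OF assms(1,2,5), of "Y z" "Z z"]
      D_D_commute[OF assms(1,3,5), of "X z" "Z z"]
      D_D_commute[OF assms(1,4,5), of "X z" "Y z"]
    by (simp add: algebra_simps)
qed

text \<open>Smoothness is known only for \<open>j y v\<close> with fixed \<open>v\<close>, so the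
  operator is expanded over \<open>Basis\<close> before the product rule applies.\<close>

lemma D_apply_field:
  assumes "open S" "\<forall>y\<in>S. linear (j y)" "\<And>v. smooth_on S (\<lambda>y. j y v)"
    and "X differentiable at z" "z \<in> S"
  shows "(\<lambda>y. j y (X y)) differentiable at z"
    and "D (\<lambda>y. j y (X y)) z v = D (\<lambda>y. j y (X z)) z v + j z (D X z v)"
proof -
  have expand: "j y w = (\<Sum>b\<in>Basis. (w \<bullet> b) *\<^sub>R j y b)" if "y \<in> S" for y w
    using linear_expand_Basis[OF assms(2)[rule_format, OF that]] by metis
  have dj: "((\<lambda>y. j y b) has_derivative D (\<lambda>y. j y b) z) (at z)" for b
    using smooth_has_derivative[OF assms(3,5)] .
  have 1: "((\<lambda>y. \<Sum>b\<in>Basis. (X y \<bullet> b) *\<^sub>R j y b) has_derivative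
      (\<lambda>v. \<Sum>b\<in>Basis. (X z \<bullet> b) *\<^sub>R D (\<lambda>y. j y b) z v + (D X z v \<bullet> b) *\<^sub>R j z b)) (at z)"
    using dj assms(4) by (auto intro!: derivative_eq_intros simp: frechet_derivative_works)
  have 2: "((\<lambda>y. \<Sum>b\<in>Basis. (X z \<bullet> b) *\<^sub>R j y b) has_derivative
      (\<lambda>v. \<Sum>b\<in>Basis. (X z \<bullet> b) *\<^sub>R D (\<lambda>y. j y b) z v)) (at z)"
    using dj by (auto intro!: derivative_eq_intros)
  have 3: "((\<lambda>y. j y (X y)) has_derivative
      (\<lambda>v. \<Sum>b\<in>Basis. (X z \<bullet> b) *\<^sub>R D (\<lambda>y. j y b) z v + (D X z v \<bullet> b) *\<^sub>R j z b)) (at z)"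
    by (rule has_derivative_transform_within_open[OF 1 assms(1,5)]) (simp add: expand[symmetric])
  have 4: "((\<lambda>y. j y (X z)) has_derivative
      (\<lambda>v. \<Sum>b\<in>Basis. (X z \<bullet> b) *\<^sub>R D (\<lambda>y. j y b) z v)) (at z)"
    by (rule has_derivative_transform_within_open[OF 2 assms(1,5)]) (simp add: expand[symmetric])
  show "D (\<lambda>y. j y (X y)) z v = D (\<lambda>y. j y (X z)) z v + j z (D X z v)"
    unfolding D_eqI[OF 3] D_eqI[OF 4] using expand[OF assms(5), of "D X z v"] by (simp add: sum.distrib)
  show "(\<lambda>y. j y (X y)) differentiable at z" using 3 by (auto simp: differentiable_def)
qed

text \<open>This is the Nijenhuis tensor evaluated on the constant extensions of \<open>u\<close>
  and \<open>w\<close>, whose own bracket vanishes.\<close>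

definition nijenhuis_at ::
    "('e::euclidean_space \<Rightarrow> 'e \<Rightarrow> 'e) \<Rightarrow> 'e \<Rightarrow> 'e \<Rightarrow> 'e \<Rightarrow> 'e" where
  "nijenhuis_at j z u w = D (\<lambda>y. j y w) z (j z u) - D (\<lambda>y. j y u) z (j z w)
     + j z (D (\<lambda>y. j y u) z w) - j z (D (\<lambda>y. j y w) z u)"

text \<open>All terms with derivatives of \<open>X\<close> or \<open>Y\<close> cancel, so the tensor
  may be tested on any convenient fields through the given values.\<close>

lemma nijenhuis_tensorial:
  assumes "open S" "\<forall>y\<in>S. linear (j y)" "\<And>v. smooth_on S (\<lambda>y. j y v)"
    and "X differentiable at z" "Y differentiable at z" "z \<in> S"
  shows "nijenhuis j X Y z = nijenhuis_at j z (X z) (Y z)"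
proof -
  note lin = assms(2)[rule_format, OF assms(6)]
  note d = D_apply_field[OF assms(1-3) _ assms(6)]
  show ?thesis
    unfolding nijenhuis_def nijenhuis_at_def lie_bracket_def d(2)[OF assms(4)] d(2)[OF assms(5)]
    by (simp add: linear_diff[OF lin] linear_add[OF lin])
qed

lemma linear_D_apply:
  fixes j :: "'e::euclidean_space \<Rightarrow> 'e \<Rightarrow> 'e"
  assumes "open S" "\<forall>y\<in>S. linear (j y)" "\<And>v. smooth_on S (\<lambda>y. j y v)" "z \<in> S"
  shows "linear (\<lambda>w. D (\<lambda>y. j y w) z v)"
proof (rule linearI)
  fix a b :: 'e and r :: real
  have d: "(\<lambda>y. j y w) differentiable at z" for w
    using smooth_differentiable[OF assms(3,4)] .
  have "D (\<lambda>y. j y (a + b)) z v = D (\<lambda>y. j y a + j y b) z v"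
    by (intro fun_cong[OF D_cong_open[OF assms(1,4) _ d]]) (simp add: linear_add[OF assms(2)[rule_format]])
  then show "D (\<lambda>y. j y (a + b)) z v = D (\<lambda>y. j y a) z v + D (\<lambda>y. j y b) z v"
    by (simp add: D_add d)
  have "D (\<lambda>y. j y (r *\<^sub>R a)) z v = D (\<lambda>y. r *\<^sub>R j y a) z v"
    by (intro fun_cong[OF D_cong_open[OF assms(1,4) _ d]]) (simp add: linear_scale[OF assms(2)[rule_format]])
  then show "D (\<lambda>y. j y (r *\<^sub>R a)) z v = r *\<^sub>R D (\<lambda>y. j y a) z v"
    by (simp add: D_linear[OF bounded_linear_scaleR_right] d)
qed

lemma nijenhuis_at_antisym: "nijenhuis_at j z u w = - nijenhuis_at j z w u"
  by (simp add: nijenhuis_at_def)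

lemma nijenhuis_at_add_right:
  assumes "open S" "\<forall>y\<in>S. linear (j y)" "\<And>v. smooth_on S (\<lambda>y. j y v)" "z \<in> S"
  shows "nijenhuis_at j z u (a + b) = nijenhuis_at j z u a + nijenhuis_at j z u b"
  using linear_add[OF linear_D_apply[OF assms]] linear_add[OF assms(2)[rule_format, OF assms(4)]]
    linear_add[OF linear_D[OF assms(3,4)]]
  by (simp add: nijenhuis_at_def)

text \<open>Differentiating \<open>j\<^sup>2 = -1\<close> shows that \<open>j\<close> anticommutes with its derivatives.\<close>
lemma nijenhuis_at_complex_right:
  assumes "open S" "\<forall>y\<in>S. linear (j y)" "\<And>v. smooth_on S (\<lambda>y. j y v)" "z \<in> S"
    and sq: "\<forall>y\<in>S. \<forall>v. j y (j y v) = - v"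
  shows "nijenhuis_at j z u (j z w) = - j z (nijenhuis_at j z u w)"
proof -
  note lin = assms(2)[rule_format, OF assms(4)]
  have dd: "(\<lambda>y. j y w) differentiable at z" for w
    using smooth_differentiable[OF assms(3,4)] .
  have anti: "D (\<lambda>y. j y (j z w)) z v = - j z (D (\<lambda>y. j y w) z v)" for w v
  proof -
    have "D (\<lambda>y. j y (j y w)) z v = 0"
      using D_cong_open[OF assms(1,4), of "\<lambda>y. j y (j y w)" "\<lambda>y. - w"] sq
        D_apply_field(1)[OF assms(1-3) dd assms(4)] by simp
    then show ?thesis
      using D_apply_field(2)[OF assms(1-3) dd assms(4)] by (simp add: eq_neg_iff_add_eq_0)
  qed
  have neg: "D (\<lambda>y. j y u) z (- w) = - D (\<lambda>y. j y u) z w" for u w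
    using linear_neg[OF linear_D[OF assms(3,4)]] .
  show ?thesis
    unfolding nijenhuis_at_def sq[rule_format, OF assms(4)] anti neg
    by (simp add: linear_diff[OF lin] linear_add[OF lin] linear_neg[OF lin] sq[rule_format, OF assms(4)])
qed

text \<open>The tensor is additive and \<open>j\<close>-antilinear in each slot, so vanishing on
  \<open>B\<close> spreads to \<open>B + j B\<close>. Taking for \<open>B\<close> the horizontal
  vectors leaves only the pairs \<open>\<delta>_i\<close>, \<open>\<delta>_j\<close> to
  compute.\<close>

lemma nijenhuis_at_eq_0:
  assumes "open S" "\<forall>y\<in>S. linear (j y)" "\<And>v. smooth_on S (\<lambda>y. j y v)" "z \<in> S"
    and sq: "\<forall>y\<in>S. \<forall>v. j y (j y v) = - v"
    and gen: "\<And>v. \<exists>a\<in>B. \<exists>b\<in>B. v = a + j z b"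
    and zero: "\<And>a b. a \<in> B \<Longrightarrow> b \<in> B \<Longrightarrow> nijenhuis_at j z a b = 0"
  shows "nijenhuis_at j z u w = 0"
proof -
  note lin0 = linear_0[OF assms(2)[rule_format, OF assms(4)]]
  note add = nijenhuis_at_add_right[OF assms(1-4)]
  note cx = nijenhuis_at_complex_right[OF assms(1-5)]
  have half: "nijenhuis_at j z a w = 0" if "a \<in> B" for a w
    using gen[of w] zero that lin0 by (auto simp: add cx)
  show ?thesis
    using gen[of u] half nijenhuis_at_antisym[of j z _ w] lin0
    by (metis add add.right_neutral cx minus_zero nijenhuis_at_antisym)
qed

section \<open>The adapted frame of a Cartan space in a chart\<close>

definition energy :: "('n::finite phase \<Rightarrow> real) \<Rightarrow> 'n phase \<Rightarrow> real" where
  "energy F z = (F z)^2 / 2"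

text \<open>The Legendre map, with components \<open>p^i\<close>: half the vertical gradient of
  \<open>K^2\<close>.\<close>

definition velocity :: "('n::finite phase \<Rightarrow> real) \<Rightarrow> 'n phase \<Rightarrow> real^'n" where
  "velocity F z = (\<chi> i. D (energy F) z (0, axis i 1))"

definition force :: "('n::finite phase \<Rightarrow> real) \<Rightarrow> 'n phase \<Rightarrow> real^'n" where
  "force F z = (\<chi> i. D (energy F) z (axis i 1, 0))"

definition conn :: "('n::finite phase \<Rightarrow> real) \<Rightarrow> 'n phase \<Rightarrow> real^'n^'n" where
  "conn F z = (\<chi> i j. nonlin_conn F i j z)"

definition spray :: "('n::finite phase \<Rightarrow> real) \<Rightarrow> 'n phase \<Rightarrow> 'n phase" where
  "spray F z = (velocity F z, - force F z)"

definition liouville :: "'n::finite phase \<Rightarrow> 'n phase" where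
  "liouville z = (0, snd z)"

text \<open>A constant vector \<open>u\<close> stands for the contraction \<open>u^j V_j\<close>;
  the same convention for \<open>hor\<close> and \<open>legendre_hor\<close> replaces index
  computations by linear algebra.\<close>

definition vert :: "('n::finite phase \<Rightarrow> real) \<Rightarrow> real^'n \<Rightarrow> 'n phase \<Rightarrow> 'n phase" where
  "vert F u z = (0, g_low F z *v u)"

text \<open>The product contracts the second index of \<open>conn\<close>, whereas
  \<open>delta_vec\<close> keeps the first index fixed and sums over the second; the two agree by
  \<open>conn_sym\<close>.\<close>

definition hor :: "('n::finite phase \<Rightarrow> real) \<Rightarrow> real^'n \<Rightarrow> 'n phase \<Rightarrow> 'n phase" where
  "hor F u z = (u, conn F z *v u)"

text \<open>The coordinate field \<open>\<partial>/\<partial>x\<close> of the coordinates \<open>(x\<^sup>i, p\<^sup>i)\<close> given by the Legendre map.\<close>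
definition legendre_hor :: "('n::finite phase \<Rightarrow> real) \<Rightarrow> real^'n \<Rightarrow> 'n phase \<Rightarrow> 'n phase" where
  "legendre_hor F u z = (u, - (g_low F z *v D (velocity F) z (u, 0)))"

lemma linear_expand_axis:
  fixes L :: "real^'n \<Rightarrow> 'f::real_vector"
  assumes "linear L"
  shows "L q = (\<Sum>i\<in>UNIV. q $ i *\<^sub>R L (axis i 1))"
proof -
  have "L q = L (\<Sum>i\<in>UNIV. q $ i *\<^sub>R axis i 1)"
    using basis_expansion[of q] by (simp add: scalar_mult_eq_scaleR)
  then show ?thesis by (simp add: linear_sum[OF assms] linear_scale[OF assms])
qed

lemma linear_Pair_left: "linear L \<Longrightarrow> linear (\<lambda>a. L (a, 0))"
  and linear_Pair_right: "linear L \<Longrightarrow> linear (\<lambda>b. L (0, b))"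
  by (rule linear_compose[unfolded o_def]; (assumption | (rule linearI; simp)))+

lemma pos_def_invertible:
  fixes A :: "real^'n^'n"
  assumes "\<And>v. v \<noteq> 0 \<Longrightarrow> 0 < v \<bullet> (A *v v)"
  shows "invertible A"
proof -
  have "inj ((*v) A)"
  proof (rule injI)
    fix x y assume "A *v x = A *v y"
    then have "(x - y) \<bullet> (A *v (x - y)) = 0" by (simp add: matrix_vector_mult_diff_distrib)
    then show "x = y" using assms[of "x - y"] by fastforce
  qed
  then show ?thesis
    by (simp add: invertible_left_inverse matrix_left_invertible_injective)
qed

lemma inner_matrix_inv_sym:
  fixes A :: "real^'n^'n"
  assumes "invertible A" "\<And>q r. (A *v q) \<bullet> r = q \<bullet> (A *v r)"
  shows "(matrix_inv A *v q) \<bullet> r = q \<bullet> (matrix_inv A *v r)"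
  using assms(2)[of "matrix_inv A *v q" "matrix_inv A *v r"]
  by (simp add: matrix_inv_vector_mult[OF assms(1)])

lemma matrix_vector_mult_scaleR_left: "(r *\<^sub>R A) *v (x :: real^'n) = r *\<^sub>R (A *v x)"
  by (simp add: vec_eq_iff matrix_vector_mult_def sum_distrib_left mult.assoc)

lemma matrix_nth_inner: "A $ i $ j = (A *v axis j 1) \<bullet> (axis i 1 :: real^'n)"
  by (simp add: inner_axis matrix_vector_mul_component)

lemma D_nth: "f differentiable at z \<Longrightarrow> D (\<lambda>y. f y $ i) z v = D f z v $ i"
  by (rule D_linear[OF bounded_linear_vec_nth])

lemma D_nth_nth:
  fixes M :: "'e::euclidean_space \<Rightarrow> real^'n^'m"
  assumes "M differentiable at z"
  shows "D (\<lambda>y. M y $ i $ j) z v = D M z v $ i $ j"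
proof -
  have "(\<lambda>y. M y $ i) differentiable at z"
    using assms bounded_linear.has_derivative[OF bounded_linear_vec_nth]
    unfolding differentiable_def by blast
  then show ?thesis using assms by (simp add: D_nth)
qed

lemma D_matrix_vector_const:
  fixes M :: "'e::euclidean_space \<Rightarrow> real^'n^'m"
  shows
  "M differentiable at z \<Longrightarrow> D (\<lambda>y. M y *v u) z v = D M z v *v u"
  using D_matrix_vector_mult[OF _ differentiable_const, of M z u] by simp

lemma bounded_linear_liouville: "bounded_linear (liouville :: 'n::finite phase \<Rightarrow> _)"
  unfolding liouville_def[abs_def]
  by (intro bounded_linear_Pair bounded_linear_zero bounded_linear_snd)

lemma D_liouville: "D liouville z v = (0, snd v)"
  by (simp add: D_bounded_linear[OF bounded_linear_liouville]) (simp add: liouville_def)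

text \<open>Homogeneity enters as Euler's identity. Being infinitesimal, it passes to every open
  subset, in particular to the tube, which is not invariant under scaling.\<close>

locale cartan_chart =
  fixes \<Omega> :: "'n::finite phase set" and F :: "'n phase \<Rightarrow> real"
  assumes open_\<Omega>: "open \<Omega>"
    and smooth_F: "smooth_on \<Omega> F"
    and euler_F: "\<And>z. z \<in> \<Omega> \<Longrightarrow> D F z (liouville z) = F z"
    and pos_g: "\<And>z v. z \<in> \<Omega> \<Longrightarrow> v \<noteq> 0 \<Longrightarrow> 0 < v \<bullet> (g_up F z *v v)"
begin

lemma smooth_liouville: "smooth_on \<Omega> liouville"
  by (rule smooth_on_bounded_linear[OF open_\<Omega> bounded_linear_liouville])

lemma smooth_energy: "smooth_on \<Omega> (energy F)"
proof -
  have "smooth_on \<Omega> (\<lambda>z. F z * F z * (1/2))"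
    by (intro smooth_on_mult smooth_F open_\<Omega> smooth_on_const)
  then show ?thesis by (rule smooth_on_cong[OF open_\<Omega>]) (simp add: energy_def power2_eq_square)
qed

lemma D_energy_F: "z \<in> \<Omega> \<Longrightarrow> D (energy F) z v = F z * D F z v"
proof -
  assume "z \<in> \<Omega>"
  then have "(F has_derivative D F z) (at z)" by (rule smooth_has_derivative[OF smooth_F])
  then have "((\<lambda>z. (F z)^2 / 2) has_derivative (\<lambda>v. F z * D F z v)) (at z)"
    by (auto intro!: derivative_eq_intros)
  then show ?thesis unfolding energy_def[abs_def] by (simp add: D_eqI)
qed

lemma D_energy: "z \<in> \<Omega> \<Longrightarrow> D (energy F) z v = force F z \<bullet> fst v + velocity F z \<bullet> snd v"
proof -
  assume z: "z \<in> \<Omega>"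
  note lin = linear_D[OF smooth_energy z]
  have "D (energy F) z v = D (energy F) z (fst v, 0) + D (energy F) z (0, snd v)"
    using linear_add[OF lin, of "(fst v, 0)" "(0, snd v)"] by simp
  then show ?thesis
    using linear_expand_axis[OF linear_Pair_left[OF lin], of "fst v"]
      linear_expand_axis[OF linear_Pair_right[OF lin], of "snd v"]
    by (simp add: inner_vec_def force_def velocity_def mult.commute)
qed

lemma smooth_velocity: "smooth_on \<Omega> (velocity F)"
  unfolding velocity_def[abs_def]
  by (intro smooth_on_vec open_\<Omega> smooth_on_D smooth_energy)

lemma smooth_force: "smooth_on \<Omega> (force F)"
  unfolding force_def[abs_def]
  by (intro smooth_on_vec open_\<Omega> smooth_on_D smooth_energy)

text \<open>Pairing with a constant vector exhibits the derivative of a gradient as a second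
  derivative of the energy; the symmetries below are then equality of mixed partials.\<close>

lemma D_velocity_inner:
  "z \<in> \<Omega> \<Longrightarrow> D (velocity F) z v \<bullet> r = D (\<lambda>y. D (energy F) y (0, r)) z v"
  using fun_cong[OF D_cong_smooth[OF open_\<Omega> smooth_on_D[OF smooth_energy],
      of z "(0, r)" "\<lambda>y. velocity F y \<bullet> r"], of v]
    D_inner[OF smooth_differentiable[OF smooth_velocity]] by (simp add: D_energy)

lemma D_force_inner:
  "z \<in> \<Omega> \<Longrightarrow> D (force F) z v \<bullet> r = D (\<lambda>y. D (energy F) y (r, 0)) z v"
  using fun_cong[OF D_cong_smooth[OF open_\<Omega> smooth_on_D[OF smooth_energy],
      of z "(r, 0)" "\<lambda>y. force F y \<bullet> r"], of v]
    D_inner[OF smooth_differentiable[OF smooth_force]] by (simp add: D_energy)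

lemma D_velocity_sym: "z \<in> \<Omega> \<Longrightarrow> D (velocity F) z (0, q) \<bullet> r = D (velocity F) z (0, r) \<bullet> q"
  using D_D_commute[OF open_\<Omega> smooth_energy] by (simp add: D_velocity_inner)

lemma D_velocity_force: "z \<in> \<Omega> \<Longrightarrow> D (velocity F) z (a, 0) \<bullet> r = D (force F) z (0, r) \<bullet> a"
  using D_D_commute[OF open_\<Omega> smooth_energy] by (simp add: D_velocity_inner D_force_inner)

text \<open>The metric is the momentum Jacobian of the Legendre map, and from here on it is used in
  this form.\<close>

lemma g_up_nth: "z \<in> \<Omega> \<Longrightarrow> g_up F z $ i $ j = D (velocity F) z (0, axis i 1) $ j"
proof -
  assume z: "z \<in> \<Omega>"
  have sq: "(\<lambda>y. (F y)^2) = (\<lambda>y. 2 * energy F y)" by (simp add: energy_def)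
  have 1: "2 * velocity F y $ j = dp j (\<lambda>y. (F y)^2) y" if "y \<in> \<Omega>" for y
    unfolding sq dp_def
    by (simp add: D_linear[OF bounded_linear_mult_right smooth_differentiable[OF smooth_energy that]]
        velocity_def)
  have "smooth_on \<Omega> (\<lambda>y. 2 * velocity F y $ j)"
    by (intro smooth_on_mult open_\<Omega> smooth_on_const smooth_on_nth smooth_velocity)
  then have "D (dp j (\<lambda>y. (F y)^2)) z = D (\<lambda>y. 2 * velocity F y $ j) z"
    using D_cong_smooth[OF open_\<Omega> _ z] 1 by blast
  then show ?thesis
    using smooth_differentiable[OF smooth_on_nth[OF open_\<Omega> smooth_velocity] z]
      smooth_differentiable[OF smooth_velocity z]
    by (simp add: g_up_def dp_def D_linear[OF bounded_linear_mult_right] D_nth)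
qed

lemma g_up_mult: "z \<in> \<Omega> \<Longrightarrow> g_up F z *v q = D (velocity F) z (0, q)"
  using D_velocity_sym[of z "axis _ 1" q]
  by (simp add: vec_eq_iff matrix_vector_mult_def g_up_nth inner_axis)
    (simp add: inner_vec_def)

lemma g_up_sym: "z \<in> \<Omega> \<Longrightarrow> (g_up F z *v q) \<bullet> r = q \<bullet> (g_up F z *v r)"
  using D_velocity_sym by (simp add: g_up_mult inner_commute[of q])

lemma invertible_g_up: "z \<in> \<Omega> \<Longrightarrow> invertible (g_up F z)"
  using pos_g by (rule pos_def_invertible)

lemma g_up_low: "z \<in> \<Omega> \<Longrightarrow> g_up F z *v (g_low F z *v u) = u"
  and g_low_up: "z \<in> \<Omega> \<Longrightarrow> g_low F z *v (g_up F z *v u) = u"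
  unfolding g_low_def by (rule matrix_inv_vector_mult[OF invertible_g_up]; assumption)+

lemma g_low_sym: "z \<in> \<Omega> \<Longrightarrow> (g_low F z *v q) \<bullet> r = q \<bullet> (g_low F z *v r)"
  unfolding g_low_def using inner_matrix_inv_sym[OF invertible_g_up] g_up_sym by blast

lemma smooth_g_up: "smooth_on \<Omega> (g_up F)"
proof (rule smooth_on_matrixI[OF open_\<Omega>])
  fix i j
  show "smooth_on \<Omega> (\<lambda>z. g_up F z $ i $ j)"
    by (rule smooth_on_cong[OF open_\<Omega> smooth_on_nth[OF open_\<Omega> smooth_on_D[OF smooth_velocity]]])
      (simp add: g_up_nth)
qed

lemma smooth_g_low: "smooth_on \<Omega> (g_low F)"
  unfolding g_low_def[abs_def]
  by (rule smooth_on_matrix_inv[OF open_\<Omega> smooth_g_up invertible_g_up])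

section \<open>Euler identities: degrees of homogeneity in the momenta\<close>

lemma D_energy_liouville: "z \<in> \<Omega> \<Longrightarrow> D (energy F) z (liouville z) = 2 * energy F z"
  by (simp add: D_energy_F euler_F energy_def power2_eq_square)

lemma velocity_inner_p: "z \<in> \<Omega> \<Longrightarrow> velocity F z \<bullet> snd z = (F z)^2"
  using D_energy_liouville[of z] by (simp add: D_energy liouville_def energy_def)

text \<open>Euler's identity of degree two is differentiated in direction \<open>v\<close> and the
  two derivatives are exchanged. The correction is the derivative of \<open>liouville\<close>
  itself, which sees only the vertical part of \<open>v\<close>.\<close>

lemma D_D_energy_liouville:
  assumes "z \<in> \<Omega>"
  shows "D (\<lambda>y. D (energy F) y v) z (liouville z) = 2 * D (energy F) z v - velocity F z \<bullet> snd v"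
proof -
  have sm: "smooth_on \<Omega> (\<lambda>y. 2 * energy F y)"
    by (intro smooth_on_mult open_\<Omega> smooth_on_const smooth_energy)
  have "D (\<lambda>y. D (energy F) y (liouville y)) z v = D (\<lambda>y. 2 * energy F y) z v"
    using D_cong_smooth[OF open_\<Omega> sm assms, of "\<lambda>y. D (energy F) y (liouville y)"]
    by (simp add: D_energy_liouville)
  also have "\<dots> = 2 * D (energy F) z v"
    by (simp add: D_linear[OF bounded_linear_mult_right smooth_differentiable[OF smooth_energy assms]])
  finally have "D (\<lambda>y. D (energy F) y (liouville z)) z v + D (energy F) z (0, snd v)
      = 2 * D (energy F) z v"
    using D_D_field[OF smooth_energy smooth_liouville assms open_\<Omega>] by (simp add: D_liouville)
  then show ?thesis
    using D_D_commute[OF open_\<Omega> smooth_energy assms] D_energy[OF assms, of "(0, snd v)"] by simp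
qed

lemma D_velocity_liouville: "z \<in> \<Omega> \<Longrightarrow> D (velocity F) z (liouville z) = velocity F z"
  by (rule vector_eq_rdot[THEN iffD1])
    (simp add: D_velocity_inner D_D_energy_liouville D_energy)

lemma D_force_liouville: "z \<in> \<Omega> \<Longrightarrow> D (force F) z (liouville z) = 2 *\<^sub>R force F z"
  by (rule vector_eq_rdot[THEN iffD1])
    (simp add: D_force_inner D_D_energy_liouville D_energy)

lemma g_up_p: "z \<in> \<Omega> \<Longrightarrow> g_up F z *v snd z = velocity F z"
  using D_velocity_liouville by (simp add: g_up_mult liouville_def)

lemma g_low_velocity: "z \<in> \<Omega> \<Longrightarrow> g_low F z *v velocity F z = snd z"
  using g_low_up[of z "snd z"] by (simp add: g_up_p)

lemma p_up_velocity: "z \<in> \<Omega> \<Longrightarrow> p_up F z i = velocity F z $ i"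
  using g_up_p[of z] by (simp add: p_up_def p_low_def matrix_vector_mult_def vec_eq_iff)

text \<open>The same argument one derivative later: horizontal derivatives of the Legendre map keep
  degree one, vertical ones drop to degree zero.\<close>

lemma D_D_velocity_liouville:
  assumes "z \<in> \<Omega>"
  shows "D (\<lambda>y. D (velocity F) y v) z (liouville z) = D (velocity F) z v - D (velocity F) z (0, snd v)"
proof -
  have "D (\<lambda>y. D (velocity F) y (liouville y)) z v = D (velocity F) z v"
    using D_cong_smooth[OF open_\<Omega> smooth_velocity assms, of "\<lambda>y. D (velocity F) y (liouville y)"]
    by (simp add: D_velocity_liouville)
  then have "D (\<lambda>y. D (velocity F) y (liouville z)) z v + D (velocity F) z (0, snd v)
      = D (velocity F) z v"
    using D_D_field[OF smooth_velocity smooth_liouville assms open_\<Omega>] by (simp add: D_liouville)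
  then show ?thesis
    using D_D_commute[OF open_\<Omega> smooth_velocity assms] by (metis add_diff_cancel_right')
qed

text \<open>Degree zero of \<open>g_up\<close> is inherited by the inverse on differentiating
  \<open>g_up F y *v (g_low F y *v u) = u\<close>.\<close>

lemma D_g_low_liouville:
  assumes "z \<in> \<Omega>"
  shows "D (g_low F) z (liouville z) *v u = 0"
proof -
  note d = smooth_differentiable[OF smooth_g_up assms] smooth_differentiable[OF smooth_g_low assms]
  have up: "D (g_up F) z (liouville z) *v q = 0" for q
  proof -
    have "D (g_up F) z (liouville z) *v q = D (\<lambda>y. g_up F y *v q) z (liouville z)"
      by (simp add: D_matrix_vector_const d)
    also have "\<dots> = D (\<lambda>y. D (velocity F) y (0, q)) z (liouville z)"
      using fun_cong[OF D_cong_smooth[OF open_\<Omega> smooth_on_D[OF smooth_velocity] assms]] g_up_mult by metis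
    finally show ?thesis by (simp add: D_D_velocity_liouville assms)
  qed
  have d': "(\<lambda>y. g_low F y *v u) differentiable at z"
    using smooth_differentiable[OF smooth_matrix_vector_mult[OF open_\<Omega> smooth_g_low smooth_on_const] assms] .
  have "D (\<lambda>y. g_up F y *v (g_low F y *v u)) z = D (\<lambda>y. u) z"
    by (rule D_cong_smooth[OF open_\<Omega> smooth_on_const assms]) (simp add: g_up_low)
  then have "g_up F z *v (D (g_low F) z (liouville z) *v u) = 0"
    using D_matrix_vector_mult[OF d(1) d', of "liouville z"] by (simp add: D_matrix_vector_const d up)
  then show ?thesis using g_low_up[OF assms, of "D (g_low F) z (liouville z) *v u"] by simp
qed

lemma D_g_low_sym:
  assumes "z \<in> \<Omega>"
  shows "D (g_low F) z v $ i $ j = D (g_low F) z v $ j $ i"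
proof -
  have "g_low F y $ i $ j = g_low F y $ j $ i" if "y \<in> \<Omega>" for y
    unfolding matrix_nth_inner using g_low_sym[OF that] by (simp add: inner_commute)
  then have "D (\<lambda>y. g_low F y $ i $ j) z = D (\<lambda>y. g_low F y $ j $ i) z"
    using D_cong_smooth[OF open_\<Omega> smooth_on_nth[OF open_\<Omega> smooth_on_nth[OF open_\<Omega> smooth_g_low]] assms]
    by metis
  then show ?thesis
    using D_nth_nth[OF smooth_differentiable[OF smooth_g_low assms]] by metis
qed

text \<open>Lowering the index of the Legendre vector returns \<open>p\<close>, which stays fixed
  while only \<open>x\<close> moves.\<close>

lemma D_g_low_velocity:
  assumes "z \<in> \<Omega>"
  shows "D (g_low F) z (a, 0) *v velocity F z = - (g_low F z *v D (velocity F) z (a, 0))"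
proof -
  have "D (\<lambda>y. g_low F y *v velocity F y) z (a, 0) = 0"
    using fun_cong[OF D_cong_smooth[OF open_\<Omega> smooth_on_bounded_linear[OF open_\<Omega> bounded_linear_snd] assms,
        of "\<lambda>y. g_low F y *v velocity F y"]] D_bounded_linear[OF bounded_linear_snd, of z "(a, 0)"]
    by (simp add: g_low_velocity)
  then show ?thesis
    using smooth_differentiable[OF smooth_g_low assms] smooth_differentiable[OF smooth_velocity assms]
    by (simp add: D_matrix_vector_mult eq_neg_iff_add_eq_0 add.commute)
qed

lemma force_velocity: "z \<in> \<Omega> \<Longrightarrow> 2 * (force F z \<bullet> a) = snd z \<bullet> D (velocity F) z (a, 0)"
  using D_force_liouville[of z] D_velocity_force[of z a "snd z"]
  by (simp add: liouville_def inner_commute)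

text \<open>Contracting the upper index with \<open>p\<close> turns \<open>g^is p_i\<close> into the
  Legendre component \<open>y $ s\<close>, so no factor \<open>g_up\<close> survives.\<close>

lemma christoffel0_eq:
  assumes "z \<in> \<Omega>"
  shows "christoffel0 F j k z = 1/2 * ((D (g_low F) z (axis k 1, 0) *v velocity F z) $ j
    + (D (g_low F) z (axis j 1, 0) *v velocity F z) $ k - D (g_low F) z (velocity F z, 0) $ j $ k)"
proof -
  define M where "M = (\<lambda>a. D (g_low F) z (a, 0))"
  define y where "y = velocity F z"
  have d: "g_low F differentiable at z" by (rule smooth_differentiable[OF smooth_g_low assms])
  have Msym: "M a $ i $ l = M a $ l $ i" for a i l unfolding M_def by (rule D_g_low_sym[OF assms])
  have "linear M" unfolding M_def by (rule linear_Pair_left[OF linear_D[OF smooth_g_low assms]])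
  then have Mlin: "M y $ j $ k = (\<Sum>s\<in>UNIV. y $ s * M (axis s 1) $ j $ k)"
    using linear_expand_axis[of M y] by simp
  have dxg: "dx r (\<lambda>y. g_low F y $ a $ b) z = M (axis r 1) $ a $ b" for r a b
    by (simp add: dx_def M_def D_nth_nth[OF d])
  have y: "y $ s = (\<Sum>i\<in>UNIV. g_up F z $ i $ s * snd z $ i)" for s
  proof -
    have "y $ s = (g_up F z *v snd z) \<bullet> axis s 1" by (simp add: y_def g_up_p assms inner_axis)
    also have "\<dots> = snd z \<bullet> (g_up F z *v axis s 1)" by (rule g_up_sym[OF assms])
    finally show ?thesis
      by (simp add: inner_vec_def[of "snd z"] matrix_vector_mul_component inner_axis mult.commute)
  qed
  define X where "X = (\<lambda>s. M (axis k 1) $ j $ s + M (axis j 1) $ s $ k - M (axis s 1) $ j $ k)"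
  have "christoffel0 F j k z = (\<Sum>i\<in>UNIV. \<Sum>s\<in>UNIV. 1/2 * (g_up F z $ i $ s * X s * snd z $ i))"
    by (simp add: christoffel0_def christoffel_def dxg X_def p_low_def sum_distrib_left sum_distrib_right
        mult.assoc)
  also have "\<dots> = (\<Sum>s\<in>UNIV. \<Sum>i\<in>UNIV. 1/2 * (g_up F z $ i $ s * X s * snd z $ i))"
    by (rule sum.swap)
  also have "\<dots> = (\<Sum>s\<in>UNIV. 1/2 * (y $ s * X s))"
    by (simp add: y sum_distrib_left sum_distrib_right mult_ac)
  also have "\<dots> = 1/2 * ((M (axis k 1) *v y) $ j + (M (axis j 1) *v y) $ k - M y $ j $ k)"
    unfolding Mlin X_def
    by (simp add: matrix_vector_mult_def sum.distrib sum_subtractf sum_distrib_left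
        right_diff_distrib distrib_left mult_ac Msym[of "axis j 1" k])
  finally show ?thesis by (simp add: M_def y_def)
qed

text \<open>On the second contraction two of the three terms cancel; the rest is half the
  \<open>x\<close>-derivative of the metric, evaluated twice on the Legendre vector, and this is
  minus the force.\<close>

lemma christoffel00_eq:
  assumes "z \<in> \<Omega>"
  shows "christoffel00 F j z = - force F z $ j"
proof -
  define M where "M = (\<lambda>a. D (g_low F) z (a, 0))"
  define y where "y = velocity F z"
  have "linear M" unfolding M_def by (rule linear_Pair_left[OF linear_D[OF smooth_g_low assms]])
  then have "linear (\<lambda>a. (M a *v y) $ j)"
    by (auto intro!: linearI simp: linear_add linear_scale matrix_vector_mult_add_rdistrib
        matrix_vector_mult_scaleR_left)
  then have 1: "(\<Sum>k\<in>UNIV. (M (axis k 1) *v y) $ j * y $ k) = (M y *v y) $ j"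
    using linear_expand_axis[of "\<lambda>a. (M a *v y) $ j" y] by (simp add: mult.commute)
  have "christoffel00 F j z = (\<Sum>k\<in>UNIV. 1/2 * ((M (axis k 1) *v y) $ j
      + (M (axis j 1) *v y) $ k - M y $ j $ k) * y $ k)"
    by (simp add: christoffel00_def christoffel0_eq assms p_up_velocity M_def y_def)
  also have "\<dots> = 1/2 * ((\<Sum>k\<in>UNIV. (M (axis k 1) *v y) $ j * y $ k)
      + (M (axis j 1) *v y) \<bullet> y - (M y *v y) $ j)"
    by (simp add: inner_vec_def matrix_vector_mult_def[of "M y" y] sum_distrib_left
        sum.distrib sum_subtractf ring_distribs diff_divide_distrib add_divide_distrib sum_divide_distrib
        mult.assoc)
  also have "\<dots> = - (1/2) * (snd z \<bullet> D (velocity F) z (axis j 1, 0))"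
    unfolding 1 using g_low_sym[OF assms, of "D (velocity F) z (axis j 1, 0)" "velocity F z"]
    by (simp add: M_def y_def D_g_low_velocity assms g_low_velocity inner_commute[of "snd z"])
  also have "\<dots> = - force F z $ j"
    unfolding force_velocity[OF assms, symmetric] by (simp add: inner_axis)
  finally show ?thesis .
qed

text \<open>The Christoffel term contributes the derivative of \<open>g_low\<close> along
  \<open>(velocity F z, 0)\<close> and the correction term the one along
  \<open>(0, force F z)\<close>, with opposite sign. They combine to the derivative along
  \<open>spray\<close>, which is how the Hamiltonian field enters the connection.\<close>

lemma conn_nth:
  assumes "z \<in> \<Omega>"
  shows "conn F z $ i $ j = 1/2 * (- (g_low F z *v D (velocity F) z (axis j 1, 0)) $ i
    - (g_low F z *v D (velocity F) z (axis i 1, 0)) $ j - D (g_low F) z (spray F z) $ i $ j)"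
proof -
  have d: "g_low F differentiable at z" by (rule smooth_differentiable[OF smooth_g_low assms])
  note lin = linear_D[OF smooth_g_low assms]
  have "D (g_low F) z (0, force F z) $ i $ j
      = (\<Sum>h\<in>UNIV. force F z $ h * D (g_low F) z (0, axis h 1) $ i $ j)"
    using linear_expand_axis[OF linear_Pair_right[OF lin], of "force F z"] by simp
  moreover have "D (g_low F) z (spray F z) = D (g_low F) z (velocity F z, 0) - D (g_low F) z (0, force F z)"
    using linear_diff[OF lin, of "(velocity F z, 0)" "(0, force F z)"] by (simp add: spray_def)
  ultimately show ?thesis
    by (simp add: conn_def nonlin_conn_def dp_def christoffel0_eq christoffel00_eq assms D_nth_nth[OF d]
        D_g_low_velocity sum_negf)
qed

lemma conn_sym: "z \<in> \<Omega> \<Longrightarrow> conn F z $ i $ j = conn F z $ j $ i"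
  by (simp add: conn_nth D_g_low_sym[of z _ i])

lemma conn_inner:
  assumes "z \<in> \<Omega>"
  shows "2 * ((conn F z *v u) \<bullet> w) = - (D (velocity F) z (w, 0) \<bullet> (g_low F z *v u))
    - (g_low F z *v D (velocity F) z (u, 0)) \<bullet> w - (D (g_low F) z (spray F z) *v u) \<bullet> w"
    (is "?l u w = ?r u w")
proof -
  have lin: "linear (\<lambda>a. D (velocity F) z (a, 0))"
    by (rule linear_Pair_left[OF linear_D[OF smooth_velocity assms]])
  have bl: "bilinear ?l"
    by (auto simp: bilinear_def algebra_simps inner_add_left inner_add_right
        matrix_vector_mult_scaleR intro!: linearI)
  have br: "bilinear ?r"
    using linear_add[OF lin] linear_scale[OF lin]
    by (auto simp: bilinear_def algebra_simps inner_add_left inner_add_right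
        matrix_vector_mult_scaleR intro!: linearI)
  have "?l a b = ?r a b" if ab: "a \<in> Basis" "b \<in> Basis" for a b
  proof -
    obtain i j where ij: "a = axis j 1" "b = axis i 1"
      using ab by (auto simp: Basis_vec_def)
    have "D (velocity F) z (axis i 1, 0) \<bullet> (g_low F z *v axis j 1)
        = (g_low F z *v D (velocity F) z (axis i 1, 0)) $ j"
      unfolding g_low_sym[OF assms, symmetric] by (simp add: inner_axis)
    then show ?thesis
      unfolding ij using conn_nth[OF assms, of i j]
      by (simp add: matrix_nth_inner[symmetric] inner_axis matrix_vector_mul_component)
  qed
  then have "?l = ?r" by (intro bilinear_eq_stdbasis[OF bl br])
  then show ?thesis by metis
qed

lemma smooth_spray: "smooth_on \<Omega> (spray F)"
  unfolding spray_def[abs_def]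
  by (intro smooth_on_Pair smooth_on_uminus open_\<Omega> smooth_velocity smooth_force)

lemma smooth_conn: "smooth_on \<Omega> (conn F)"
proof (rule smooth_on_matrixI[OF open_\<Omega>])
  fix i j
  have "smooth_on \<Omega> (\<lambda>z. (- (g_low F z *v D (velocity F) z (axis j 1, 0)) $ i
    - (g_low F z *v D (velocity F) z (axis i 1, 0)) $ j - D (g_low F) z (spray F z) $ i $ j) * (1/2))"
    by (intro smooth_on_mult smooth_on_diff smooth_on_uminus smooth_on_nth smooth_on_D_field smooth_on_D
        smooth_matrix_vector_mult open_\<Omega> smooth_g_low smooth_velocity smooth_spray smooth_on_const)
  then show "smooth_on \<Omega> (\<lambda>z. conn F z $ i $ j)"
    by (rule smooth_on_cong[OF open_\<Omega>]) (simp add: conn_nth)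
qed

lemma conn_inner_sym: "z \<in> \<Omega> \<Longrightarrow> (conn F z *v u) \<bullet> w = u \<bullet> (conn F z *v w)"
  using conn_sym[of z]
  by (simp add: inner_vec_def matrix_vector_mult_def sum_distrib_left sum_distrib_right)
    (subst sum.swap, simp add: mult_ac)

lemma smooth_vert: "smooth_on \<Omega> (vert F u)"
  unfolding vert_def[abs_def]
  by (intro smooth_on_Pair smooth_matrix_vector_mult open_\<Omega> smooth_g_low smooth_on_const)

lemma smooth_hor: "smooth_on \<Omega> (hor F u)"
  unfolding hor_def[abs_def]
  by (intro smooth_on_Pair smooth_matrix_vector_mult open_\<Omega> smooth_conn smooth_on_const)

lemma smooth_legendre_hor: "smooth_on \<Omega> (legendre_hor F u)"
  unfolding legendre_hor_def[abs_def]
  by (intro smooth_on_Pair smooth_on_uminus smooth_matrix_vector_mult open_\<Omega> smooth_g_low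
      smooth_on_const smooth_on_D smooth_velocity)

end

section \<open>Brackets of the adapted frame\<close>

lemma lie_bracket_uminus_right:
  assumes "smooth_on S X" "smooth_on S Y" "z \<in> S"
  shows "lie_bracket Y (\<lambda>y. - X y) z = - lie_bracket Y X z"
  unfolding lie_bracket_def D_uminus[OF smooth_differentiable[OF assms(1,3)]]
    linear_neg[OF linear_D[OF assms(2,3)]] by simp

lemma lie_bracket_zero_right:
  assumes "smooth_on S X" "z \<in> S"
  shows "lie_bracket X (\<lambda>y. 0) z = 0"
  unfolding lie_bracket_def using linear_0[OF linear_D[OF assms]] by simp

lemma lie_bracket_cong_right:
  assumes "open S" "smooth_on S X" "smooth_on S Y" "z \<in> S" "\<And>y. y \<in> S \<Longrightarrow> Y' y = Y y"
  shows "lie_bracket X Y' z = lie_bracket X Y z"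
  by (rule lie_bracket_cong[OF assms(1-4)]) (simp_all add: assms(5))

text \<open>For the Bianchi identity: \<open>a\<close>, \<open>b\<close>, \<open>d\<close> are
  double brackets with one vertical field, and their differences telescope around the cycle.\<close>

lemma cyclic_cancel:
  fixes a b d :: "'a::ab_group_add"
  assumes "a - b + x = 0" "b - d + y = 0" "d - a + w = 0"
  shows "x + y + w = 0"
proof -
  have "x = b - a" "y = d - b" "w = a - d"
    using assms by (simp_all add: add_eq_0_iff)
  then show ?thesis by simp
qed

context cartan_chart
begin

lemma D_vert: "z \<in> \<Omega> \<Longrightarrow> D (vert F u) z v = (0, D (g_low F) z v *v u)"
  using D_Pair[OF differentiable_const smooth_differentiable[OF
      smooth_matrix_vector_mult[OF open_\<Omega> smooth_g_low smooth_on_const]], of z 0 u v]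
    D_matrix_vector_const[OF smooth_differentiable[OF smooth_g_low]]
  unfolding vert_def[abs_def] by simp

lemma D_hor: "z \<in> \<Omega> \<Longrightarrow> D (hor F u) z v = (0, D (conn F) z v *v u)"
  using D_Pair[OF differentiable_const smooth_differentiable[OF
      smooth_matrix_vector_mult[OF open_\<Omega> smooth_conn smooth_on_const]], of z u u v]
    D_matrix_vector_const[OF smooth_differentiable[OF smooth_conn]]
  unfolding hor_def[abs_def] by simp

lemma D_spray: "z \<in> \<Omega> \<Longrightarrow> D (spray F) z v = (D (velocity F) z v, - D (force F) z v)"
  using D_Pair[OF smooth_differentiable[OF smooth_velocity]
      smooth_differentiable[OF smooth_on_uminus[OF open_\<Omega> smooth_force]], of z v]
    D_uminus[OF smooth_differentiable[OF smooth_force]]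
  unfolding spray_def[abs_def] by simp

lemma D_legendre_hor:
  assumes "z \<in> \<Omega>"
  shows "D (legendre_hor F u) z v = (0, - (g_low F z *v D (\<lambda>y. D (velocity F) y (u, 0)) z v
    + D (g_low F) z v *v D (velocity F) z (u, 0)))"
proof -
  note sm = smooth_matrix_vector_mult[OF open_\<Omega> smooth_g_low smooth_on_D[OF smooth_velocity], of "(u, 0)"]
  show ?thesis
    using D_Pair[OF differentiable_const smooth_differentiable[OF
        smooth_on_uminus[OF open_\<Omega> sm] assms], of u v]
      D_uminus[OF smooth_differentiable[OF sm assms], of v]
      D_matrix_vector_mult[OF smooth_differentiable[OF smooth_g_low assms]
        smooth_differentiable[OF smooth_on_D[OF smooth_velocity] assms], of "(u, 0)" v]
    unfolding legendre_hor_def[abs_def] by simp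
qed

text \<open>Along \<open>vert F u\<close> the Legendre components change at the constant rate
  \<open>u\<close>, along \<open>legendre_hor F u\<close> not at all: these are the coordinate
  fields of \<open>(x^i, p^i)\<close>.\<close>

lemma D_velocity_vert: "z \<in> \<Omega> \<Longrightarrow> D (velocity F) z (vert F u z) = u"
  by (simp add: vert_def g_up_mult[symmetric] g_up_low)

lemma D_velocity_legendre_hor:
  assumes "z \<in> \<Omega>"
  shows "D (velocity F) z (legendre_hor F u z) = 0"
proof -
  have "legendre_hor F u z = (u, 0) - vert F (D (velocity F) z (u, 0)) z"
    by (simp add: legendre_hor_def vert_def)
  then show ?thesis
    using linear_diff[OF linear_D[OF smooth_velocity assms]] D_velocity_vert[OF assms] by simp
qed

text \<open>Invertibility of \<open>g_up\<close> is what makes the derivative of the Legendre map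
  faithful on vertical vectors. This replaces a change to Legendre coordinates.\<close>

lemma vertical_eqI:
  assumes "z \<in> \<Omega>" "fst X = 0" "D (velocity F) z X = u"
  shows "X = vert F u z"
proof -
  have X: "X = (0, snd X)" using assms(2) by (metis prod.collapse)
  then have "g_up F z *v snd X = u" using assms(1,3) by (simp add: g_up_mult)
  then have "snd X = g_low F z *v u" using g_low_up assms(1) by metis
  then show ?thesis using X by (metis vert_def)
qed

lemma vert_0 [simp]: "vert F 0 z = 0"
  by (simp add: vert_def zero_prod_def)

lemma D_D_velocity_vert: "z \<in> \<Omega> \<Longrightarrow> D (\<lambda>y. D (velocity F) y (vert F u y)) z v = 0"
  using fun_cong[OF D_cong_smooth[OF open_\<Omega> smooth_on_const[of _ u], of z
        "\<lambda>y. D (velocity F) y (vert F u y)"]] by (simp add: D_velocity_vert)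

lemma D_D_velocity_legendre_hor: "z \<in> \<Omega> \<Longrightarrow> D (\<lambda>y. D (velocity F) y (legendre_hor F u y)) z v = 0"
  using fun_cong[OF D_cong_smooth[OF open_\<Omega> smooth_on_const[of _ 0], of z
        "\<lambda>y. D (velocity F) y (legendre_hor F u y)"]] by (simp add: D_velocity_legendre_hor)

text \<open>Both fields move the Legendre components at constant rates and leave \<open>x\<close>
  fixed, so the bracket moves neither.\<close>

lemma bracket_vert_vert:
  assumes "z \<in> \<Omega>"
  shows "lie_bracket (vert F u) (vert F w) z = 0"
proof -
  have "D (velocity F) z (lie_bracket (vert F u) (vert F w) z) = 0"
    using D_lie_bracket[OF open_\<Omega> smooth_vert smooth_vert smooth_velocity assms]
    by (simp add: D_D_velocity_vert assms)
  moreover have "fst (lie_bracket (vert F u) (vert F w) z) = 0"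
    by (simp add: lie_bracket_def D_vert assms)
  ultimately show ?thesis using vertical_eqI[OF assms] by (metis vert_0)
qed

lemma bracket_legendre_hor_vert:
  assumes "z \<in> \<Omega>"
  shows "lie_bracket (legendre_hor F u) (vert F w) z = 0"
proof -
  have "D (velocity F) z (lie_bracket (legendre_hor F u) (vert F w) z) = 0"
    using D_lie_bracket[OF open_\<Omega> smooth_legendre_hor smooth_vert smooth_velocity assms]
    by (simp add: D_D_velocity_vert D_D_velocity_legendre_hor assms)
  moreover have "fst (lie_bracket (legendre_hor F u) (vert F w) z) = 0"
    by (simp add: lie_bracket_def D_vert D_legendre_hor assms)
  ultimately show ?thesis using vertical_eqI[OF assms] by (metis vert_0)
qed

text \<open>This ties the prescribed connection to brackets. The derivative of \<open>g_low\<close>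
  along \<open>spray\<close> in \<open>conn_inner\<close> is one half of the bracket; the other
  half, a vertical derivative of the force, is a derivative of the Legendre map by equality of mixed
  partials.\<close>

lemma bracket_vert_spray:
  assumes "z \<in> \<Omega>"
  shows "lie_bracket (vert F u) (spray F) z = 2 *\<^sub>R hor F u z - legendre_hor F u z"
proof -
  have "- D (force F) z (vert F u z) - D (g_low F) z (spray F z) *v u
      = 2 *\<^sub>R (conn F z *v u) + g_low F z *v D (velocity F) z (u, 0)"
  proof (rule vector_eq_rdot[THEN iffD1], rule allI)
    fix w
    show "(- D (force F) z (vert F u z) - D (g_low F) z (spray F z) *v u) \<bullet> w
      = (2 *\<^sub>R (conn F z *v u) + g_low F z *v D (velocity F) z (u, 0)) \<bullet> w"
      using conn_inner[OF assms, of u w] D_velocity_force[OF assms, of w "g_low F z *v u"]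
      by (simp add: inner_add_left inner_diff_left vert_def)
  qed
  then show ?thesis
    using assms
    by (simp add: lie_bracket_def D_spray D_vert D_velocity_vert hor_def legendre_hor_def scaleR_2)
qed

text \<open>This and the next two brackets restate degrees of homogeneity: the Legendre map has
  degree one, the force degree two, and \<open>g_low\<close> degree zero.\<close>

lemma bracket_liouville_spray: "z \<in> \<Omega> \<Longrightarrow> lie_bracket liouville (spray F) z = spray F z"
  by (simp add: lie_bracket_def D_spray D_liouville D_velocity_liouville D_force_liouville spray_def
      scaleR_2)

lemma bracket_liouville_vert: "z \<in> \<Omega> \<Longrightarrow> lie_bracket liouville (vert F u) z = - vert F u z"
  by (simp add: lie_bracket_def D_vert D_liouville D_g_low_liouville vert_def)

lemma bracket_liouville_legendre_hor: "z \<in> \<Omega> \<Longrightarrow> lie_bracket liouville (legendre_hor F u) z = 0"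
  using linear_0[OF linear_D[OF smooth_velocity]]
  by (simp add: lie_bracket_def D_legendre_hor D_liouville D_g_low_liouville legendre_hor_def
      D_D_velocity_liouville zero_prod_def[symmetric])

lemma hor_eq:
  "z \<in> \<Omega> \<Longrightarrow> 2 *\<^sub>R hor F u z = legendre_hor F u z + lie_bracket (vert F u) (spray F) z"
  by (simp add: bracket_vert_spray)

lemma bracket_2_hor:
  assumes "smooth_on \<Omega> X" "z \<in> \<Omega>"
  shows "2 *\<^sub>R lie_bracket X (hor F u) z
    = lie_bracket X (legendre_hor F u) z + lie_bracket X (lie_bracket (vert F u) (spray F)) z"
proof -
  note sm = smooth_on_lie_bracket[OF open_\<Omega> smooth_vert[of u] smooth_spray]
  have "2 *\<^sub>R lie_bracket X (hor F u) z = lie_bracket X (\<lambda>y. 2 *\<^sub>R hor F u y) z"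
    using lie_bracket_scaleR_right[OF assms(1) smooth_hor[of u] smooth_on_const[of \<Omega> "2::real"] assms(2)] by simp
  also have "\<dots> = lie_bracket X (\<lambda>y. legendre_hor F u y + lie_bracket (vert F u) (spray F) y) z"
    by (rule lie_bracket_cong[OF open_\<Omega> assms(1) _ assms(2)])
      (auto intro!: smooth_on_add open_\<Omega> smooth_legendre_hor sm simp: hor_eq)
  also have "\<dots> = lie_bracket X (legendre_hor F u) z + lie_bracket X (lie_bracket (vert F u) (spray F)) z"
    by (rule lie_bracket_add_right[OF smooth_legendre_hor sm assms])
  finally show ?thesis .
qed

text \<open>By Jacobi the Liouville field acts on \<open>[V_u, S]\<close> with weight -1 from
  \<open>V_u\<close> and weight +1 from \<open>S\<close>, in total zero.\<close>

lemma bracket_liouville_hor: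
  assumes "z \<in> \<Omega>"
  shows "lie_bracket liouville (hor F u) z = 0"
proof -
  have "lie_bracket (vert F u) (lie_bracket (spray F) liouville) z = lie_bracket (vert F u) (\<lambda>y. - spray F y) z"
    by (rule lie_bracket_cong_right[OF open_\<Omega> smooth_vert smooth_on_uminus[OF open_\<Omega> smooth_spray] assms])
      (simp add: bracket_liouville_spray lie_bracket_commute[of "spray F" liouville])
  then have 1: "lie_bracket (vert F u) (lie_bracket (spray F) liouville) z = - lie_bracket (vert F u) (spray F) z"
    by (simp add: lie_bracket_uminus_right[OF smooth_spray smooth_vert assms])
  have "lie_bracket (spray F) (lie_bracket liouville (vert F u)) z = lie_bracket (spray F) (\<lambda>y. - vert F u y) z"
    by (rule lie_bracket_cong_right[OF open_\<Omega> smooth_spray smooth_on_uminus[OF open_\<Omega> smooth_vert] assms])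
      (simp add: bracket_liouville_vert)
  then have 2: "lie_bracket (spray F) (lie_bracket liouville (vert F u)) z = lie_bracket (vert F u) (spray F) z"
    by (simp add: lie_bracket_uminus_right[OF smooth_vert smooth_spray assms]
        lie_bracket_commute[of "spray F" "vert F u"])
  show ?thesis
    using lie_bracket_jacobi[OF open_\<Omega> smooth_liouville smooth_vert smooth_spray assms, of u]
      bracket_2_hor[OF smooth_liouville assms, of u] bracket_liouville_legendre_hor[OF assms, of u]
    by (simp add: 1 2)
qed

text \<open>The field \<open>legendre_hor\<close> commutes with vertical fields, so
  \<open>2 [V_w, \<delta>_u] = [V_w, [V_u, S]]\<close>; as \<open>V_u\<close> and \<open>V_w\<close>
  commute, they may act on \<open>S\<close> in either order.\<close>

lemma bracket_hor_vert_sym: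
  assumes "z \<in> \<Omega>"
  shows "lie_bracket (hor F u) (vert F w) z = lie_bracket (hor F w) (vert F u) z"
proof -
  note sm = smooth_on_lie_bracket[OF open_\<Omega> smooth_vert smooth_spray]
  have "lie_bracket (vert F u) (lie_bracket (spray F) (vert F w)) z
      = lie_bracket (vert F u) (\<lambda>y. - lie_bracket (vert F w) (spray F) y) z"
    by (rule lie_bracket_cong_right[OF open_\<Omega> smooth_vert smooth_on_uminus[OF open_\<Omega> sm] assms])
      (rule lie_bracket_commute)
  then have 1: "lie_bracket (vert F u) (lie_bracket (spray F) (vert F w)) z
      = - lie_bracket (vert F u) (lie_bracket (vert F w) (spray F)) z"
    by (simp add: lie_bracket_uminus_right[OF sm smooth_vert assms])
  have "lie_bracket (spray F) (lie_bracket (vert F w) (vert F u)) z = lie_bracket (spray F) (\<lambda>y. 0) z"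
    by (rule lie_bracket_cong_right[OF open_\<Omega> smooth_spray smooth_on_const assms])
      (rule bracket_vert_vert)
  then have 2: "lie_bracket (spray F) (lie_bracket (vert F w) (vert F u)) z = 0"
    by (simp add: lie_bracket_zero_right[OF smooth_spray assms])
  have 3: "lie_bracket (vert F a) (legendre_hor F b) z = 0" for a b
    using bracket_legendre_hor_vert[OF assms] lie_bracket_commute by (metis neg_equal_0_iff_equal)
  have "2 *\<^sub>R lie_bracket (vert F w) (hor F u) z = 2 *\<^sub>R lie_bracket (vert F u) (hor F w) z"
    using lie_bracket_jacobi[OF open_\<Omega> smooth_vert smooth_spray smooth_vert assms, of u w]
      bracket_2_hor[OF smooth_vert assms, of u w] bracket_2_hor[OF smooth_vert assms, of w u]
    by (simp add: 1 2 3)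
  then show ?thesis by (simp add: lie_bracket_commute[of "hor F _"])
qed

lemma D_g_low_vert_sym:
  "z \<in> \<Omega> \<Longrightarrow> D (g_low F) z (vert F u z) *v w = D (g_low F) z (vert F w z) *v u"
  using bracket_vert_vert[of z u w] by (simp add: lie_bracket_def D_vert zero_prod_def)

lemma D_conn_liouville: "z \<in> \<Omega> \<Longrightarrow> D (conn F) z (liouville z) *v u = conn F z *v u"
  using bracket_liouville_hor[of z u] by (simp add: lie_bracket_def D_hor D_liouville hor_def zero_prod_def)

section \<open>The curvature as a bracket of horizontal fields\<close>

lemma bracket_hor_hor:
  "z \<in> \<Omega> \<Longrightarrow> lie_bracket (hor F u) (hor F w) z
    = (0, D (conn F) z (hor F u z) *v w - D (conn F) z (hor F w z) *v u)"
  by (simp add: lie_bracket_def D_hor)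

lemma D_conn_sym:
  assumes "z \<in> \<Omega>"
  shows "D (conn F) z v $ i $ j = D (conn F) z v $ j $ i"
proof -
  have "D (\<lambda>y. conn F y $ i $ j) z = D (\<lambda>y. conn F y $ j $ i) z"
    using D_cong_smooth[OF open_\<Omega> smooth_on_nth[OF open_\<Omega> smooth_on_nth[OF open_\<Omega> smooth_conn]] assms]
      conn_sym by metis
  then show ?thesis
    using D_nth_nth[OF smooth_differentiable[OF smooth_conn assms]] by metis
qed

lemma delta_conn:
  assumes "z \<in> \<Omega>"
  shows "delta F i (nonlin_conn F j k) z = D (conn F) z (hor F (axis i 1) z) $ j $ k"
proof -
  note lin = linear_D[OF smooth_conn assms]
  have N: "nonlin_conn F j k = (\<lambda>y. conn F y $ j $ k)" by (simp add: conn_def fun_eq_iff)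
  have D: "D (nonlin_conn F j k) z v = D (conn F) z v $ j $ k" for v
    unfolding N by (rule D_nth_nth[OF smooth_differentiable[OF smooth_conn assms]])
  have "(conn F z *v axis i 1) $ l = nonlin_conn F i l z" for l
    using conn_sym[OF assms, of l i]
    by (simp add: matrix_vector_mul_component inner_axis) (simp add: conn_def)
  moreover have "D (conn F) z (hor F (axis i 1) z)
      = D (conn F) z (axis i 1, 0) + D (conn F) z (0, conn F z *v axis i 1)"
    using linear_add[OF lin, of "(axis i 1, 0)" "(0, conn F z *v axis i 1)"] by (simp add: hor_def)
  ultimately show ?thesis
    using linear_expand_axis[OF linear_Pair_right[OF lin], of "conn F z *v axis i 1"]
    by (simp add: delta_def dx_def dp_def D)
qed

lemma curv_eq:
  assumes "z \<in> \<Omega>"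
  shows "curv F k i j z = snd (lie_bracket (hor F (axis i 1)) (hor F (axis j 1)) z) $ k"
  using D_conn_sym[OF assms, of _ i k] D_conn_sym[OF assms, of _ j k]
  by (simp add: curv_def delta_conn bracket_hor_hor assms matrix_vector_mul_component inner_axis)

lemma hor_bracket_linear:
  assumes "z \<in> \<Omega>"
  shows "linear (\<lambda>w. lie_bracket (hor F u) (hor F w) z)"
proof -
  note lin = linear_D[OF smooth_conn assms]
  have "hor F (a + b) z = hor F a z + hor F b z" "hor F (r *\<^sub>R a) z = r *\<^sub>R hor F a z" for a b r
    by (simp_all add: hor_def matrix_vector_right_distrib matrix_vector_mult_scaleR)
  then show ?thesis
    by (intro linearI)
      (simp_all add: bracket_hor_hor assms matrix_vector_right_distrib matrix_vector_mult_scaleR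
        linear_add[OF lin] linear_scale[OF lin] matrix_vector_mult_add_rdistrib
        matrix_vector_mult_scaleR_left algebra_simps)
qed

text \<open>\<open>R\<^sub>k\<^sub>i\<^sub>ju\<^sup>iw\<^sup>j\<close> with the index \<open>k\<close> raised by \<open>g\<close>.\<close>
definition hor_curv :: "real^'n \<Rightarrow> real^'n \<Rightarrow> 'n phase \<Rightarrow> real^'n" where
  "hor_curv u w z = D (velocity F) z (lie_bracket (hor F u) (hor F w) z)"

lemma linear_hor_curv: "z \<in> \<Omega> \<Longrightarrow> linear (\<lambda>w. hor_curv u w z)"
  unfolding hor_curv_def
  using linear_compose[OF hor_bracket_linear linear_D[OF smooth_velocity]]
  by (simp add: o_def)

lemma hor_curv_antisym:
  assumes "z \<in> \<Omega>"
  shows "hor_curv u w z = - hor_curv w u z"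
  unfolding hor_curv_def lie_bracket_commute[of "hor F u"]
  using linear_neg[OF linear_D[OF smooth_velocity assms]] by blast

lemma smooth_hor_curv: "smooth_on \<Omega> (hor_curv u w)"
  unfolding hor_curv_def[abs_def]
  by (intro smooth_on_D_field open_\<Omega> smooth_velocity smooth_on_lie_bracket smooth_hor)

lemma bracket_eq_vert_hor_curv:
  "z \<in> \<Omega> \<Longrightarrow> lie_bracket (hor F u) (hor F w) z = vert F (hor_curv u w z) z"
  by (rule vertical_eqI) (simp_all add: bracket_hor_hor hor_curv_def)

text \<open>The Liouville field commutes with both horizontal fields, hence with their bracket.
  Applied to the Legendre map, of degree one, the bracket yields a quantity of degree one.\<close>

lemma hor_curv_liouville:
  assumes "z \<in> \<Omega>"
  shows "D (hor_curv u w) z (liouville z) = hor_curv u w z"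
proof -
  note smB = smooth_on_lie_bracket[OF open_\<Omega> smooth_hor smooth_hor]
  have zero: "lie_bracket (hor F a) X z = 0" if "\<And>y. y \<in> \<Omega> \<Longrightarrow> X y = 0" for a X
    using lie_bracket_cong_right[OF open_\<Omega> smooth_hor smooth_on_const assms that]
    by (simp add: lie_bracket_zero_right[OF smooth_hor assms])
  have 1: "lie_bracket (hor F u) (lie_bracket (hor F w) liouville) z = 0"
    by (rule zero) (simp add: bracket_liouville_hor lie_bracket_commute[of "hor F w"])
  have 2: "lie_bracket (hor F w) (lie_bracket liouville (hor F u)) z = 0"
    by (rule zero) (rule bracket_liouville_hor)
  have "lie_bracket liouville (lie_bracket (hor F u) (hor F w)) z = 0"
    using lie_bracket_jacobi[OF open_\<Omega> smooth_liouville smooth_hor smooth_hor assms, of u w] 1 2 by simp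
  then have "D (\<lambda>y. D (velocity F) y (lie_bracket (hor F u) (hor F w) y)) z (liouville z)
      = D (\<lambda>y. D (velocity F) y (liouville y)) z (lie_bracket (hor F u) (hor F w) z)"
    using D_lie_bracket[OF open_\<Omega> smooth_liouville smB smooth_velocity assms, of u w]
      linear_0[OF linear_D[OF smooth_velocity assms]] by simp
  also have "\<dots> = hor_curv u w z"
    using D_cong_smooth[OF open_\<Omega> smooth_velocity assms, of "\<lambda>y. D (velocity F) y (liouville y)"]
    by (simp add: D_velocity_liouville hor_curv_def)
  finally show ?thesis by (simp add: hor_curv_def[abs_def])
qed

lemma hor_curv_bianchi:
  assumes "z \<in> \<Omega>"
  shows "D (hor_curv u w) z (vert F l z) + D (hor_curv w l) z (vert F u z)
    + D (hor_curv l u) z (vert F w z) = 0"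
proof -
  note c = lie_bracket_cong_right[OF open_\<Omega> smooth_hor _ assms]
  note sm = smooth_on_lie_bracket[OF open_\<Omega> smooth_hor smooth_vert]
  note smB = smooth_on_lie_bracket[OF open_\<Omega> smooth_hor smooth_hor]
  have neg: "lie_bracket (hor F a) (lie_bracket (vert F b) (hor F d)) z
      = - lie_bracket (hor F a) (lie_bracket (hor F d) (vert F b)) z" for a b d
    unfolding lie_bracket_uminus_right[OF sm smooth_hor assms, symmetric]
    by (rule c[OF smooth_on_uminus[OF open_\<Omega> sm]]) (rule lie_bracket_commute)
  have sym: "lie_bracket (hor F a) (lie_bracket (hor F b) (vert F d)) z
      = lie_bracket (hor F a) (lie_bracket (hor F d) (vert F b)) z" for a b d
    by (rule c[OF sm]) (rule bracket_hor_vert_sym)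
  have jac: "lie_bracket (hor F a) (lie_bracket (hor F b) (vert F d)) z
      - lie_bracket (hor F b) (lie_bracket (hor F a) (vert F d)) z
      + lie_bracket (vert F d) (lie_bracket (hor F a) (hor F b)) z = 0" for a b d
    using lie_bracket_jacobi[OF open_\<Omega> smooth_hor smooth_hor smooth_vert assms, of a b d] neg by simp
  have sum: "lie_bracket (vert F l) (lie_bracket (hor F u) (hor F w)) z
      + lie_bracket (vert F u) (lie_bracket (hor F w) (hor F l)) z
      + lie_bracket (vert F w) (lie_bracket (hor F l) (hor F u)) z = 0"
    using jac[of u w l] jac[of w l u, unfolded sym[of w l u]] jac[of l u w]
    unfolding sym[of u w l] sym[of l u w] by (rule cyclic_cancel)
  \<comment> \<open>Along \<open>vert F d\<close> the Legendre map has constant rate, so one term of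
    the commutator drops out and the double bracket becomes a plain derivative of
    \<open>hor_curv\<close>.\<close>
  have "D (velocity F) z (lie_bracket (vert F d) (lie_bracket (hor F a) (hor F b)) z)
      = D (hor_curv a b) z (vert F d z)" for a b d
    using D_lie_bracket[OF open_\<Omega> smooth_vert smB smooth_velocity assms]
    by (simp add: D_D_velocity_vert assms hor_curv_def[abs_def])
  then show ?thesis
    using arg_cong[OF sum, of "D (velocity F) z"] linear_add[OF linear_D[OF smooth_velocity assms]]
      linear_0[OF linear_D[OF smooth_velocity assms]] by simp
qed

text \<open>Raising the free index turns \<open>g_hk w^k\<close> into \<open>w\<close> and
  \<open>p_h\<close> into the Legendre vector. The minus sign comes from moving the contracted
  vector to the second slot, and \<open>(F z)^2\<close> is written as a pairing because it will be
  differentiated.\<close>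

lemma flag_hor_curv:
  assumes flag: "\<And>h k. (\<Sum>j\<in>UNIV. curv F h j k z * p_up F z j)
      = c * ((F z)^2 * g_low F z $ h $ k - p_low z h * p_low z k)"
    and z: "z \<in> \<Omega>"
  shows "hor_curv w (velocity F z) z
    = - c *\<^sub>R ((velocity F z \<bullet> snd z) *\<^sub>R w - (snd z \<bullet> w) *\<^sub>R velocity F z)"
proof -
  define y where "y = velocity F z"
  define B where "B = (\<lambda>u w. lie_bracket (hor F u) (hor F w) z)"
  have lin: "linear (B u)" for u unfolding B_def by (rule hor_bracket_linear[OF z])
  have anti: "B u w = - B w u" for u w unfolding B_def by (rule lie_bracket_commute)
  have fstB: "fst (B u w) = 0" for u w unfolding B_def by (simp add: bracket_hor_hor z)
  have ax: "snd (B y (axis k 1)) $ h = c * ((F z)^2 * g_low F z $ h $ k - snd z $ h * snd z $ k)" for h k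
  proof -
    have "B y (axis k 1) = - (\<Sum>j\<in>UNIV. y $ j *\<^sub>R B (axis k 1) (axis j 1))"
      by (subst anti, subst linear_expand_axis[OF lin]) simp
    also have "\<dots> = (\<Sum>j\<in>UNIV. y $ j *\<^sub>R B (axis j 1) (axis k 1))"
      by (subst anti[of "axis k 1"]) (simp add: sum_negf)
    finally have "snd (B y (axis k 1)) $ h = (\<Sum>j\<in>UNIV. y $ j * snd (B (axis j 1) (axis k 1)) $ h)"
      by (simp add: snd_sum)
    then show ?thesis
      using flag[of h k] by (simp add: curv_eq z p_up_velocity y_def B_def p_low_def mult.commute)
  qed
  have "snd (B y w) $ h = (c *\<^sub>R ((F z)^2 *\<^sub>R (g_low F z *v w) - (snd z \<bullet> w) *\<^sub>R snd z)) $ h" for h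
  proof -
    have "snd (B y w) $ h = (\<Sum>k\<in>UNIV. w $ k * snd (B y (axis k 1)) $ h)"
      by (subst linear_expand_axis[OF lin, of _ w]) (simp add: snd_sum)
    also have "\<dots> = (\<Sum>k\<in>UNIV. c * (F z)^2 * (g_low F z $ h $ k * w $ k) - c * snd z $ h * (snd z $ k * w $ k))"
      unfolding ax by (intro sum.cong) (simp_all add: algebra_simps)
    also have "\<dots> = c * (F z)^2 * (\<Sum>k\<in>UNIV. g_low F z $ h $ k * w $ k)
        - c * snd z $ h * (\<Sum>k\<in>UNIV. snd z $ k * w $ k)"
      by (simp only: sum_subtractf sum_distrib_left)
    finally show ?thesis
      by (simp add: matrix_vector_mult_def inner_vec_def right_diff_distrib)
  qed
  then have "snd (B y w) = c *\<^sub>R ((F z)^2 *\<^sub>R (g_low F z *v w) - (snd z \<bullet> w) *\<^sub>R snd z)"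
    by (simp add: vec_eq_iff)
  then have "B y w = (0, c *\<^sub>R ((F z)^2 *\<^sub>R (g_low F z *v w) - (snd z \<bullet> w) *\<^sub>R snd z))"
    using fstB by (metis prod.collapse)
  then have "hor_curv y w z = c *\<^sub>R ((F z)^2 *\<^sub>R w - (snd z \<bullet> w) *\<^sub>R y)"
    unfolding hor_curv_def B_def
    by (simp add: g_up_mult[OF z, symmetric] matrix_vector_mult_scaleR matrix_vector_mult_diff_distrib
        g_up_low z g_up_p y_def)
  then show ?thesis
    using hor_curv_antisym[OF z, of w y] by (simp add: y_def velocity_inner_p z)
qed

text \<open>The flag curvature only controls the curvature contracted with the Liouville direction;
  the Bianchi identity recovers the full curvature from it.\<close>
lemma hor_curv_constant:
  assumes flag: "\<And>z h k. z \<in> \<Omega> \<Longrightarrow> (\<Sum>j\<in>UNIV. curv F h j k z * p_up F z j)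
      = c * ((F z)^2 * g_low F z $ h $ k - p_low z h * p_low z k)"
    and z: "z \<in> \<Omega>"
  shows "hor_curv u w z = c *\<^sub>R ((snd z \<bullet> u) *\<^sub>R w - (snd z \<bullet> w) *\<^sub>R u)"
proof -
  \<comment> \<open>Frozen at \<open>z\<close>, the Legendre vector is a constant to which the
    Bianchi identity applies; at \<open>z\<close> itself its vertical field is the Liouville
    field.\<close>
  define l where "l = velocity F z"
  have vl: "vert F l z = liouville z" by (simp add: vert_def liouville_def l_def g_low_velocity z)
  have E: "D (\<lambda>y. hor_curv b l y) z (vert F a z)
    = - c *\<^sub>R ((2 * (snd z \<bullet> a)) *\<^sub>R b - ((g_low F z *v a) \<bullet> b) *\<^sub>R l - (snd z \<bullet> b) *\<^sub>R a)
      - hor_curv b a z" for a b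
  proof -
    define f where "f = (\<lambda>y. - c *\<^sub>R ((velocity F y \<bullet> snd y) *\<^sub>R b - (snd y \<bullet> b) *\<^sub>R velocity F y))"
    have dv: "(velocity F has_derivative D (velocity F) z) (at z)"
      by (rule smooth_has_derivative[OF smooth_velocity z])
    have smf: "smooth_on \<Omega> f"
      unfolding f_def by (intro smooth_on_scaleR smooth_on_diff smooth_on_inner open_\<Omega> smooth_velocity
          smooth_on_const smooth_on_snd smooth_on_ident)
    have df: "(f has_derivative (\<lambda>v. - c *\<^sub>R ((velocity F z \<bullet> snd v + D (velocity F) z v \<bullet> snd z) *\<^sub>R b
        - ((snd z \<bullet> b) *\<^sub>R D (velocity F) z v + (snd v \<bullet> b) *\<^sub>R velocity F z)))) (at z)"
      unfolding f_def by (auto intro!: derivative_eq_intros dv)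
    have Df: "D f z (vert F a z)
        = - c *\<^sub>R ((2 * (snd z \<bullet> a)) *\<^sub>R b - ((g_low F z *v a) \<bullet> b) *\<^sub>R l - (snd z \<bullet> b) *\<^sub>R a)"
      using g_low_sym[OF z, of "velocity F z" a] unfolding D_eqI[OF df] D_velocity_vert[OF z]
      by (simp add: l_def g_low_velocity z inner_commute[of a] vert_def)
    have "D (\<lambda>y. hor_curv b (velocity F y) y) z = D f z"
      by (rule D_cong_smooth[OF open_\<Omega> smf z]) (simp add: f_def flag_hor_curv[OF flag])
    moreover have "D (\<lambda>y. hor_curv b (velocity F y) y) z v
        = D (\<lambda>y. hor_curv b l y) z v + hor_curv b (D (velocity F) z v) z" for v
      unfolding l_def
      by (rule D_apply_field(2)[OF open_\<Omega> _ _ _ z])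
        (auto intro: linear_hor_curv smooth_hor_curv smooth_differentiable[OF smooth_velocity z])
    ultimately show ?thesis using Df by (simp add: D_velocity_vert z algebra_simps)
  qed
  have third: "D (hor_curv l u) z v = - D (\<lambda>y. hor_curv u l y) z v" for v
  proof -
    have "D (hor_curv l u) z = D (\<lambda>y. - hor_curv u l y) z"
      by (rule D_cong_smooth[OF open_\<Omega> smooth_on_uminus[OF open_\<Omega> smooth_hor_curv] z])
        (rule hor_curv_antisym[symmetric])
    then show ?thesis by (simp add: D_uminus[OF smooth_differentiable[OF smooth_hor_curv z]])
  qed
  \<comment> \<open>One copy of the curvature comes from homogeneity, and one from the moving
    argument in each of the two other cyclic terms. The terms with \<open>l\<close> cancel by
    symmetry of \<open>g_low\<close>.\<close>
  have "3 *\<^sub>R hor_curv u w z = 3 *\<^sub>R (c *\<^sub>R ((snd z \<bullet> u) *\<^sub>R w - (snd z \<bullet> w) *\<^sub>R u))"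
    using hor_curv_bianchi[OF z, of u w l] hor_curv_antisym[OF z, of w u] g_low_sym[OF z, of u w]
    unfolding vl third hor_curv_liouville[OF z] E
    by (simp add: vec_eq_iff inner_commute[of u] algebra_simps)
  then show ?thesis by (metis scaleR_cancel_left zero_neq_numeral)
qed

end

section \<open>The Kaehler structure in a chart\<close>

text \<open>\<open>G_metric\<close> and \<open>J_structure\<close> depend on the chart only through
  the local expression of \<open>K\<close>. Taking that expression as an argument lets the
  chart-level proof work on open sets of phase space.\<close>

definition G_form ::
    "real \<Rightarrow> real \<Rightarrow> real \<Rightarrow> ('n::finite phase \<Rightarrow> real) \<Rightarrow> 'n phase \<Rightarrow> 'n phase \<Rightarrow> 'n phase \<Rightarrow> real" where
  "G_form \<alpha> \<beta> v F z X Y =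
     (\<Sum>i\<in>UNIV. \<Sum>j\<in>UNIV. G_low \<alpha> \<beta> v F z $ i $ j * dx_form i X * dx_form j Y)
     + (\<Sum>i\<in>UNIV. \<Sum>j\<in>UNIV.
          G_up \<alpha> \<beta> v F z $ i $ j * deltap_form F i z X * deltap_form F j z Y)"

definition J_map ::
    "real \<Rightarrow> real \<Rightarrow> real \<Rightarrow> ('n::finite phase \<Rightarrow> real) \<Rightarrow> 'n phase \<Rightarrow> 'n phase \<Rightarrow> 'n phase" where
  "J_map \<alpha> \<beta> v F z X =
     (\<Sum>i\<in>UNIV. dx_form i X *\<^sub>R (\<Sum>k\<in>UNIV. G_low \<alpha> \<beta> v F z $ i $ k *\<^sub>R vert_vec k))
     + (\<Sum>i\<in>UNIV. deltap_form F i z X *\<^sub>R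
          (- (\<Sum>k\<in>UNIV. G_up \<alpha> \<beta> v F z $ i $ k *\<^sub>R delta_vec F k z)))"

lemma G_metric_eq: "G_metric \<alpha> \<beta> v K c z = G_form \<alpha> \<beta> v (K \<circ> coord_inv c) z"
  by (simp add: G_metric_def G_form_def Let_def fun_eq_iff)

lemma J_structure_eq: "J_structure \<alpha> \<beta> v K c z = J_map \<alpha> \<beta> v (K \<circ> coord_inv c) z"
  by (simp add: J_structure_def J_map_def Let_def fun_eq_iff)

text \<open>The tangent vector with components \<open>a\<close> in \<open>\<delta>\<^sub>i\<close> and \<open>b\<close> in \<open>J \<delta>\<^sub>i\<close>.\<close>
definition frame ::
    "real \<Rightarrow> real \<Rightarrow> real \<Rightarrow> ('n::finite phase \<Rightarrow> real) \<Rightarrow> 'n phase \<Rightarrow> real^'n \<Rightarrow> real^'n \<Rightarrow> 'n phase" where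
  "frame \<alpha> \<beta> v F z a b = (a, conn F z *v a + G_low \<alpha> \<beta> v F z *v b)"

lemma inner_matrix_vector_sum:
  fixes M :: "real^'n^'m"
  shows "(\<Sum>i\<in>UNIV. \<Sum>j\<in>UNIV. M $ i $ j * x $ i * y $ j) = x \<bullet> (M *v y)"
  by (simp add: inner_vec_def matrix_vector_mult_def sum_distrib_left mult_ac)

lemma sum_scaleR_axis_pair: "(\<Sum>k\<in>UNIV. a $ k *\<^sub>R (0::real^'n, axis k (1::real))) = (0, a :: real^'n)"
  using basis_expansion[of a]
  by (intro prod_eqI) (simp_all add: fst_sum snd_sum scalar_mult_eq_scaleR)

text \<open>The condition \<open>tube\<close> is \<open>\<alpha> + 2 \<tau> v > 0\<close> divided by
  \<open>\<alpha>\<close>, with \<open>v\<close> inserted.\<close>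

locale kaehler_chart = cartan_chart \<Omega> F
  for \<Omega> :: "'n::finite phase set" and F :: "'n phase \<Rightarrow> real" +
  fixes \<kappa> \<alpha> \<beta> v :: real
  assumes \<alpha>_pos: "\<alpha> > 0" and \<beta>_pos: "\<beta> > 0" and v_eq: "v = - \<kappa> * \<alpha> * \<beta>\<^sup>2"
    and tube: "\<And>z. z \<in> \<Omega> \<Longrightarrow> \<kappa> * \<beta>\<^sup>2 * (F z)\<^sup>2 < 1"
    and flag: "\<And>z h k. z \<in> \<Omega> \<Longrightarrow> (\<Sum>j\<in>UNIV. curv F h j k z * p_up F z j)
      = \<kappa> * ((F z)^2 * g_low F z $ h $ k - p_low z h * p_low z k)"
begin

abbreviation G where "G \<equiv> G_low \<alpha> \<beta> v F"
abbreviation J where "J \<equiv> J_map \<alpha> \<beta> v F"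
abbreviation G_met where "G_met \<equiv> G_form \<alpha> \<beta> v F"
abbreviation G_inv where "G_inv \<equiv> G_up \<alpha> \<beta> v F"
abbreviation frm where "frm \<equiv> frame \<alpha> \<beta> v F"

lemma coeff_eq: "v / (\<alpha> * \<beta>) = - \<kappa> * \<beta>"
  using \<alpha>_pos \<beta>_pos by (simp add: v_eq power2_eq_square)

lemma G_mult: "G z *v u = (1/\<beta>) *\<^sub>R (g_low F z *v u) + (- \<kappa> * \<beta> * (snd z \<bullet> u)) *\<^sub>R snd z"
proof -
  have "(G z *v u) $ i = (\<Sum>j\<in>UNIV. (1/\<beta>) * (g_low F z $ i $ j * u $ j)
      + (- \<kappa> * \<beta> * snd z $ i) * (snd z $ j * u $ j))" for i
    by (simp add: G_low_def coeff_eq p_low_def matrix_vector_mult_def algebra_simps)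
  then have "(G z *v u) $ i = ((1/\<beta>) *\<^sub>R (g_low F z *v u) + (- \<kappa> * \<beta> * (snd z \<bullet> u)) *\<^sub>R snd z) $ i" for i
    by (simp only: sum.distrib sum_distrib_left[symmetric])
      (simp add: matrix_vector_mult_def inner_vec_def mult_ac)
  then show ?thesis by (simp add: vec_eq_iff)
qed

section \<open>Symmetry and positivity of the metric on the tube\<close>

lemma G_sym: "z \<in> \<Omega> \<Longrightarrow> (G z *v a) \<bullet> b = a \<bullet> (G z *v b)"
  by (simp add: G_mult inner_diff_left inner_diff_right g_low_sym inner_commute[of a "snd z"])

lemma g_low_pos: "z \<in> \<Omega> \<Longrightarrow> u \<noteq> 0 \<Longrightarrow> 0 < u \<bullet> (g_low F z *v u)"
  using pos_g[of z "g_low F z *v u"] g_up_low[of z u]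
  by (metis inner_commute matrix_vector_mult_0_right)

lemma g_low_nonneg: "z \<in> \<Omega> \<Longrightarrow> 0 \<le> u \<bullet> (g_low F z *v u)"
  using g_low_pos[of z u] by (cases "u = 0") auto

lemma momentum_cauchy_schwarz:
  assumes z: "z \<in> \<Omega>"
  shows "(snd z \<bullet> u)\<^sup>2 \<le> (F z)\<^sup>2 * (u \<bullet> (g_low F z *v u))"
proof (cases "F z = 0")
  \<comment> \<open>A zero of \<open>F\<close> forces \<open>p = 0\<close>, because
    \<open>(F z)^2\<close> is the squared length of the Legendre vector.\<close>
  case True
  have "velocity F z \<bullet> (g_low F z *v velocity F z) = 0"
    using True by (simp add: g_low_velocity z velocity_inner_p)
  then have "velocity F z = 0" using g_low_pos[OF z] by fastforce
  then have "snd z = 0" using g_low_velocity[OF z] by simp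
  then show ?thesis using g_low_nonneg[OF z] by simp
next
  case False
  define f q s where "f = (F z)\<^sup>2" and "q = u \<bullet> (g_low F z *v u)" and "s = snd z \<bullet> u"
  \<comment> \<open>Up to the factor \<open>f\<close>, the part of \<open>u\<close> that is
    \<open>g\<close>-orthogonal to the Legendre vector; its squared length is the defect in the
    inequality.\<close>
  define w where "w = f *\<^sub>R u - s *\<^sub>R velocity F z"
  have gw: "g_low F z *v w = f *\<^sub>R (g_low F z *v u) - s *\<^sub>R snd z"
    by (simp add: w_def matrix_vector_mult_diff_distrib matrix_vector_mult_scaleR g_low_velocity z)
  have "velocity F z \<bullet> (g_low F z *v u) = s"
    using g_low_sym[OF z, of "velocity F z" u] by (simp add: g_low_velocity z s_def)
  moreover have "velocity F z \<bullet> snd z = f" by (simp add: velocity_inner_p z f_def)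
  ultimately have "w \<bullet> (g_low F z *v w) = f * (f * q - s\<^sup>2)"
    unfolding gw unfolding w_def
    by (simp add: inner_diff_left inner_diff_right q_def[symmetric]
        inner_commute[of u "snd z"] s_def[symmetric] power2_eq_square algebra_simps)
  moreover have "f > 0" using False by (simp add: f_def)
  ultimately have "0 \<le> f * q - s\<^sup>2"
    using g_low_nonneg[OF z, of w] by (simp add: zero_le_mult_iff)
  then show ?thesis by (simp add: f_def q_def s_def)
qed

text \<open>For \<open>\<kappa> \<le> 0\<close> the rank-one term only helps. For
  \<open>\<kappa> > 0\<close> Cauchy-Schwarz bounds it, and the tube condition makes the bound
  strictly smaller than the main term.\<close>

lemma G_pos:
  assumes z: "z \<in> \<Omega>" and u: "u \<noteq> 0"
  shows "0 < u \<bullet> (G z *v u)"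
proof -
  define q where "q = u \<bullet> (g_low F z *v u)"
  have q: "q > 0" unfolding q_def by (rule g_low_pos[OF z u])
  have "\<kappa> * \<beta>\<^sup>2 * (snd z \<bullet> u)\<^sup>2 < q"
  proof (cases "\<kappa> \<le> 0")
    case True
    then have "\<kappa> * \<beta>\<^sup>2 * (snd z \<bullet> u)\<^sup>2 \<le> 0" by (simp add: mult_nonpos_nonneg)
    then show ?thesis using q by simp
  next
    case False
    then have "\<kappa> * \<beta>\<^sup>2 * (snd z \<bullet> u)\<^sup>2 \<le> \<kappa> * \<beta>\<^sup>2 * ((F z)\<^sup>2 * q)"
      using momentum_cauchy_schwarz[OF z] by (intro mult_left_mono) (auto simp: q_def)
    also have "\<dots> < 1 * q"
      unfolding mult.assoc[symmetric] using tube[OF z] q by (intro mult_strict_right_mono) auto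
    finally show ?thesis by simp
  qed
  moreover have "\<beta> * (u \<bullet> (G z *v u)) = q - \<kappa> * \<beta>\<^sup>2 * (snd z \<bullet> u)\<^sup>2"
    using \<beta>_pos by (simp add: G_mult inner_diff_right q_def[symmetric] inner_commute[of u "snd z"]
        power2_eq_square algebra_simps)
  ultimately have "0 < \<beta> * (u \<bullet> (G z *v u))" by simp
  then show ?thesis using \<beta>_pos by (simp add: zero_less_mult_iff)
qed

lemma invertible_G: "z \<in> \<Omega> \<Longrightarrow> invertible (G z)"
  using G_pos by (rule pos_def_invertible)

lemma G_G_up: "z \<in> \<Omega> \<Longrightarrow> G z *v (G_inv z *v u) = u"
  and G_up_G: "z \<in> \<Omega> \<Longrightarrow> G_inv z *v (G z *v u) = u"
  unfolding G_up_def by (rule matrix_inv_vector_mult[OF invertible_G]; assumption)+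

lemma G_up_sym: "z \<in> \<Omega> \<Longrightarrow> (G_inv z *v a) \<bullet> b = a \<bullet> (G_inv z *v b)"
  unfolding G_up_def using inner_matrix_inv_sym[OF invertible_G] G_sym by blast

lemma smooth_G: "smooth_on \<Omega> G"
proof (rule smooth_on_matrixI[OF open_\<Omega>])
  fix i j
  have "smooth_on \<Omega> (\<lambda>z. 1/\<beta> * g_low F z $ i $ j + v/(\<alpha>*\<beta>) * snd z $ i * snd z $ j)"
    by (intro smooth_on_add smooth_on_mult smooth_on_nth smooth_on_snd smooth_on_ident smooth_g_low
        open_\<Omega> smooth_on_const)
  then show "smooth_on \<Omega> (\<lambda>z. G z $ i $ j)"
    by (simp add: G_low_def p_low_def)
qed

lemma smooth_G_up: "smooth_on \<Omega> (G_inv)"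
  unfolding G_up_def[abs_def] by (rule smooth_on_matrix_inv[OF open_\<Omega> smooth_G invertible_G])

section \<open>The metric and the complex structure in the adapted frame\<close>

lemma frame_exhaust:
  assumes "z \<in> \<Omega>"
  obtains a b where "X = frm z a b"
proof
  show "X = frm z (fst X) (G_inv z *v (snd X - conn F z *v fst X))"
    by (simp add: frame_def G_G_up assms)
qed

lemma frame_0: "frm z a 0 = hor F a z"
  by (simp add: frame_def hor_def)

lemma deltap_form_eq:
  "z \<in> \<Omega> \<Longrightarrow> deltap_form F i z X = (snd X - conn F z *v fst X) $ i"
  using conn_sym[of z i] by (simp add: deltap_form_def dx_form_def matrix_vector_mult_def)
    (simp add: conn_def)

lemma delta_vec_eq: "z \<in> \<Omega> \<Longrightarrow> delta_vec F k z = hor F (axis k 1) z"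
proof -
  assume z: "z \<in> \<Omega>"
  have "nonlin_conn F k j z = (conn F z *v axis k 1) $ j" for j
    using conn_sym[OF z, of j k] by (simp add: matrix_vector_mul_component inner_axis) (simp add: conn_def)
  then show ?thesis
    using sum_scaleR_axis_pair[of "conn F z *v axis k 1"] by (simp add: delta_vec_def hor_def)
qed

text \<open>Symmetry of \<open>M\<close> converts the row contractions in \<open>J_map\<close> into
  a matrix-vector product.\<close>

lemma sum_row_scaleR:
  fixes L :: "real^'n \<Rightarrow> 'b::real_vector" and M :: "real^'n^'n"
  assumes "linear L" "\<And>q r. (M *v q) \<bullet> r = q \<bullet> (M *v r)"
  shows "(\<Sum>i\<in>UNIV. a $ i *\<^sub>R (\<Sum>k\<in>UNIV. M $ i $ k *\<^sub>R L (axis k 1))) = L (M *v a)"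
proof -
  have "(\<Sum>k\<in>UNIV. M $ i $ k *\<^sub>R L (axis k 1)) = L (M *v axis i 1)" for i
  proof -
    have "M $ i $ k = (M *v axis i 1) $ k" for k
      using assms(2)[of "axis k 1" "axis i 1"] by (simp add: matrix_nth_inner inner_axis inner_axis')
    then show ?thesis using linear_expand_axis[OF assms(1), of "M *v axis i 1"] by simp
  qed
  then show ?thesis
    using linear_expand_axis[OF linear_compose[OF matrix_vector_mul_linear assms(1)], of M a]
    by (simp add: o_def)
qed

lemma linear_hor: "linear (\<lambda>u. hor F u z)"
  by (rule linearI) (simp_all add: hor_def matrix_vector_right_distrib matrix_vector_mult_scaleR)

lemma J_map_eq:
  assumes "z \<in> \<Omega>"
  shows "J z X
    = (0, G z *v fst X) - hor F (G_inv z *v (snd X - conn F z *v fst X)) z"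
proof -
  have lin: "linear (\<lambda>b. (0::real^'n, b))" for z :: 'a by (rule linearI) simp_all
  have "(\<Sum>i\<in>UNIV. dx_form i X *\<^sub>R (\<Sum>k\<in>UNIV. G z $ i $ k *\<^sub>R vert_vec k)) = (0, G z *v fst X)"
    unfolding dx_form_def vert_vec_def
    by (rule sum_row_scaleR[OF lin G_sym[OF assms]])
  moreover have "(\<Sum>i\<in>UNIV. deltap_form F i z X *\<^sub>R (\<Sum>k\<in>UNIV. G_inv z $ i $ k *\<^sub>R delta_vec F k z))
      = hor F (G_inv z *v (snd X - conn F z *v fst X)) z"
    unfolding deltap_form_eq[OF assms] delta_vec_eq[OF assms]
    by (rule sum_row_scaleR[OF linear_hor G_up_sym[OF assms]])
  ultimately show ?thesis by (simp add: J_map_def sum_negf)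
qed

text \<open>In frame components \<open>J\<close> is multiplication by the imaginary unit on
  \<open>a + i b\<close>; its square and the Hermitian property can be read off.\<close>

lemma J_frame:
  assumes "z \<in> \<Omega>"
  shows "J z (frm z a b) = frm z (- b) a"
  using linear_neg[OF matrix_vector_mul_linear, of "conn F z" b]
  by (simp add: J_map_eq assms frame_def hor_def G_up_G)

lemma G_form_eq:
  assumes "z \<in> \<Omega>"
  shows "G_met z X Y = fst X \<bullet> (G z *v fst Y)
    + (snd X - conn F z *v fst X) \<bullet> (G_inv z *v (snd Y - conn F z *v fst Y))"
  unfolding G_form_def deltap_form_eq[OF assms] dx_form_def inner_matrix_vector_sum ..

lemma G_frame:
  assumes "z \<in> \<Omega>"
  shows "G_met z (frm z a b) (frm z a' b')
    = a \<bullet> (G z *v a') + b \<bullet> (G z *v b')"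
  using G_sym[OF assms] by (simp add: G_form_eq assms frame_def G_up_G)

lemma linear_J: "z \<in> \<Omega> \<Longrightarrow> linear (J z)"
  by (rule linearI)
    (simp_all add: J_map_eq hor_def matrix_vector_right_distrib matrix_vector_mult_diff_distrib
      matrix_vector_mult_scaleR algebra_simps)

lemma smooth_J: "smooth_on \<Omega> (\<lambda>z. J z X)"
proof (rule smooth_on_cong[OF open_\<Omega>])
  show "smooth_on \<Omega> (\<lambda>z. (0, G z *v fst X)
      - hor F (G_inv z *v (snd X - conn F z *v fst X)) z)"
    unfolding hor_def
    by (intro smooth_on_diff smooth_on_Pair smooth_matrix_vector_mult open_\<Omega> smooth_on_const
        smooth_G smooth_G_up smooth_conn)
qed (simp add: J_map_eq)

lemma J_J:
  assumes "z \<in> \<Omega>"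
  shows "J z (J z X) = - X"
proof -
  obtain a b where X: "X = frm z a b" using frame_exhaust[OF assms] .
  have "frm z (- a) (- b) = - frm z a b"
    by (simp add: frame_def linear_neg[OF matrix_vector_mul_linear])
  then show ?thesis by (simp add: X J_frame assms)
qed

lemma bilinear_G: "z \<in> \<Omega> \<Longrightarrow> bilinear (G_met z)"
  by (auto simp: bilinear_def G_form_eq inner_add_left inner_add_right matrix_vector_right_distrib
      matrix_vector_mult_diff_distrib matrix_vector_mult_scaleR algebra_simps inner_diff_left inner_diff_right
      intro!: linearI)

lemma smooth_G_form: "smooth_on \<Omega> (\<lambda>z. G_met z X Y)"
proof (rule smooth_on_cong[OF open_\<Omega>])
  show "smooth_on \<Omega> (\<lambda>z. fst X \<bullet> (G z *v fst Y)
    + (snd X - conn F z *v fst X) \<bullet> (G_inv z *v (snd Y - conn F z *v fst Y)))"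
    by (intro smooth_on_add smooth_on_diff smooth_on_inner smooth_matrix_vector_mult open_\<Omega>
        smooth_on_const smooth_G smooth_G_up smooth_conn)
qed (simp add: G_form_eq)

lemma G_form_sym:
  assumes "z \<in> \<Omega>"
  shows "G_met z X Y = G_met z Y X"
  using G_sym[OF assms, of "fst X" "fst Y"]
    G_up_sym[OF assms, of "snd X - conn F z *v fst X" "snd Y - conn F z *v fst Y"]
  by (simp add: G_form_eq assms inner_commute)

lemma G_form_pos:
  assumes "z \<in> \<Omega>" "X \<noteq> 0"
  shows "0 < G_met z X X"
proof -
  obtain a b where X: "X = frm z a b" using frame_exhaust[OF assms(1)] .
  then have "a \<noteq> 0 \<or> b \<noteq> 0" using assms(2) by (auto simp: frame_def zero_prod_def)
  moreover have "0 \<le> u \<bullet> (G z *v u)" for u using G_pos[OF assms(1), of u] by (cases "u = 0") auto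
  ultimately show ?thesis
    unfolding X G_frame[OF assms(1)] using G_pos[OF assms(1)] by (metis add_nonneg_pos add_pos_nonneg)
qed

lemma G_form_hermitian:
  assumes "z \<in> \<Omega>"
  shows "G_met z (J z X) (J z Y) = G_met z X Y"
proof -
  obtain a b a' b' where "X = frm z a b" "Y = frm z a' b'"
    using frame_exhaust[OF assms] by metis
  then show ?thesis
    by (simp add: J_frame G_frame assms linear_neg[OF matrix_vector_mul_linear])
qed

text \<open>The canonical symplectic form: here the symmetry of \<open>N\<^sub>i\<^sub>j\<close> enters.\<close>
lemma fundamental_form:
  assumes "z \<in> \<Omega>"
  shows "G_met z X (J z Y) = snd X \<bullet> fst Y - fst X \<bullet> snd Y"
proof -
  obtain a b a' b' where XY: "X = frm z a b" "Y = frm z a' b'"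
    using frame_exhaust[OF assms] by metis
  show ?thesis
    unfolding XY J_frame[OF assms] G_frame[OF assms]
    using conn_inner_sym[OF assms, of a a'] G_sym[OF assms, of b a']
    by (simp add: frame_def inner_add_left inner_add_right linear_neg[OF matrix_vector_mul_linear])
qed

text \<open>This is the field \<open>J (hor F u)\<close>, by \<open>J_hor\<close>.\<close>

definition vert_G :: "real^'n \<Rightarrow> 'n phase \<Rightarrow> 'n phase" where
  "vert_G u z = (0, G z *v u)"

lemma smooth_vert_G: "smooth_on \<Omega> (vert_G u)"
  unfolding vert_G_def[abs_def]
  by (intro smooth_on_Pair smooth_matrix_vector_mult open_\<Omega> smooth_G smooth_on_const)

lemma vert_G_eq: "vert_G u z = (1/\<beta>) *\<^sub>R vert F u z + (- \<kappa> * \<beta> * (snd z \<bullet> u)) *\<^sub>R liouville z"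
  by (simp add: vert_G_def vert_def liouville_def G_mult)

lemma D_vert_G:
  assumes "z \<in> \<Omega>"
  shows "D (vert_G u) z X = (0, (1/\<beta>) *\<^sub>R (D (g_low F) z X *v u)
    + (- \<kappa> * \<beta>) *\<^sub>R ((snd X \<bullet> u) *\<^sub>R snd z + (snd z \<bullet> u) *\<^sub>R snd X))"
proof -
  have dg: "((\<lambda>y. g_low F y *v u) has_derivative (\<lambda>X. D (g_low F) z X *v u)) (at z)"
    using smooth_has_derivative[OF smooth_matrix_vector_mult[OF open_\<Omega> smooth_g_low smooth_on_const] assms, of u]
      D_matrix_vector_const[OF smooth_differentiable[OF smooth_g_low assms]]
    by (metis (no_types, lifting) ext)
  have "((\<lambda>y. (0::real^'n, (1/\<beta>) *\<^sub>R (g_low F y *v u) + (- \<kappa> * \<beta> * (snd y \<bullet> u)) *\<^sub>R snd y)) has_derivative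
      (\<lambda>X. (0, (1/\<beta>) *\<^sub>R (D (g_low F) z X *v u)
        + ((- \<kappa> * \<beta> * (snd z \<bullet> u)) *\<^sub>R snd X + (- \<kappa> * \<beta> * (snd X \<bullet> u)) *\<^sub>R snd z)))) (at z)"
    by (auto intro!: derivative_eq_intros has_derivative_Pair dg)
  then show ?thesis
    unfolding vert_G_def[abs_def] G_mult by (simp add: D_eqI algebra_simps)
qed

text \<open>The rank-one part of \<open>vert_G\<close> adds a multiple of the Liouville field. Since
  that field commutes with horizontal ones, only its coefficient is differentiated, which gives the
  connection as a bilinear form in \<open>a\<close> and \<open>b\<close>, again symmetric.\<close>

lemma bracket_hor_vert_G_sym:
  assumes z: "z \<in> \<Omega>"
  shows "lie_bracket (hor F u) (vert_G w) z = lie_bracket (hor F w) (vert_G u) z"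
proof -
  note lin = linear_D[OF smooth_conn z]
  have bracket: "lie_bracket (hor F a) (vert_G b) z = (0, (1/\<beta>) *\<^sub>R snd (lie_bracket (hor F a) (vert F b) z)
      + (- \<kappa> * \<beta> * ((conn F z *v a) \<bullet> b)) *\<^sub>R snd z)" for a b
    unfolding lie_bracket_def D_vert_G[OF z] D_hor[OF z] D_vert[OF z] vert_G_eq
      linear_add[OF lin] linear_scale[OF lin]
    by (simp add: hor_def D_conn_liouville z matrix_vector_mult_add_rdistrib matrix_vector_mult_scaleR_left
        algebra_simps)
  show ?thesis
    unfolding bracket using bracket_hor_vert_sym[OF z, of u w] conn_inner_sym[OF z, of u w]
    by (simp add: inner_commute)
qed

text \<open>All terms of \<open>half\<close> are symmetric in \<open>a\<close> and \<open>b\<close>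
  except the one with \<open>(snd z \<bullet> b)\<close> times the lowered \<open>a\<close>. Its
  coefficient is \<open>(1/\<beta>) * (- \<kappa> * \<beta>) = - \<kappa>\<close>, and this is where
  the value of \<open>v\<close> pays off.\<close>

lemma bracket_vert_G_vert_G:
  assumes z: "z \<in> \<Omega>"
  shows "lie_bracket (vert_G u) (vert_G w) z
    = \<kappa> *\<^sub>R ((snd z \<bullet> u) *\<^sub>R vert F w z - (snd z \<bullet> w) *\<^sub>R vert F u z)"
proof -
  note lin = linear_D[OF smooth_g_low z]
  have half: "D (vert_G b) z (vert_G a z)
      = (0, (1/\<beta>\<^sup>2) *\<^sub>R (D (g_low F) z (vert F a z) *v b)
        + (- \<kappa>) *\<^sub>R (((g_low F z *v a) \<bullet> b) *\<^sub>R snd z + (snd z \<bullet> b) *\<^sub>R (g_low F z *v a))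
        + (2 * \<kappa>\<^sup>2 * \<beta>\<^sup>2 * (snd z \<bullet> a) * (snd z \<bullet> b)) *\<^sub>R snd z)" for a b
  proof -
    have 1: "D (g_low F) z (vert_G a z) *v b = (1/\<beta>) *\<^sub>R (D (g_low F) z (vert F a z) *v b)"
      unfolding vert_G_eq linear_add[OF lin] linear_scale[OF lin]
      by (simp only: matrix_vector_mult_add_rdistrib matrix_vector_mult_scaleR_left
          D_g_low_liouville[OF z] scaleR_zero_right add_0_right)
    have 2: "snd (vert_G a z) = (1/\<beta>) *\<^sub>R (g_low F z *v a) - (\<kappa> * \<beta> * (snd z \<bullet> a)) *\<^sub>R snd z"
      by (simp add: vert_G_def G_mult)
    show ?thesis
      unfolding D_vert_G[OF z] 1 2 using \<beta>_pos
      by (simp add: inner_diff_left power2_eq_square vec_eq_iff field_simps)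
  qed
  show ?thesis
    unfolding lie_bracket_def half
    using D_g_low_vert_sym[OF z, of u w] g_low_sym[OF z, of u w] inner_commute[of u]
    by (simp add: vert_def vec_eq_iff algebra_simps)
qed

lemma bracket_hor_hor_vert_G:
  assumes z: "z \<in> \<Omega>"
  shows "lie_bracket (hor F u) (hor F w) z = lie_bracket (vert_G u) (vert_G w) z"
proof -
  have "hor_curv u w z = \<kappa> *\<^sub>R ((snd z \<bullet> u) *\<^sub>R w - (snd z \<bullet> w) *\<^sub>R u)"
    by (rule hor_curv_constant[OF _ z]) (rule flag)
  then show ?thesis
    unfolding bracket_vert_G_vert_G[OF z] bracket_eq_vert_hor_curv[OF z]
    by (simp add: vert_def matrix_vector_mult_scaleR matrix_vector_mult_diff_distrib)
qed

lemma J_hor: "z \<in> \<Omega> \<Longrightarrow> J z (hor F u z) = vert_G u z"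
  using J_frame[of z u 0] by (simp add: frame_0) (simp add: frame_def vert_G_def)

text \<open>The two mixed brackets cancel by symmetry, and \<open>J^2 = -1\<close> leaves the
  difference of \<open>[J \<delta>, J \<delta>]\<close> and
  \<open>[\<delta>, \<delta>]\<close>.\<close>

lemma nijenhuis_hor:
  assumes z: "z \<in> \<Omega>"
  shows "nijenhuis (J) (hor F u) (hor F w) z = 0"
proof -
  have "lie_bracket (\<lambda>y. J y (hor F u y)) (\<lambda>y. J y (hor F w y)) z
      = lie_bracket (vert_G u) (vert_G w) z"
    by (rule lie_bracket_cong[OF open_\<Omega> smooth_vert_G smooth_vert_G z]) (simp_all add: J_hor)
  moreover have 1: "lie_bracket (hor F a) (\<lambda>y. J y (hor F b y)) z
      = lie_bracket (hor F a) (vert_G b) z" for a b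
    by (rule lie_bracket_cong_right[OF open_\<Omega> smooth_hor smooth_vert_G z]) (simp add: J_hor)
  moreover have "lie_bracket (\<lambda>y. J y (hor F u y)) (hor F w) z
      = - lie_bracket (hor F u) (vert_G w) z"
    unfolding lie_bracket_commute[of _ "hor F w"] 1 bracket_hor_vert_G_sym[OF z, of w u] ..
  ultimately show ?thesis
    by (simp add: nijenhuis_def J_J z linear_neg[OF linear_J] bracket_hor_hor_vert_G)
qed

lemma nijenhuis_J:
  assumes z: "z \<in> \<Omega>" and "smooth_on \<Omega> X" "smooth_on \<Omega> Y"
  shows "nijenhuis (J) X Y z = 0"
proof -
  have lin: "\<forall>y\<in>\<Omega>. linear (J y)" using linear_J by blast
  note tensor = nijenhuis_tensorial[OF open_\<Omega> lin smooth_J _ _ z]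
  have "nijenhuis_at (J) z a b = 0" for a b
  proof (rule nijenhuis_at_eq_0[OF open_\<Omega> lin smooth_J z, where B = "range (\<lambda>u. hor F u z)"])
    show "\<forall>y\<in>\<Omega>. \<forall>X. J y (J y X) = - X" using J_J by blast
    show "\<exists>a\<in>range (\<lambda>u. hor F u z). \<exists>b\<in>range (\<lambda>u. hor F u z). X = a + J z b" for X
    proof -
      obtain a b where "X = frm z a b" using frame_exhaust[OF z] .
      then have "X = hor F a z + J z (hor F b z)"
        by (simp add: J_hor z) (simp add: frame_def hor_def vert_G_def)
      then show ?thesis by blast
    qed
    show "nijenhuis_at (J) z a b = 0"
      if "a \<in> range (\<lambda>u. hor F u z)" "b \<in> range (\<lambda>u. hor F u z)" for a b
      using that tensor[OF smooth_differentiable[OF smooth_hor z] smooth_differentiable[OF smooth_hor z]]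
      by (auto simp: nijenhuis_hor[OF z])
  qed
  then show ?thesis
    using tensor smooth_differentiable[OF assms(2) z] smooth_differentiable[OF assms(3) z] by simp
qed

end

section \<open>Change of induced coordinates\<close>

text \<open>The new momenta \<open>P\<close> are tied to the old ones by the covector law, in which
  \<open>P\<close> stands on the side of \<open>D \<tau>\<close>; surjectivity of
  \<open>D \<tau>\<close> makes that law determine \<open>P\<close> and allows cancelling it
  (\<open>eq_by_A\<close>).\<close>

locale cartan_transition =
  src: cartan_chart \<Omega> F + dst: cartan_chart \<Omega>' F'
  for \<Omega> \<Omega>' :: "'n::finite phase set" and F F' :: "'n phase \<Rightarrow> real" +
  fixes W :: "'n phase set" and U :: "(real^'n) set"
    and \<tau> :: "real^'n \<Rightarrow> real^'n" and P :: "'n phase \<Rightarrow> real^'n"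
  assumes open_W: "open W" and W_subset: "W \<subseteq> \<Omega>"
    and open_U: "open U" and fst_W: "\<And>z. z \<in> W \<Longrightarrow> fst z \<in> U"
    and smooth_\<tau>: "smooth_on U \<tau>" and smooth_P: "smooth_on W P"
    and T_mem: "\<And>z. z \<in> W \<Longrightarrow> (\<tau> (fst z), P z) \<in> \<Omega>'"
    and F_eq: "\<And>z. z \<in> W \<Longrightarrow> F z = F' (\<tau> (fst z), P z)"
    and covector: "\<And>z u. z \<in> W \<Longrightarrow> snd z \<bullet> u = P z \<bullet> D \<tau> (fst z) u"
    and surj_D\<tau>: "\<And>z. z \<in> W \<Longrightarrow> surj (D \<tau> (fst z))"
begin

abbreviation d\<tau> where "d\<tau> z \<equiv> D \<tau> (fst z)"

definition T :: "'n phase \<Rightarrow> 'n phase" where "T z = (\<tau> (fst z), P z)"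

definition A2 :: "'n phase \<Rightarrow> real^'n \<Rightarrow> real^'n \<Rightarrow> real^'n" where
  "A2 z a u = D (\<lambda>x. D \<tau> x u) (fst z) a"

lemma W_\<Omega>: "z \<in> W \<Longrightarrow> z \<in> \<Omega>" using W_subset by blast
lemma T_\<Omega>': "z \<in> W \<Longrightarrow> T z \<in> \<Omega>'" using T_mem by (simp add: T_def)

lemma linear_A: "z \<in> W \<Longrightarrow> linear (d\<tau> z)"
  by (rule linear_D[OF smooth_\<tau> fst_W])

lemma smooth_T: "smooth_on W T"
  unfolding T_def[abs_def]
  by (intro smooth_on_Pair open_W smooth_P)
    (rule smooth_on_compose[OF open_W open_U smooth_\<tau> smooth_on_fst[OF open_W smooth_on_ident[OF open_W]] fst_W])

lemma smooth_A: "smooth_on W (\<lambda>z. d\<tau> z u)"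
  by (rule smooth_on_compose[OF open_W open_U smooth_on_D[OF smooth_\<tau>]
        smooth_on_fst[OF open_W smooth_on_ident[OF open_W]] fst_W])

lemma D_fst: "D fst z X = fst X"
  by (rule D_bounded_linear[OF bounded_linear_fst])

lemma differentiable_fst: "fst differentiable at z"
  by (rule bounded_linear_imp_differentiable[OF bounded_linear_fst])

lemma D_A: "z \<in> W \<Longrightarrow> D (\<lambda>z. d\<tau> z u) z X = A2 z (fst X) u"
  using D_compose[OF differentiable_fst smooth_differentiable[OF smooth_on_D[OF smooth_\<tau>] fst_W]]
  by (simp add: A2_def D_fst)

lemma D_A_field:
  assumes "z \<in> W" "f differentiable at z"
  shows "D (\<lambda>z. d\<tau> z (f z)) z X = A2 z (fst X) (f z) + d\<tau> z (D f z X)"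
  using D_apply_field(2)[where j = "\<lambda>z. d\<tau> z", OF open_W _ smooth_A assms(2,1)] linear_A
  by (simp add: D_A assms(1))

lemma A2_sym: "z \<in> W \<Longrightarrow> A2 z a u = A2 z u a"
  unfolding A2_def by (rule D_D_commute[OF open_U smooth_\<tau> fst_W])

lemma D_T: "z \<in> W \<Longrightarrow> D T z X = (d\<tau> z (fst X), D P z X)"
proof -
  assume z: "z \<in> W"
  have d: "\<tau> differentiable at (fst z)" by (rule smooth_differentiable[OF smooth_\<tau> fst_W[OF z]])
  then have "(\<lambda>y. \<tau> (fst y)) differentiable at z"
    using differentiable_chain_at[OF differentiable_fst] by (simp add: o_def)
  then show ?thesis
    unfolding T_def[abs_def]
    by (simp add: D_Pair smooth_differentiable[OF smooth_P z] D_compose[OF differentiable_fst d] D_fst)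
qed

text \<open>The product rule applied to the covector law. The term with \<open>A2\<close>, the
  second derivative of the base transition, is the inhomogeneous contribution that must cancel
  later.\<close>

lemma D_covector:
  assumes "z \<in> W"
  shows "D P z X \<bullet> d\<tau> z u + P z \<bullet> A2 z (fst X) u = snd X \<bullet> u"
proof -
  have "D (\<lambda>z. snd z \<bullet> u) z X = snd X \<bullet> u"
    by (rule D_bounded_linear[OF bounded_linear_compose[OF bounded_linear_inner_left bounded_linear_snd]])
  moreover have "D (\<lambda>z. P z \<bullet> d\<tau> z u) z X = P z \<bullet> A2 z (fst X) u + D P z X \<bullet> d\<tau> z u"
    using D_bilinear[OF bounded_bilinear_inner smooth_differentiable[OF smooth_P assms]
        smooth_differentiable[OF smooth_A assms]] by (simp add: D_A assms)
  moreover have "D (\<lambda>z. P z \<bullet> d\<tau> z u) z = D (\<lambda>z. snd z \<bullet> u) z"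
    by (rule D_cong_smooth[OF open_W _ assms])
      (auto intro!: smooth_on_inner smooth_on_snd smooth_on_ident open_W simp: covector)
  ultimately show ?thesis by simp
qed

lemma eq_by_A: "z \<in> W \<Longrightarrow> (\<And>u. q \<bullet> d\<tau> z u = r \<bullet> d\<tau> z u) \<Longrightarrow> q = r"
  using surj_D\<tau>[of z] by (metis surjD vector_eq_rdot)

lemma A2_0: "z \<in> W \<Longrightarrow> A2 z 0 u = 0"
  unfolding A2_def by (rule linear_0[OF linear_D[OF smooth_on_D[OF smooth_\<tau>] fst_W]])

lemma D_P_surj:
  assumes "z \<in> W"
  obtains b where "D P z (0, b) = q"
proof
  \<comment> \<open>On fibres the change of coordinates is the inverse transpose of
    \<open>d\<tau>\<close>, so the transpose supplies the preimage.\<close>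
  show "D P z (0, adjoint (d\<tau> z) q) = q"
  proof (rule eq_by_A[OF assms])
    fix u
    show "D P z (0, adjoint (d\<tau> z) q) \<bullet> d\<tau> z u = q \<bullet> d\<tau> z u"
      using D_covector[OF assms, of "(0, adjoint (d\<tau> z) q)" u]
        adjoint_works[OF linear_A[OF assms], of u q] by (simp add: A2_0 assms inner_commute)
  qed
qed

lemma D_P_vertical: "z \<in> W \<Longrightarrow> D P z (0, b) \<bullet> d\<tau> z u = b \<bullet> u"
  using D_covector[of z "(0, b)" u] by (simp add: A2_0)

lemma D_P_horizontal: "z \<in> W \<Longrightarrow> D P z (a, 0) \<bullet> d\<tau> z u = - (P z \<bullet> A2 z a u)"
  using D_covector[of z "(a, 0)" u] by simp

lemma D_compose_T:
  assumes "z \<in> W" "smooth_on \<Omega>' f"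
  shows "D (\<lambda>y. f (T y)) z X = D f (T z) (D T z X)"
  by (rule D_compose[OF smooth_differentiable[OF smooth_T assms(1)]
        smooth_differentiable[OF assms(2) T_\<Omega>'[OF assms(1)]]])

lemma smooth_compose_T: "smooth_on \<Omega>' f \<Longrightarrow> smooth_on W (\<lambda>y. f (T y))"
  by (rule smooth_on_compose[OF open_W dst.open_\<Omega> _ smooth_T T_\<Omega>'])

section \<open>Transformation of the energy, the metric and the connection\<close>

lemma D_energy_T:
  assumes "z \<in> W"
  shows "D (energy F) z X = D (energy F') (T z) (D T z X)"
proof -
  have "D (energy F) z = D (\<lambda>y. energy F' (T y)) z"
    by (rule D_cong_smooth[OF open_W smooth_compose_T[OF dst.smooth_energy] assms])
      (simp add: energy_def F_eq T_def)
  then show ?thesis by (simp add: D_compose_T assms dst.smooth_energy)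
qed

lemma velocity_T:
  assumes z: "z \<in> W"
  shows "velocity F' (T z) = d\<tau> z (velocity F z)"
proof (rule vector_eq_rdot[THEN iffD1], rule allI)
  fix q
  obtain b where b: "D P z (0, b) = q" using D_P_surj[OF z] .
  have "velocity F z \<bullet> b = velocity F' (T z) \<bullet> q"
    using D_energy_T[OF z, of "(0, b)"]
    by (simp add: src.D_energy W_\<Omega> dst.D_energy T_\<Omega>' z D_T b linear_0[OF linear_A])
  then show "velocity F' (T z) \<bullet> q = d\<tau> z (velocity F z) \<bullet> q"
    using D_P_vertical[OF z, of b "velocity F z"] by (simp add: b inner_commute)
qed

lemma D_velocity_T:
  assumes z: "z \<in> W"
  shows "D (velocity F') (T z) (D T z X)
    = A2 z (fst X) (velocity F z) + d\<tau> z (D (velocity F) z X)"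
proof -
  have "D (\<lambda>y. D \<tau> (fst y) (velocity F y)) z = D (\<lambda>y. velocity F' (T y)) z"
    by (rule D_cong_smooth[OF open_W smooth_compose_T[OF dst.smooth_velocity] z]) (simp add: velocity_T)
  then show ?thesis
    using D_A_field[OF z smooth_differentiable[OF src.smooth_velocity W_\<Omega>[OF z]]]
    by (simp add: D_compose_T z dst.smooth_velocity)
qed

lemma D_P_g_low:
  assumes z: "z \<in> W"
  shows "D P z (0, g_low F z *v u) = g_low F' (T z) *v d\<tau> z u"
proof -
  have "g_up F' (T z) *v D P z (0, g_low F z *v u) = d\<tau> z u"
    using D_velocity_T[OF z, of "(0, g_low F z *v u)"]
    by (simp add: D_T z linear_0[OF linear_A] A2_0 dst.g_up_mult T_\<Omega>' src.g_up_mult[symmetric] W_\<Omega>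
        src.g_up_low)
  then show ?thesis using dst.g_low_up[OF T_\<Omega>'[OF z]] by metis
qed

lemma g_low_T:
  "z \<in> W \<Longrightarrow> (g_low F z *v u) \<bullet> w = (g_low F' (T z) *v d\<tau> z u) \<bullet> d\<tau> z w"
  by (simp add: D_P_g_low[symmetric] D_P_vertical)

text \<open>A cotangent lift preserves the Hamiltonian field of an invariant energy. Concretely, the
  \<open>A2\<close> terms from the force and from the covector law cancel by symmetry of
  \<open>A2\<close>.\<close>

lemma D_T_spray:
  assumes z: "z \<in> W"
  shows "D T z (spray F z) = spray F' (T z)"
proof -
  have "D P z (spray F z) = - force F' (T z)"
  proof (rule eq_by_A[OF z])
    fix u
    have "force F z \<bullet> u = force F' (T z) \<bullet> d\<tau> z u + d\<tau> z (velocity F z) \<bullet> D P z (u, 0)"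
      using D_energy_T[OF z, of "(u, 0)"]
      by (simp add: src.D_energy W_\<Omega> dst.D_energy T_\<Omega>' z D_T velocity_T)
    then have "force F z \<bullet> u = force F' (T z) \<bullet> d\<tau> z u - P z \<bullet> A2 z u (velocity F z)"
      using D_P_horizontal[OF z, of u "velocity F z"] by (simp add: inner_commute)
    then show "D P z (spray F z) \<bullet> d\<tau> z u = - force F' (T z) \<bullet> d\<tau> z u"
      using D_covector[OF z, of "spray F z" u] A2_sym[OF z, of u "velocity F z"] by (simp add: spray_def)
  qed
  then show ?thesis by (simp add: D_T z) (simp add: spray_def velocity_T z)
qed

text \<open>The transformation law of \<open>g_low\<close> is differentiated along the invariant
  spray, whose base part is \<open>y\<close>; the \<open>A2 z y\<close> terms record the change of
  \<open>d\<tau>\<close> along it.\<close>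

lemma D_g_low_spray_T:
  assumes z: "z \<in> W"
  defines "y \<equiv> velocity F z" and "A \<equiv> d\<tau> z" and "g' \<equiv> g_low F' (T z)"
  shows "(D (g_low F) z (spray F z) *v u) \<bullet> w
    = (D (g_low F') (T z) (spray F' (T z)) *v A u) \<bullet> A w + (g' *v A2 z y u) \<bullet> A w + (g' *v A u) \<bullet> A2 z y w"
proof -
  have smg: "smooth_on W (\<lambda>z. g_low F' (T z))" by (rule smooth_compose_T[OF dst.smooth_g_low])
  note smgA = smooth_matrix_vector_mult[OF open_W smg smooth_A]
  have smW: "smooth_on W (g_low F)" by (rule smooth_on_subset[OF src.smooth_g_low W_subset])
  have 1: "D (\<lambda>z. (g_low F z *v u) \<bullet> w) z
      = D (\<lambda>z. (g_low F' (T z) *v d\<tau> z u) \<bullet> d\<tau> z w) z"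
    by (rule D_cong_smooth[OF open_W smooth_on_inner[OF open_W smgA smooth_A] z]) (rule g_low_T[symmetric])
  have 2: "D (\<lambda>z. (g_low F z *v u) \<bullet> w) z X = (D (g_low F) z X *v u) \<bullet> w" for X
    by (simp add: D_inner D_matrix_vector_const smooth_differentiable[OF smW z]
        smooth_differentiable[OF smooth_matrix_vector_mult[OF open_W smW smooth_on_const] z])
  have 3: "D (\<lambda>z. (g_low F' (T z) *v d\<tau> z u) \<bullet> d\<tau> z w) z X
      = (g' *v A u) \<bullet> A2 z (fst X) w
        + (g' *v A2 z (fst X) u + D (g_low F') (T z) (D T z X) *v A u) \<bullet> A w" for X
    using D_bilinear[OF bounded_bilinear_inner smooth_differentiable[OF smgA z] smooth_differentiable[OF smooth_A z]]
      D_matrix_vector_mult[OF smooth_differentiable[OF smg z] smooth_differentiable[OF smooth_A z]]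
    by (simp add: D_A z D_compose_T dst.smooth_g_low g'_def A_def)
  have "(D (g_low F) z (spray F z) *v u) \<bullet> w
      = (g' *v A u) \<bullet> A2 z (fst (spray F z)) w
        + (g' *v A2 z (fst (spray F z)) u + D (g_low F') (T z) (D T z (spray F z)) *v A u) \<bullet> A w"
    unfolding 2[symmetric] 1 3 ..
  moreover have "fst (spray F z) = y" by (simp add: spray_def y_def)
  ultimately show ?thesis by (simp add: D_T_spray z inner_add_left)
qed

lemma velocity_conn_T:
  assumes z: "z \<in> W"
  defines "y \<equiv> velocity F z" and "A \<equiv> d\<tau> z" and "g' \<equiv> g_low F' (T z)"
  shows "D (velocity F) z (w, 0) \<bullet> (g_low F z *v u)
    = D (velocity F') (T z) (A w, 0) \<bullet> (g' *v A u) - P z \<bullet> A2 z w u - (g' *v A u) \<bullet> A2 z w y"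
proof -
  note T = T_\<Omega>'[OF z]
  have split: "D (velocity F') (T z) (A w, D P z (w, 0))
      = D (velocity F') (T z) (A w, 0) + g_up F' (T z) *v D P z (w, 0)"
    using linear_add[OF linear_D[OF dst.smooth_velocity T], of "(A w, 0)" "(0, D P z (w, 0))"]
    by (simp add: dst.g_up_mult T)
  have "A (D (velocity F) z (w, 0)) = D (velocity F') (T z) (A w, D P z (w, 0)) - A2 z w y"
    using D_velocity_T[OF z, of "(w, 0)"] by (simp add: D_T z A_def y_def)
  then have "D (velocity F) z (w, 0) \<bullet> (g_low F z *v u)
      = (g' *v A u) \<bullet> (D (velocity F') (T z) (A w, 0) + g_up F' (T z) *v D P z (w, 0) - A2 z w y)"
    using g_low_T[OF z, of u "D (velocity F) z (w, 0)"] split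
    by (simp add: A_def g'_def inner_commute)
  moreover have "(g' *v A u) \<bullet> (g_up F' (T z) *v D P z (w, 0)) = - (P z \<bullet> A2 z w u)"
    using D_P_horizontal[OF z, of w u] dst.g_up_sym[OF T, of "g' *v A u" "D P z (w, 0)"]
    by (simp add: g'_def A_def dst.g_up_low[OF T] inner_commute)
  ultimately show ?thesis by (simp add: inner_add_right inner_diff_right inner_commute)
qed

text \<open>In \<open>conn_inner\<close> the \<open>A2\<close> terms involving \<open>y\<close>
  cancel between the Legendre derivatives and the spray derivative. What survives is the pairing of
  \<open>P\<close> with \<open>A2\<close>, the usual inhomogeneous term of a connection.\<close>

lemma conn_T:
  assumes z: "z \<in> W"
  shows "(conn F z *v u) \<bullet> w
    = (conn F' (T z) *v d\<tau> z u) \<bullet> d\<tau> z w + P z \<bullet> A2 z u w"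
proof -
  define A where "A = d\<tau> z"
  define y where "y = velocity F z"
  define g' where "g' = g_low F' (T z)"
  have z': "z \<in> \<Omega>" "T z \<in> \<Omega>'" using z W_\<Omega> T_\<Omega>' by auto
  have 1: "D (velocity F) z (w, 0) \<bullet> (g_low F z *v u)
    = D (velocity F') (T z) (A w, 0) \<bullet> (g' *v A u) - P z \<bullet> A2 z u w - (g' *v A u) \<bullet> A2 z w y"
    using velocity_conn_T[OF z, of w u] A2_sym[OF z, of w u] by (simp add: A_def y_def g'_def)
  have 2: "(g_low F z *v D (velocity F) z (u, 0)) \<bullet> w
    = (g' *v D (velocity F') (T z) (A u, 0)) \<bullet> A w - P z \<bullet> A2 z u w - (g' *v A w) \<bullet> A2 z u y"
    using velocity_conn_T[OF z, of u w]
    by (simp add: A_def y_def g'_def src.g_low_sym z' dst.g_low_sym)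
  have 3: "(D (g_low F) z (spray F z) *v u) \<bullet> w
    = (D (g_low F') (T z) (spray F' (T z)) *v A u) \<bullet> A w + (g' *v A w) \<bullet> A2 z u y + (g' *v A u) \<bullet> A2 z w y"
    using D_g_low_spray_T[OF z, of u w] A2_sym[OF z, of y] dst.g_low_sym[OF z'(2), of "A2 z u y" "A w"]
    by (simp add: A_def y_def g'_def inner_commute)
  have "2 * ((conn F z *v u) \<bullet> w) = 2 * ((conn F' (T z) *v A u) \<bullet> A w + P z \<bullet> A2 z u w)"
    using src.conn_inner[OF z'(1), of u w] dst.conn_inner[OF z'(2), of "A u" "A w"]
    unfolding 1 2 3 g'_def[symmetric] by simp
  then show ?thesis by (simp add: A_def)
qed

text \<open>The inhomogeneous term of the connection matches the one in \<open>D_covector\<close>,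
  so horizontal vectors transform as vectors of the base.\<close>

lemma D_T_hor:
  assumes z: "z \<in> W"
  shows "D T z (hor F u z) = hor F' (d\<tau> z u) (T z)"
proof -
  have "D P z (hor F u z) = conn F' (T z) *v d\<tau> z u"
    using D_covector[OF z, of "hor F u z"] conn_T[OF z, of u]
    by (intro eq_by_A[OF z]) (simp add: hor_def eq_diff_eq[symmetric])
  then show ?thesis by (simp add: D_T z) (simp add: hor_def)
qed

end

locale kaehler_transition =
  cartan_transition \<Omega> \<Omega>' F F' W U \<tau> P +
  src: kaehler_chart \<Omega> F \<kappa> \<alpha> \<beta> v + dst: kaehler_chart \<Omega>' F' \<kappa> \<alpha> \<beta> v
  for \<Omega> \<Omega>' :: "'n::finite phase set" and F F' W U \<tau> P \<kappa> \<alpha> \<beta> v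
begin

lemma G_T:
  assumes z: "z \<in> W"
  shows "(src.G z *v u) \<bullet> w = (dst.G (T z) *v d\<tau> z u) \<bullet> d\<tau> z w"
proof -
  have "snd z \<bullet> u = snd (T z) \<bullet> d\<tau> z u" for u using covector[OF z] by (simp add: T_def)
  then show ?thesis
    using g_low_T[OF z, of u w] by (simp add: src.G_mult dst.G_mult inner_diff_left)
qed

text \<open>Both frame components transform by \<open>d\<tau>\<close>. Since \<open>J\<close> and
  the metric are expressed by these components, their invariance follows.\<close>

lemma D_T_frame:
  assumes z: "z \<in> W"
  shows "D T z (frame \<alpha> \<beta> v F z a b)
    = frame \<alpha> \<beta> v F' (T z) (d\<tau> z a) (d\<tau> z b)"
proof -
  have "D P z (0, src.G z *v b) = dst.G (T z) *v d\<tau> z b"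
    by (rule eq_by_A[OF z]) (simp add: D_P_vertical z G_T)
  then have d: "D T z (0, src.G z *v b) = (0, dst.G (T z) *v d\<tau> z b)"
    by (simp add: D_T z linear_0[OF linear_A])
  have "frame \<alpha> \<beta> v F z a b = hor F a z + (0, src.G z *v b)"
    by (simp add: frame_def hor_def)
  then show ?thesis
    by (simp only: linear_add[OF linear_D[OF smooth_T z]] D_T_hor[OF z] d)
      (simp add: frame_def hor_def)
qed

lemma J_T:
  assumes z: "z \<in> W"
  shows "J_map \<alpha> \<beta> v F' (T z) (D T z X) = D T z (J_map \<alpha> \<beta> v F z X)"
proof -
  obtain a b where "X = frame \<alpha> \<beta> v F z a b" using src.frame_exhaust[OF W_\<Omega>[OF z]] .
  then show ?thesis
    by (simp add: D_T_frame z src.J_frame W_\<Omega> dst.J_frame T_\<Omega>' linear_neg[OF linear_A])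
qed

lemma G_form_T:
  assumes z: "z \<in> W"
  shows "G_form \<alpha> \<beta> v F' (T z) (D T z X) (D T z Y) = G_form \<alpha> \<beta> v F z X Y"
proof -
  obtain a b a' b' where "X = frame \<alpha> \<beta> v F z a b" "Y = frame \<alpha> \<beta> v F z a' b'"
    using src.frame_exhaust[OF W_\<Omega>[OF z]] by metis
  then show ?thesis
    using G_T[OF z, of a' a] G_T[OF z, of b' b]
    by (simp add: D_T_frame z src.G_frame W_\<Omega> dst.G_frame T_\<Omega>' inner_commute)
qed

end

section \<open>The atlas topology\<close>

text \<open>The part of \<open>smooth_manifold\<close> without separation and countability, isolated
  because facts on the atlas topology are needed to establish those two for the bundle.\<close>

definition compatible_atlas :: "('a, 'e::euclidean_space) chart set \<Rightarrow> bool" where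
  "compatible_atlas A \<longleftrightarrow>
     (\<forall>c\<in>A. inj_on (snd c) (fst c) \<and> open (coord_range c)) \<and>
     (\<forall>c\<in>A. \<forall>d\<in>A. open (overlap c d) \<and> smooth_on (overlap c d) (transition c d))"

lemma smooth_manifold_iff:
  "smooth_manifold A \<longleftrightarrow> compatible_atlas A \<and> Hausdorff_space (atlas_topology A)
     \<and> second_countable (atlas_topology A)"
  by (auto simp: smooth_manifold_def compatible_atlas_def)

lemma topspace_atlas_topology: "topspace (atlas_topology A) = points A"
proof -
  have "fst c = fst c \<inter> snd c -` UNIV" for c :: "('a, 'b) chart" by simp
  then show ?thesis
    unfolding atlas_topology_def topology_generated_by_topspace points_def using open_UNIV by blast
qed

lemma openin_atlas_basic:
  "c \<in> A \<Longrightarrow> open V \<Longrightarrow> openin (atlas_topology A) (fst c \<inter> snd c -` V)"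
  unfolding atlas_topology_def by (rule topology_generated_by_Basis) blast

lemma coord_inv_app: "compatible_atlas A \<Longrightarrow> c \<in> A \<Longrightarrow> x \<in> fst c \<Longrightarrow> coord_inv c (snd c x) = x"
  unfolding compatible_atlas_def coord_inv_def by (simp add: inv_into_f_f)

lemma transition_app:
  "compatible_atlas A \<Longrightarrow> c \<in> A \<Longrightarrow> x \<in> fst c \<Longrightarrow> transition c d (snd c x) = snd d x"
  by (simp add: transition_def coord_inv_app)

text \<open>By induction over the generated topology; for a generating set the image is the preimage
  of \<open>V\<close> under a continuous transition. Intersections need injectivity of the
  chart.\<close>

lemma open_chart_image:
  assumes A: "compatible_atlas A" and U: "openin (atlas_topology A) U" and c: "c \<in> A"
  shows "open (snd c ` (U \<inter> fst c))"
proof -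
  have inj: "inj_on (snd c) (fst c)" using A c by (simp add: compatible_atlas_def)
  have "generate_topology_on {fst d \<inter> snd d -` V | d V. d \<in> A \<and> open V} U"
    using U unfolding atlas_topology_def openin_topology_generated_by_iff .
  then show ?thesis
  proof (induction U rule: generate_topology_on.induct)
    case Empty
    then show ?case by simp
  next
    case (Int a b)
    have "snd c ` (a \<inter> b \<inter> fst c) = snd c ` (a \<inter> fst c) \<inter> snd c ` (b \<inter> fst c)"
      using inj by (auto simp: inj_on_def image_iff)
    then show ?case using Int by auto
  next
    case (UN K)
    have "snd c ` (\<Union> K \<inter> fst c) = (\<Union>k\<in>K. snd c ` (k \<inter> fst c))" by auto
    then show ?case using UN by auto
  next
    case (Basis s)
    then obtain d V where s: "s = fst d \<inter> snd d -` V" and d: "d \<in> A" and V: "open V" by blast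
    have "open (overlap c d)" "smooth_on (overlap c d) (transition c d)"
      using A c d by (auto simp: compatible_atlas_def)
    then have "open (overlap c d \<inter> transition c d -` V)"
      using V by (simp add: continuous_open_preimage smooth_on_continuous)
    moreover have "snd c ` (s \<inter> fst c) = overlap c d \<inter> transition c d -` V"
      unfolding s overlap_def using transition_app[OF A c, of _ d] by (auto simp: image_iff)
    ultimately show ?case by simp
  qed
qed

text \<open>A second countable space is Lindelof, applied to the cover by chart domains.\<close>

lemma countable_chart_cover:
  fixes A :: "('a, 'e::euclidean_space) chart set"
  assumes "second_countable (atlas_topology A)"
  obtains C where "C \<subseteq> A" "countable C" "points A = (\<Union>c\<in>C. fst c)"
proof -
  have "Lindelof_space (atlas_topology A)"
    using assms by (rule second_countable_imp_Lindelof_space)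
  moreover have "\<forall>U\<in>fst ` A. openin (atlas_topology A) U"
    using openin_atlas_basic[of _ A UNIV] by auto
  moreover have "\<Union> (fst ` A) = topspace (atlas_topology A)"
    by (simp add: topspace_atlas_topology points_def)
  ultimately obtain \<V> where V: "countable \<V>" "\<V> \<subseteq> fst ` A" "\<Union> \<V> = points A"
    unfolding Lindelof_space_def by (metis (no_types, lifting) topspace_atlas_topology)
  then obtain C where "C \<subseteq> A" "countable C" "\<V> = fst ` C"
    using countable_subset_image by metis
  then show ?thesis using that V(3) by metis
qed

text \<open>Preimages of a countable basis under countably many charts suffice:
  \<open>open_chart_image\<close> makes each open set open in the coordinates of a chart from
  \<open>C\<close> around the given point.\<close>

lemma second_countable_atlasI:
  fixes A :: "('a, 'e::euclidean_space) chart set"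
  assumes A: "compatible_atlas A" and C: "C \<subseteq> A" "countable C" "points A = (\<Union>c\<in>C. fst c)"
  shows "second_countable (atlas_topology A)"
proof -
  obtain \<B> :: "'e set set" where B: "countable \<B>" "topological_basis \<B>"
    using ex_countable_basis by blast
  define \<W> where "\<W> = (\<lambda>(c, V). fst c \<inter> snd c -` V) ` (C \<times> \<B>)"
  have "countable \<W>" using B(1) C(2) by (simp add: \<W>_def)
  moreover have "openin (atlas_topology A) V" if "V \<in> \<W>" for V
  proof -
    obtain c X where "V = fst c \<inter> snd c -` X" "c \<in> C" "X \<in> \<B>" using \<open>V \<in> \<W>\<close> by (auto simp: \<W>_def)
    then show ?thesis using C(1) topological_basis_open[OF B(2)] openin_atlas_basic by blast
  qed
  moreover have "\<exists>V\<in>\<W>. x \<in> V \<and> V \<subseteq> U" if U: "openin (atlas_topology A) U" and x: "x \<in> U" for U x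
  proof -
    have "x \<in> points A" using U x openin_subset topspace_atlas_topology by fastforce
    then obtain c where c: "c \<in> C" "x \<in> fst c" using C(3) by auto
    have cA: "c \<in> A" using c C(1) by blast
    have "open (snd c ` (U \<inter> fst c))" by (rule open_chart_image[OF A U cA])
    then obtain V where V: "V \<in> \<B>" "snd c x \<in> V" "V \<subseteq> snd c ` (U \<inter> fst c)"
      using topological_basisE[OF B(2), of "snd c ` (U \<inter> fst c)" "snd c x"] c x by blast
    have inj: "inj_on (snd c) (fst c)" using A cA by (simp add: compatible_atlas_def)
    have "x' \<in> U" if x': "x' \<in> fst c" "snd c x' \<in> V" for x'
    proof -
      obtain x'' where "x'' \<in> U" "x'' \<in> fst c" "snd c x' = snd c x''" using V(3) x' by auto
      then show ?thesis using inj_onD[OF inj] x' by blast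
    qed
    then have "fst c \<inter> snd c -` V \<subseteq> U" by blast
    moreover have "fst c \<inter> snd c -` V \<in> \<W>"
      unfolding \<W>_def using c(1) V(1) by (auto intro!: image_eqI[of _ _ "(c, V)"])
    moreover have "x \<in> fst c \<inter> snd c -` V" using c(2) V(2) by simp
    ultimately show ?thesis by (intro bexI conjI)
  qed
  ultimately show ?thesis unfolding second_countable_def by blast
qed

section \<open>Open subsets of the cotangent bundle as manifolds\<close>

locale base_manifold =
  fixes A :: "('a, 'e::euclidean_space) chart set"
  assumes manifold: "smooth_manifold A"
begin

lemma compatible: "compatible_atlas A" using manifold by (simp add: smooth_manifold_iff)

lemma inj_chart: "c \<in> A \<Longrightarrow> inj_on (snd c) (fst c)"
  and open_coord_range: "c \<in> A \<Longrightarrow> open (coord_range c)"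
  and open_overlap: "c \<in> A \<Longrightarrow> d \<in> A \<Longrightarrow> open (overlap c d)"
  and smooth_transition: "c \<in> A \<Longrightarrow> d \<in> A \<Longrightarrow> smooth_on (overlap c d) (transition c d)"
  using compatible by (auto simp: compatible_atlas_def)

lemmas transition_chart = transition_app[OF compatible]

lemma chart_mem_overlap: "x \<in> fst c \<Longrightarrow> x \<in> fst d \<Longrightarrow> snd c x \<in> overlap c d"
  by (simp add: overlap_def)

lemma chart_overlap_mem: "c \<in> A \<Longrightarrow> x \<in> fst c \<Longrightarrow> snd c x \<in> overlap c d \<Longrightarrow> x \<in> fst d"
  using inj_chart[of c] by (auto simp: overlap_def inj_on_def)

lemma D_transition_chain:
  assumes "c \<in> A" "d \<in> A" "e \<in> A" "x \<in> fst c" "x \<in> fst d" "x \<in> fst e"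
  shows "D (transition d e) (snd d x) (D (transition c d) (snd c x) v) = D (transition c e) (snd c x) v"
proof -
  define S where "S = overlap c d \<inter> overlap c e"
  have S: "open S" "snd c x \<in> S"
    using assms by (auto simp: S_def open_overlap chart_mem_overlap)
  have sm: "smooth_on S (transition c e)"
    using smooth_transition[OF assms(1,3)] by (rule smooth_on_subset) (simp add: S_def)
  have eq: "transition d e (transition c d y) = transition c e y" if y: "y \<in> S" for y
  proof -
    obtain x' where "y = snd c x'" "x' \<in> fst c" "x' \<in> fst d"
      using y by (auto simp: S_def overlap_def)
    then show ?thesis using assms by (simp add: transition_chart)
  qed
  have "D (\<lambda>y. transition d e (transition c d y)) (snd c x) = D (transition c e) (snd c x)"
    by (rule D_cong_smooth[OF S(1) sm S(2) eq[symmetric]])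
  moreover have "D (\<lambda>y. transition d e (transition c d y)) (snd c x) v
      = D (transition d e) (snd d x) (D (transition c d) (snd c x) v)"
    using D_compose[of "transition c d" "snd c x" "transition d e" v] assms
    by (simp add: transition_chart smooth_differentiable[OF smooth_transition] chart_mem_overlap)
  ultimately show ?thesis by simp
qed

lemma D_transition_self:
  assumes "c \<in> A" "x \<in> fst c"
  shows "D (transition c c) (snd c x) v = v"
proof -
  have "D (transition c c) (snd c x) = D (\<lambda>y. y) (snd c x)"
    by (rule D_cong_smooth[OF open_coord_range[OF assms(1)]])
      (use assms in \<open>auto simp: coord_range_def transition_chart
        intro: smooth_on_ident open_coord_range[unfolded coord_range_def]\<close>)
  then show ?thesis by simp
qed

lemma D_transition_inverse:
  assumes "c \<in> A" "d \<in> A" "x \<in> fst c" "x \<in> fst d"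
  shows "D (transition d c) (snd d x) (D (transition c d) (snd c x) v) = v"
  using D_transition_chain[OF assms(1,2,1,3,4,3)] D_transition_self[OF assms(1,3)] by simp

lemma cotangent_spaceD:
  "\<omega> \<in> cotangent_space A x \<Longrightarrow> c \<in> A \<Longrightarrow> d \<in> A \<Longrightarrow> x \<in> fst c \<Longrightarrow> x \<in> fst d
    \<Longrightarrow> \<omega> c \<bullet> v = \<omega> d \<bullet> D (transition c d) (snd c x) v"
  unfolding cotangent_space_def by blast

lemma cotangent_space_outside:
  "\<omega> \<in> cotangent_space A x \<Longrightarrow> \<not> (c \<in> A \<and> x \<in> fst c) \<Longrightarrow> \<omega> c = 0"
  unfolding cotangent_space_def by blast

lemma cotangent_spaceI:
  assumes "\<And>c. \<not> (c \<in> A \<and> x \<in> fst c) \<Longrightarrow> \<omega> c = 0"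
    and "\<And>c d v. c \<in> A \<Longrightarrow> d \<in> A \<Longrightarrow> x \<in> fst c \<Longrightarrow> x \<in> fst d
      \<Longrightarrow> \<omega> c \<bullet> v = \<omega> d \<bullet> D (transition c d) (snd c x) v"
  shows "\<omega> \<in> cotangent_space A x"
  unfolding cotangent_space_def using assms by blast

text \<open>One component determines all others through the transformation law; hence a single chart
  separates covectors at a point.\<close>

lemma covector_eqI:
  assumes "\<omega> \<in> cotangent_space A x" "\<omega>' \<in> cotangent_space A x" "c \<in> A" "x \<in> fst c" "\<omega> c = \<omega>' c"
  shows "\<omega> = \<omega>'"
proof
  fix d
  show "\<omega> d = \<omega>' d"
  proof (cases "d \<in> A \<and> x \<in> fst d")
    case True
    then have "\<omega> d \<bullet> v = \<omega>' d \<bullet> v" for v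
      using cotangent_spaceD[OF assms(1), of d c v] cotangent_spaceD[OF assms(2), of d c v] assms(3-5) by simp
    then show ?thesis by (metis vector_eq_rdot)
  next
    case False
    then show ?thesis using assms(1,2) by (simp add: cotangent_space_outside)
  qed
qed

lemma zero_covector: "(\<lambda>_. 0) \<in> cotangent_space A x"
  by (rule cotangent_spaceI) simp_all

lemma scaleR_covector: "\<omega> \<in> cotangent_space A x \<Longrightarrow> (\<lambda>c. t *\<^sub>R \<omega> c) \<in> cotangent_space A x"
proof (rule cotangent_spaceI)
  assume \<omega>: "\<omega> \<in> cotangent_space A x"
  show "t *\<^sub>R \<omega> c = 0" if "\<not> (c \<in> A \<and> x \<in> fst c)" for c
    using cotangent_space_outside[OF \<omega> that] by simp
  show "(t *\<^sub>R \<omega> c) \<bullet> v = (t *\<^sub>R \<omega> d) \<bullet> D (transition c d) (snd c x) v"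
    if "c \<in> A" "d \<in> A" "x \<in> fst c" "x \<in> fst d" for c d v
    using cotangent_spaceD[OF \<omega> that, of v] by simp
qed

text \<open>The components in every other chart are the pullback of \<open>p\<close> by the
  derivative of the transition; the chain rule makes the family consistent.\<close>

lemma covector_exists:
  assumes c: "c \<in> A" and x: "x \<in> fst c"
  obtains \<omega> where "\<omega> \<in> cotangent_space A x" "\<omega> c = p"
proof
  define \<omega> where "\<omega> = (\<lambda>d. if d \<in> A \<and> x \<in> fst d then adjoint (D (transition d c) (snd d x)) p else 0)"
  have *: "\<omega> d \<bullet> v = p \<bullet> D (transition d c) (snd d x) v" if "d \<in> A" "x \<in> fst d" for d v
    using adjoint_works[OF linear_D[OF smooth_transition[OF that(1) c]
        chart_mem_overlap[OF that(2) x]], of v p] that by (simp add: \<omega>_def inner_commute)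
  show "\<omega> \<in> cotangent_space A x"
  proof (rule cotangent_spaceI)
    show "\<omega> d = 0" if "\<not> (d \<in> A \<and> x \<in> fst d)" for d using that by (auto simp: \<omega>_def)
    show "\<omega> d \<bullet> v = \<omega> e \<bullet> D (transition d e) (snd d x) v"
      if "d \<in> A" "e \<in> A" "x \<in> fst d" "x \<in> fst e" for d e v
      using that c x by (simp add: * D_transition_chain)
  qed
  show "\<omega> c = p"
    by (rule vector_eq_rdot[THEN iffD1]) (simp add: * c x D_transition_self)
qed

end

text \<open>This treats the slit bundle and the tube at once; openness of \<open>W\<close> is stated
  in coordinates, so no topology on the bundle is presupposed.\<close>

locale cotangent_open = base_manifold A
  for A :: "('a, 'e::euclidean_space) chart set" +
  fixes W :: "('a \<times> ('a, 'e) covector) set"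
  assumes W_bundle: "W \<subseteq> cotangent_bundle A"
    and open_W: "\<And>c. c \<in> A \<Longrightarrow> open (snd (cotangent_chart A c) ` (fst (cotangent_chart A c) \<inter> W))"
begin

definition induced :: "('a, 'e) chart \<Rightarrow> ('a \<times> ('a, 'e) covector, 'e \<times> 'e) chart" where
  "induced c = (fst (cotangent_chart A c) \<inter> W, snd (cotangent_chart A c))"

lemma restrict_atlas_eq: "restrict_atlas (cotangent_atlas A) W = induced ` A"
proof (intro set_eqI iffI)
  fix e assume "e \<in> restrict_atlas (cotangent_atlas A) W"
  then obtain U \<phi> where e: "e = (U \<inter> W, \<phi>)" and "(U, \<phi>) \<in> cotangent_chart A ` A"
    unfolding restrict_atlas_def cotangent_atlas_def by blast
  then obtain c where "c \<in> A" "cotangent_chart A c = (U, \<phi>)" by (metis imageE)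
  with e show "e \<in> induced ` A" by (auto simp: induced_def image_iff intro!: bexI[of _ c])
next
  fix e assume "e \<in> induced ` A"
  then obtain c where "c \<in> A" "e = induced c" by blast
  then show "e \<in> restrict_atlas (cotangent_atlas A) W"
    unfolding restrict_atlas_def cotangent_atlas_def induced_def
    by (auto intro!: exI[of _ "fst (cotangent_chart A c)"] imageI)
qed

lemma mem_induced: "(x, \<omega>) \<in> fst (induced c) \<longleftrightarrow> (x, \<omega>) \<in> W \<and> x \<in> fst c"
  using W_bundle by (auto simp: induced_def cotangent_chart_def)

lemma snd_induced: "snd (induced c) (x, \<omega>) = (snd c x, \<omega> c)"
  by (simp add: induced_def cotangent_chart_def)

lemma covector_W: "(x, \<omega>) \<in> W \<Longrightarrow> \<omega> \<in> cotangent_space A x"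
  using W_bundle by (auto simp: cotangent_bundle_def)

lemma inj_induced:
  assumes "c \<in> A"
  shows "inj_on (snd (induced c)) (fst (induced c))"
proof (rule inj_onI)
  fix u u' assume u: "u \<in> fst (induced c)" "u' \<in> fst (induced c)" "snd (induced c) u = snd (induced c) u'"
  obtain x \<omega> x' \<omega>' where eq: "u = (x, \<omega>)" "u' = (x', \<omega>')" by fastforce
  have "x = x'"
    using u inj_chart[OF assms] unfolding eq mem_induced snd_induced inj_on_def by auto
  then show "u = u'"
    using u covector_eqI[OF covector_W covector_W assms] unfolding eq mem_induced snd_induced by auto
qed

lemma open_range_induced: "c \<in> A \<Longrightarrow> open (coord_range (induced c))"
  using open_W by (simp add: coord_range_def induced_def)

lemma coord_inv_induced:
  "c \<in> A \<Longrightarrow> (x, \<omega>) \<in> W \<Longrightarrow> x \<in> fst c \<Longrightarrow> coord_inv (induced c) (snd c x, \<omega> c) = (x, \<omega>)"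
  using inv_into_f_f[OF inj_induced, of c "(x, \<omega>)"]
  by (simp add: coord_inv_def mem_induced snd_induced)

lemma coord_range_inducedE:
  assumes "z \<in> coord_range (induced c)"
  obtains x \<omega> where "(x, \<omega>) \<in> W" "x \<in> fst c" "z = (snd c x, \<omega> c)"
  using assms by (auto simp: coord_range_def mem_induced snd_induced)

lemma overlap_induced_iff:
  "z \<in> overlap (induced c) (induced d) \<longleftrightarrow>
    (\<exists>x \<omega>. (x, \<omega>) \<in> W \<and> x \<in> fst c \<and> x \<in> fst d \<and> z = (snd c x, \<omega> c))"
  unfolding overlap_def by (auto simp: mem_induced snd_induced image_iff Bex_def)

lemma overlap_induced:
  assumes "c \<in> A"
  shows "overlap (induced c) (induced d) = coord_range (induced c) \<inter> (overlap c d \<times> UNIV)"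
proof (intro set_eqI iffI)
  fix z assume "z \<in> overlap (induced c) (induced d)"
  then show "z \<in> coord_range (induced c) \<inter> (overlap c d \<times> UNIV)"
    unfolding overlap_induced_iff coord_range_def
    by (auto simp: chart_mem_overlap image_iff Bex_def mem_induced snd_induced)
next
  fix z assume z: "z \<in> coord_range (induced c) \<inter> (overlap c d \<times> UNIV)"
  then obtain x \<omega> where "(x, \<omega>) \<in> W" "x \<in> fst c" "z = (snd c x, \<omega> c)"
    using coord_range_inducedE by blast
  moreover from this have "x \<in> fst d" using z chart_overlap_mem[OF assms, of x d] by auto
  ultimately show "z \<in> overlap (induced c) (induced d)"
    unfolding overlap_induced_iff by blast
qed

lemma open_overlap_induced: "c \<in> A \<Longrightarrow> d \<in> A \<Longrightarrow> open (overlap (induced c) (induced d))"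
  unfolding overlap_induced
  by (intro open_Int open_Times open_UNIV open_range_induced open_overlap)

text \<open>The inverse transpose applied to the momenta, written with the derivative of the reverse
  transition. This form is visibly smooth and avoids inverting a matrix.\<close>

definition cotangent_part :: "('a, 'e) chart \<Rightarrow> ('a, 'e) chart \<Rightarrow> 'e \<times> 'e \<Rightarrow> 'e" where
  "cotangent_part c d z =
     (\<Sum>b\<in>Basis. (snd z \<bullet> D (transition d c) (transition c d (fst z)) b) *\<^sub>R b)"

lemma cotangent_part_eq:
  assumes "c \<in> A" "d \<in> A" "(x, \<omega>) \<in> W" "x \<in> fst c" "x \<in> fst d"
  shows "cotangent_part c d (snd c x, \<omega> c) = \<omega> d"
  using assms by (simp add: cotangent_part_def transition_chart
      cotangent_spaceD[OF covector_W, symmetric] euclidean_representation)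

lemma transition_induced:
  assumes "c \<in> A" "d \<in> A" "z \<in> overlap (induced c) (induced d)"
  shows "transition (induced c) (induced d) z = (transition c d (fst z), cotangent_part c d z)"
proof -
  obtain x \<omega> where "(x, \<omega>) \<in> W" "x \<in> fst c" "x \<in> fst d" "z = (snd c x, \<omega> c)"
    using assms(3) unfolding overlap_induced_iff by blast
  then show ?thesis
    using assms(1,2)
    by (simp add: transition_def[of "induced c"] coord_inv_induced snd_induced transition_chart cotangent_part_eq)
qed

lemma smooth_cotangent_part:
  assumes c: "c \<in> A" and d: "d \<in> A"
  shows "smooth_on (overlap (induced c) (induced d)) (cotangent_part c d)"
proof -
  note op = open_overlap_induced[OF c d]
  have fst: "fst z \<in> overlap c d" if "z \<in> overlap (induced c) (induced d)" for z
    using that unfolding overlap_induced[OF c] by auto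
  have sm: "smooth_on (overlap (induced c) (induced d)) (\<lambda>z. transition c d (fst z))"
    by (rule smooth_on_compose[OF op open_overlap[OF c d] smooth_transition[OF c d]
          smooth_on_fst[OF op smooth_on_ident[OF op]] fst])
  have mem: "transition c d (fst z) \<in> overlap d c" if "z \<in> overlap (induced c) (induced d)" for z
    using fst[OF that] c by (auto simp: overlap_def transition_chart)
  have "smooth_on (overlap (induced c) (induced d)) (\<lambda>z. D (transition d c) (transition c d (fst z)) b)" for b
    by (rule smooth_on_compose[OF op open_overlap[OF d c] smooth_on_D[OF smooth_transition[OF d c]] sm mem])
  then show ?thesis
    unfolding cotangent_part_def[abs_def]
    by (intro smooth_on_sum smooth_on_scaleR smooth_on_inner op smooth_on_const
        smooth_on_snd[OF op smooth_on_ident[OF op]])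
qed

lemma smooth_transition_induced:
  assumes c: "c \<in> A" and d: "d \<in> A"
  shows "smooth_on (overlap (induced c) (induced d)) (transition (induced c) (induced d))"
proof (rule smooth_on_cong[OF open_overlap_induced[OF c d]])
  note op = open_overlap_induced[OF c d]
  have fst: "fst z \<in> overlap c d" if "z \<in> overlap (induced c) (induced d)" for z
    using that unfolding overlap_induced[OF c] by auto
  show "smooth_on (overlap (induced c) (induced d)) (\<lambda>z. (transition c d (fst z), cotangent_part c d z))"
    by (intro smooth_on_Pair op smooth_cotangent_part c d)
      (rule smooth_on_compose[OF op open_overlap[OF c d] smooth_transition[OF c d]
          smooth_on_fst[OF op smooth_on_ident[OF op]] fst])
qed (simp add: transition_induced c d)

lemma compatible_induced: "compatible_atlas (induced ` A)"
  unfolding compatible_atlas_def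
  using inj_induced open_range_induced open_overlap_induced smooth_transition_induced by blast

lemma points_induced: "points (induced ` A) = W"
  using W_bundle by (auto simp: points_def mem_induced cotangent_bundle_def)

lemma second_countable_induced: "second_countable (atlas_topology (induced ` A))"
proof -
  have "second_countable (atlas_topology A)" using manifold by (simp add: smooth_manifold_iff)
  then obtain C where C: "C \<subseteq> A" "countable C" "points A = (\<Union>c\<in>C. fst c)"
    by (rule countable_chart_cover)
  show ?thesis
  proof (rule second_countable_atlasI[OF compatible_induced])
    show "induced ` C \<subseteq> induced ` A" "countable (induced ` C)" using C by auto
    show "points (induced ` A) = (\<Union>c\<in>induced ` C. fst c)"
    proof (intro set_eqI)
      fix u :: "'a \<times> ('a, 'e) covector"
      obtain x \<omega> where u: "u = (x, \<omega>)" by fastforce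
      have "u \<in> W \<Longrightarrow> x \<in> points A" using W_bundle by (auto simp: u cotangent_bundle_def)
      then show "u \<in> points (induced ` A) \<longleftrightarrow> u \<in> (\<Union>c\<in>induced ` C. fst c)"
        unfolding points_induced using C(3) by (auto simp: u mem_induced)
    qed
  qed
qed

lemma continuous_projection:
  "continuous_map (atlas_topology (induced ` A)) (atlas_topology A) fst"
proof -
  have "openin (atlas_topology (induced ` A)) (fst -` U \<inter> topspace (atlas_topology (induced ` A)))"
    if U: "U \<in> {fst c \<inter> snd c -` V | c V. c \<in> A \<and> open V}" for U
  proof -
    obtain c V where c: "U = fst c \<inter> snd c -` V" "c \<in> A" "open V" using U by blast
    have "openin (atlas_topology (induced ` A)) (fst (induced c) \<inter> snd (induced c) -` (V \<times> UNIV))"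
      using c by (intro openin_atlas_basic open_Times) auto
    moreover have "fst (induced c) \<inter> snd (induced c) -` (V \<times> UNIV)
        = fst -` U \<inter> topspace (atlas_topology (induced ` A))"
      unfolding topspace_atlas_topology points_induced c
      by (auto simp: mem_induced snd_induced)
    ultimately show ?thesis by simp
  qed
  moreover have "fst ` topspace (atlas_topology (induced ` A)) \<subseteq> topspace (atlas_topology A)"
    unfolding topspace_atlas_topology points_induced using W_bundle by (auto simp: cotangent_bundle_def)
  ultimately show ?thesis
    unfolding atlas_topology_def[of A] continuous_on_generated_topo_iff topology_generated_by_topspace
    by auto
qed

text \<open>Points over different base points are separated by pulling back open sets of the base;
  points of one fibre lie in a common induced chart.\<close>

lemma Hausdorff_induced: "Hausdorff_space (atlas_topology (induced ` A))"
  unfolding Hausdorff_space_def topspace_atlas_topology points_induced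
proof (intro allI impI, elim conjE)
  fix u u' assume u: "u \<in> W" "u' \<in> W" "u \<noteq> u'"
  obtain x \<omega> x' \<omega>' where eq: "u = (x, \<omega>)" "u' = (x', \<omega>')" by fastforce
  have x: "x \<in> points A" "x' \<in> points A" using u W_bundle by (auto simp: eq cotangent_bundle_def)
  let ?T = "atlas_topology (induced ` A)"
  show "\<exists>U V. openin ?T U \<and> openin ?T V \<and> u \<in> U \<and> u' \<in> V \<and> disjnt U V"
  proof (cases "x = x'")
    case False
    have "Hausdorff_space (atlas_topology A)" using manifold by (simp add: smooth_manifold_iff)
    then obtain U V where UV: "openin (atlas_topology A) U" "openin (atlas_topology A) V" "x \<in> U" "x' \<in> V"
      "disjnt U V"
      using False x unfolding Hausdorff_space_def topspace_atlas_topology by blast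
    let ?pre = "\<lambda>U. {u \<in> topspace ?T. fst u \<in> U}"
    have "openin ?T (?pre U)" "openin ?T (?pre V)"
      using continuous_projection UV by (auto intro: openin_continuous_map_preimage)
    moreover have "u \<in> ?pre U" "u' \<in> ?pre V"
      using u UV by (auto simp: topspace_atlas_topology points_induced eq)
    moreover have "disjnt (?pre U) (?pre V)" using UV(5) by (auto simp: disjnt_def)
    ultimately show ?thesis by blast
  next
    case True
    obtain c where c: "c \<in> A" "x \<in> fst c" using x by (auto simp: points_def)
    have mem: "u \<in> fst (induced c)" "u' \<in> fst (induced c)"
      using u c True unfolding eq mem_induced by auto
    have "snd (induced c) u \<noteq> snd (induced c) u'"
      using inj_induced[OF c(1)] mem u(3) by (auto simp: inj_on_def)
    from hausdorff[OF this] obtain V V' where V: "open V" "open V'" "snd (induced c) u \<in> V" "snd (induced c) u' \<in> V'" "V \<inter> V' = {}"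
      by blast
    let ?pre = "\<lambda>V. fst (induced c) \<inter> snd (induced c) -` V"
    have "openin ?T (?pre V)" "openin ?T (?pre V')"
      using c V by (auto intro: openin_atlas_basic)
    moreover have "disjnt (?pre V) (?pre V')" using V(5) by (auto simp: disjnt_def)
    ultimately show ?thesis using mem V by blast
  qed
qed

lemma manifold_induced: "smooth_manifold (induced ` A)"
  by (simp add: smooth_manifold_iff compatible_induced Hausdorff_induced second_countable_induced)

end

section \<open>Locality of the adapted frame\<close>

text \<open>The chosen derivative depends only on the set of possible derivatives, which is local.
  The local expressions of \<open>K\<close> in the charts of a region and of the slit bundle agree
  only on the region, so every object derived from them has to be compared locally.\<close>

lemma D_local:
  assumes "open S" "z \<in> S" "\<And>y. y \<in> S \<Longrightarrow> f y = g y"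
  shows "D f z = D g z"
proof -
  have "(f has_derivative f') (at z) \<longleftrightarrow> (g has_derivative f') (at z)" for f'
    using has_derivative_transform_within_open[OF _ assms(1,2)] assms(3) by metis
  then show ?thesis by (simp add: frechet_derivative_def)
qed

context
  fixes S :: "'n::finite phase set" and F F' :: "'n phase \<Rightarrow> real"
  assumes S: "open S" and F: "\<And>y. y \<in> S \<Longrightarrow> F y = F' y"
begin

lemma dx_local: "(\<And>y. y \<in> S \<Longrightarrow> f y = h y) \<Longrightarrow> z \<in> S \<Longrightarrow> dx i f z = dx i h z"
  unfolding dx_def by (metis D_local[OF S])

lemma dp_local: "(\<And>y. y \<in> S \<Longrightarrow> f y = h y) \<Longrightarrow> z \<in> S \<Longrightarrow> dp i f z = dp i h z"
  unfolding dp_def by (metis D_local[OF S])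

lemma g_up_local:
  assumes "z \<in> S" shows "g_up F z = g_up F' z"
proof -
  have "dp i (dp j (\<lambda>y. (F y)^2)) z = dp i (dp j (\<lambda>y. (F' y)^2)) z" for i j
    by (intro dp_local assms) (simp_all add: F)
  then show ?thesis by (simp add: g_up_def)
qed

lemma g_low_local: "z \<in> S \<Longrightarrow> g_low F z = g_low F' z"
  by (simp add: g_low_def g_up_local)

lemma p_up_local: "z \<in> S \<Longrightarrow> p_up F z i = p_up F' z i"
  by (simp add: p_up_def g_up_local)

lemma christoffel_local:
  assumes "z \<in> S" shows "christoffel F i j k z = christoffel F' i j k z"
proof -
  have "dx a (\<lambda>y. g_low F y $ b $ d) z = dx a (\<lambda>y. g_low F' y $ b $ d) z" for a b d
    by (intro dx_local assms) (simp add: g_low_local)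
  then show ?thesis by (simp add: christoffel_def g_up_local assms)
qed

lemma nonlin_conn_local:
  assumes "z \<in> S" shows "nonlin_conn F i j z = nonlin_conn F' i j z"
proof -
  have "dp h (\<lambda>y. g_low F y $ i $ j) z = dp h (\<lambda>y. g_low F' y $ i $ j) z" for h
    by (intro dp_local assms) (simp add: g_low_local)
  then show ?thesis
    by (simp add: nonlin_conn_def christoffel00_def christoffel0_def christoffel_local p_up_local assms)
qed

lemma curv_local:
  assumes "z \<in> S" shows "curv F k i j z = curv F' k i j z"
proof -
  have "delta F a (nonlin_conn F b k) z = delta F' a (nonlin_conn F' b k) z" for a b
    using dx_local[OF nonlin_conn_local assms] dp_local[OF nonlin_conn_local assms]
    by (simp add: delta_def nonlin_conn_local assms)
  then show ?thesis by (simp add: curv_def)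
qed

end

section \<open>Cartan spaces with constant flag curvature\<close>

text \<open>A nonzero covector has a nonzero component in each chart around its base point, and
  every nonzero component vector is attained.\<close>

lemma (in base_manifold) slit_image:
  assumes c: "c \<in> A"
  shows "snd (cotangent_chart A c) ` (fst (cotangent_chart A c) \<inter> slit_cotangent_bundle A)
    = coord_range c \<times> (- {0})"
proof (intro set_eqI iffI)
  fix z assume "z \<in> snd (cotangent_chart A c) ` (fst (cotangent_chart A c) \<inter> slit_cotangent_bundle A)"
  then obtain x \<omega> where x: "\<omega> \<in> cotangent_space A x" "\<omega> \<noteq> (\<lambda>_. 0)" "x \<in> fst c" "z = (snd c x, \<omega> c)"
    by (auto simp: cotangent_chart_def slit_cotangent_bundle_def cotangent_bundle_def)
  then have "\<omega> c \<noteq> 0" using covector_eqI[OF x(1) zero_covector c] by auto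
  then show "z \<in> coord_range c \<times> (- {0})" using x by (simp add: coord_range_def)
next
  fix z :: "'e \<times> 'e" assume "z \<in> coord_range c \<times> (- {0})"
  then obtain x p where x: "x \<in> fst c" "p \<noteq> 0" "z = (snd c x, p)" by (auto simp: coord_range_def)
  obtain \<omega> where w: "\<omega> \<in> cotangent_space A x" "\<omega> c = p" using covector_exists[OF c x(1)] .
  have "x \<in> points A" using c x(1) by (auto simp: points_def)
  then have "(x, \<omega>) \<in> fst (cotangent_chart A c) \<inter> slit_cotangent_bundle A"
    using x w by (auto simp: cotangent_chart_def slit_cotangent_bundle_def cotangent_bundle_def)
  moreover have "z = snd (cotangent_chart A c) (x, \<omega>)" using x w by (simp add: cotangent_chart_def)
  ultimately show "z \<in> snd (cotangent_chart A c) ` (fst (cotangent_chart A c) \<inter> slit_cotangent_bundle A)"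
    by blast
qed

locale cartan_manifold =
  fixes A :: "('a, real^'n) chart set" and K :: "('a, 'n) cotangent \<Rightarrow> real"
  assumes cartan: "cartan_space A K"

sublocale cartan_manifold \<subseteq> base_manifold A
  using cartan by unfold_locales (simp add: cartan_space_def)

sublocale cartan_manifold \<subseteq> slit: cotangent_open A "slit_cotangent_bundle A"
proof unfold_locales
  show "slit_cotangent_bundle A \<subseteq> cotangent_bundle A" by (auto simp: slit_cotangent_bundle_def)
  show "open (snd (cotangent_chart A c) ` (fst (cotangent_chart A c) \<inter> slit_cotangent_bundle A))"
    if "c \<in> A" for c
    unfolding slit_image[OF that] by (intro open_Times open_coord_range that) (simp add: open_Compl)
qed

context cartan_manifold
begin

lemma slit_chart_mem: "c \<in> A \<Longrightarrow> slit.induced c \<in> slit_cotangent_atlas A"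
  unfolding slit_cotangent_atlas_def slit.restrict_atlas_eq by blast

lemma slit_K:
  "c \<in> A \<Longrightarrow> (x, \<omega>) \<in> slit_cotangent_bundle A \<Longrightarrow> x \<in> fst c
    \<Longrightarrow> (K \<circ> coord_inv (slit.induced c)) (snd c x, \<omega> c) = K (x, \<omega>)"
  by (simp add: slit.coord_inv_induced)

lemma smooth_slit_K: "c \<in> A \<Longrightarrow> smooth_on (coord_range (slit.induced c)) (K \<circ> coord_inv (slit.induced c))"
  using cartan slit_chart_mem unfolding cartan_space_def smooth_function_def by blast

text \<open>Along the line \<open>z + t *\<^sub>R liouville z\<close> the momentum is scaled by
  \<open>1 + t\<close>, so \<open>F\<close> is affine in \<open>t\<close>; compare derivatives at
  0.\<close>

lemma euler_slit_K:
  assumes c: "c \<in> A" and z: "z \<in> coord_range (slit.induced c)"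
  defines "F \<equiv> K \<circ> coord_inv (slit.induced c)"
  shows "D F z (liouville z) = F z"
proof -
  obtain x \<omega> where x: "(x, \<omega>) \<in> slit_cotangent_bundle A" "x \<in> fst c" "z = (snd c x, \<omega> c)"
    using slit.coord_range_inducedE[OF z] .
  have "\<omega> \<in> cotangent_space A x" "\<omega> \<noteq> (\<lambda>_. 0)" "x \<in> points A"
    using x(1) by (auto simp: slit_cotangent_bundle_def cotangent_bundle_def)
  then have mem: "(x, \<lambda>d. (1 + t) *\<^sub>R \<omega> d) \<in> slit_cotangent_bundle A" if "t > -1" for t :: real
    using that scaleR_covector by (auto simp: slit_cotangent_bundle_def cotangent_bundle_def fun_eq_iff)
  have hom: "K (x, \<lambda>d. t *\<^sub>R \<omega> d) = t * K (x, \<omega>)" if "t > 0" for t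
    using cartan x(1) that unfolding cartan_space_def slit_cotangent_bundle_def by blast
  \<comment> \<open>The bound \<open>t > -1\<close> keeps the factor positive: the covector stays
    nonzero and positive homogeneity applies.\<close>
  have line: "F (z + t *\<^sub>R liouville z) = (1 + t) * F z" if "t > -1" for t
  proof -
    have "F (z + t *\<^sub>R liouville z) = F (snd c x, (1 + t) *\<^sub>R \<omega> c)"
      by (simp add: x liouville_def scaleR_add_left)
    also have "\<dots> = (1 + t) * F z"
      unfolding F_def x(3) using slit_K[OF c mem[OF that] x(2)] slit_K[OF c x(1,2)] hom[of "1 + t"] that
      by simp
    finally show ?thesis .
  qed
  have dF: "(F has_derivative D F z) (at z)"
    using smooth_has_derivative[OF smooth_slit_K[OF c] z] by (simp add: F_def)
  have "((\<lambda>t. F (z + t *\<^sub>R liouville z)) has_derivative (\<lambda>s. D F z (s *\<^sub>R liouville z))) (at 0)"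
    by (rule has_derivative_compose[where f = "\<lambda>t. z + t *\<^sub>R liouville z" and g = F])
      (auto intro!: derivative_eq_intros dF)
  moreover have "((\<lambda>t. (1 + t) * F z) has_derivative (\<lambda>s. s * F z)) (at 0)"
    by (auto intro!: derivative_eq_intros)
  then have "((\<lambda>t. F (z + t *\<^sub>R liouville z)) has_derivative (\<lambda>s. s * F z)) (at 0)"
    by (rule has_derivative_transform_within_open[of _ _ _ _ "{-1<..}"]) (auto simp: line)
  ultimately have "(\<lambda>s. D F z (s *\<^sub>R liouville z)) = (\<lambda>s. s * F z)"
    by (rule has_derivative_unique)
  from fun_cong[OF this, of 1] show ?thesis by simp
qed

lemma cartan_chart_slit:
  assumes c: "c \<in> A"
  shows "cartan_chart (coord_range (slit.induced c)) (K \<circ> coord_inv (slit.induced c))"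
proof
  show "open (coord_range (slit.induced c))" by (rule slit.open_range_induced[OF c])
  show "smooth_on (coord_range (slit.induced c)) (K \<circ> coord_inv (slit.induced c))"
    by (rule smooth_slit_K[OF c])
  show "D (K \<circ> coord_inv (slit.induced c)) z (liouville z) = (K \<circ> coord_inv (slit.induced c)) z"
    if "z \<in> coord_range (slit.induced c)" for z
    by (rule euler_slit_K[OF c that])
  show "0 < v \<bullet> (g_up (K \<circ> coord_inv (slit.induced c)) z *v v)"
    if "z \<in> coord_range (slit.induced c)" "v \<noteq> 0" for z v
    using cartan slit_chart_mem[OF c] that unfolding cartan_space_def by blast
qed

lemma tube_open:
  assumes c: "c \<in> A"
  shows "open (snd (cotangent_chart A c) ` (fst (cotangent_chart A c) \<inter>
    {u \<in> slit_cotangent_bundle A. (K u)\<^sup>2 < r}))"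
proof -
  let ?F = "\<lambda>z. ((K \<circ> coord_inv (slit.induced c)) z)\<^sup>2"
  have "continuous_on (coord_range (slit.induced c)) ?F"
    by (intro continuous_on_power smooth_on_continuous smooth_slit_K c)
  then have "open (coord_range (slit.induced c) \<inter> ?F -` {..<r})"
    by (intro continuous_open_preimage slit.open_range_induced c) auto
  moreover have "snd (cotangent_chart A c) ` (fst (cotangent_chart A c) \<inter>
      {u \<in> slit_cotangent_bundle A. (K u)\<^sup>2 < r}) = coord_range (slit.induced c) \<inter> ?F -` {..<r}"
  proof (intro set_eqI iffI)
    fix z assume "z \<in> snd (cotangent_chart A c) ` (fst (cotangent_chart A c) \<inter>
      {u \<in> slit_cotangent_bundle A. (K u)\<^sup>2 < r})"
    then obtain x \<omega> where "(x, \<omega>) \<in> fst (slit.induced c)" "(K (x, \<omega>))\<^sup>2 < r" "z = snd (slit.induced c) (x, \<omega>)"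
      by (auto simp: slit.induced_def)
    then show "z \<in> coord_range (slit.induced c) \<inter> ?F -` {..<r}"
      using slit_K[OF c, of x \<omega>]
      by (simp add: coord_range_def) (simp add: slit.mem_induced slit.snd_induced)
  next
    fix z assume z: "z \<in> coord_range (slit.induced c) \<inter> ?F -` {..<r}"
    then obtain x \<omega> where x: "(x, \<omega>) \<in> slit_cotangent_bundle A" "x \<in> fst c" "z = (snd c x, \<omega> c)"
      using slit.coord_range_inducedE by blast
    then have "(x, \<omega>) \<in> fst (slit.induced c)" "snd (slit.induced c) (x, \<omega>) = z"
      by (simp_all add: slit.mem_induced slit.snd_induced)
    moreover have "(K (x, \<omega>))\<^sup>2 < r" using z slit_K[OF c x(1,2)] x(3) by simp
    ultimately show "z \<in> snd (cotangent_chart A c) ` (fst (cotangent_chart A c) \<inter>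
        {u \<in> slit_cotangent_bundle A. (K u)\<^sup>2 < r})"
      by (intro image_eqI[of _ _ "(x, \<omega>)"]) (simp_all add: slit.induced_def)
  qed
  ultimately show ?thesis by simp
qed

end

text \<open>The common form of both claims: \<open>W\<close> is the whole slit bundle for negative
  curvature and the tube for positive curvature.\<close>

locale flag_region = cartan_manifold A K
  for A :: "('a, real^'n) chart set" and K :: "('a, 'n) cotangent \<Rightarrow> real" +
  fixes W :: "('a, 'n) cotangent set" and \<kappa> \<alpha> \<beta> v :: real
  assumes W_slit: "W \<subseteq> slit_cotangent_bundle A"
    and open_region: "\<And>c. c \<in> A \<Longrightarrow>
      open (snd (cotangent_chart A c) ` (fst (cotangent_chart A c) \<inter> W))"
    and flag_curvature: "constant_flag_curvature A K \<kappa>"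
    and \<alpha>_pos: "\<alpha> > 0" and \<beta>_pos: "\<beta> > 0" and v_eq: "v = - \<kappa> * \<alpha> * \<beta>\<^sup>2"
    and tube: "\<And>u. u \<in> W \<Longrightarrow> \<kappa> * \<beta>\<^sup>2 * (K u)\<^sup>2 < 1"

sublocale flag_region \<subseteq> reg: cotangent_open A W
  using W_slit open_region by unfold_locales (auto simp: slit_cotangent_bundle_def)

context flag_region
begin

abbreviation KF :: "('a, real^'n) chart \<Rightarrow> 'n phase \<Rightarrow> real" where
  "KF c \<equiv> K \<circ> coord_inv (reg.induced c)"

abbreviation JF where "JF c \<equiv> J_map \<alpha> \<beta> v (KF c)"
abbreviation GF where "GF c \<equiv> G_form \<alpha> \<beta> v (KF c)"

lemma region_slit_range: "coord_range (reg.induced c) \<subseteq> coord_range (slit.induced c)"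
  using W_slit by (auto simp: coord_range_def reg.induced_def slit.induced_def)

lemma KF_app: "c \<in> A \<Longrightarrow> (x, \<omega>) \<in> W \<Longrightarrow> x \<in> fst c \<Longrightarrow> KF c (snd c x, \<omega> c) = K (x, \<omega>)"
  by (simp add: reg.coord_inv_induced)

lemma KF_slit:
  assumes "c \<in> A" "z \<in> coord_range (reg.induced c)"
  shows "KF c z = (K \<circ> coord_inv (slit.induced c)) z"
proof -
  obtain x \<omega> where x: "(x, \<omega>) \<in> W" "x \<in> fst c" "z = (snd c x, \<omega> c)"
    using reg.coord_range_inducedE[OF assms(2)] .
  then show ?thesis using KF_app[OF assms(1)] slit_K[OF assms(1)] W_slit by auto
qed

text \<open>The Cartan and flag curvature hypotheses speak of slit charts; they are transferred to
  the smaller chart by locality of all the geometric objects.\<close>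

lemma kaehler_chart_region:
  assumes c: "c \<in> A"
  shows "kaehler_chart (coord_range (reg.induced c)) (KF c) \<kappa> \<alpha> \<beta> v"
proof -
  let ?\<Omega> = "coord_range (reg.induced c)" and ?F = "K \<circ> coord_inv (slit.induced c)"
  interpret S: cartan_chart "coord_range (slit.induced c)" ?F by (rule cartan_chart_slit[OF c])
  have op: "open ?\<Omega>" by (rule reg.open_range_induced[OF c])
  have sub: "z \<in> coord_range (slit.induced c)" if "z \<in> ?\<Omega>" for z
    using that region_slit_range by blast
  note eq = KF_slit[OF c]
  have local_eq: "g_up (KF c) z = g_up ?F z" "g_low (KF c) z = g_low ?F z" "p_up (KF c) z i = p_up ?F z i"
    "curv (KF c) h j k z = curv ?F h j k z" if z: "z \<in> ?\<Omega>" for z h i j k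
    by (rule g_up_local[OF op _ z], rule eq, assumption)
      (rule g_low_local[OF op _ z], rule eq, assumption,
        rule p_up_local[OF op _ z], rule eq, assumption,
        rule curv_local[OF op _ z], rule eq, assumption)
  show ?thesis
  proof
    show "open ?\<Omega>" by (rule op)
    show "smooth_on ?\<Omega> (KF c)"
      by (rule smooth_on_cong[OF op smooth_on_subset[OF S.smooth_F region_slit_range] eq[symmetric]])
    show "D (KF c) z (liouville z) = KF c z" if z: "z \<in> ?\<Omega>" for z
    proof -
      have "D (KF c) z = D ?F z" by (rule D_local[OF op z]) (rule eq)
      then show ?thesis using S.euler_F[OF sub[OF z]] eq[OF z] by simp
    qed
    show "0 < u \<bullet> (g_up (KF c) z *v u)" if z: "z \<in> ?\<Omega>" and "u \<noteq> 0" for z u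
      using local_eq(1)[OF z] S.pos_g[OF sub[OF z] that(2)] by simp
    show "\<kappa> * \<beta>\<^sup>2 * (KF c z)\<^sup>2 < 1" if z: "z \<in> ?\<Omega>" for z
    proof -
      obtain x \<omega> where x: "(x, \<omega>) \<in> W" "x \<in> fst c" "z = (snd c x, \<omega> c)"
        using reg.coord_range_inducedE[OF z] .
      then show ?thesis using tube[OF x(1)] KF_app[OF c x(1,2)] by simp
    qed
    show "(\<Sum>j\<in>UNIV. curv (KF c) h j k z * p_up (KF c) z j)
        = \<kappa> * ((KF c z)\<^sup>2 * g_low (KF c) z $ h $ k - p_low z h * p_low z k)"
      if z: "z \<in> ?\<Omega>" for z h k
    proof -
      have "(\<Sum>j\<in>UNIV. curv ?F h j k z * p_up ?F z j)
          = \<kappa> * ((?F z)\<^sup>2 * g_low ?F z $ h $ k - p_low z h * p_low z k)"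
        using flag_curvature slit_chart_mem[OF c] sub[OF z]
        unfolding constant_flag_curvature_def Let_def by blast
      then show ?thesis
        using local_eq[OF z] eq[OF z] by simp
    qed
  qed (rule \<alpha>_pos \<beta>_pos v_eq)+
qed

lemma kaehler_transition_region:
  assumes c: "c \<in> A" and d: "d \<in> A"
  shows "kaehler_transition (coord_range (reg.induced c)) (coord_range (reg.induced d))
    (KF c) (KF d) (overlap (reg.induced c) (reg.induced d)) (overlap c d)
    (transition c d) (reg.cotangent_part c d) \<kappa> \<alpha> \<beta> v"
proof -
  let ?O = "overlap (reg.induced c) (reg.induced d)"
  interpret C: kaehler_chart "coord_range (reg.induced c)" "KF c" \<kappa> \<alpha> \<beta> v
    by (rule kaehler_chart_region[OF c])
  interpret D: kaehler_chart "coord_range (reg.induced d)" "KF d" \<kappa> \<alpha> \<beta> v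
    by (rule kaehler_chart_region[OF d])
  show ?thesis
  proof unfold_locales
    show "open ?O" by (rule reg.open_overlap_induced[OF c d])
    show "?O \<subseteq> coord_range (reg.induced c)" unfolding reg.overlap_induced[OF c] by blast
    show "open (overlap c d)" by (rule open_overlap[OF c d])
    show "smooth_on (overlap c d) (transition c d)" by (rule smooth_transition[OF c d])
    show "smooth_on ?O (reg.cotangent_part c d)" by (rule reg.smooth_cotangent_part[OF c d])
    fix z assume z: "z \<in> ?O"
    then obtain x \<omega> where x: "(x, \<omega>) \<in> W" "x \<in> fst c" "x \<in> fst d" "z = (snd c x, \<omega> c)"
      unfolding reg.overlap_induced_iff by blast
    have T: "(transition c d (fst z), reg.cotangent_part c d z) = (snd d x, \<omega> d)"
      using x c d by (simp add: transition_chart reg.cotangent_part_eq)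
    show "fst z \<in> overlap c d" using x by (simp add: chart_mem_overlap)
    have "(snd d x, \<omega> d) = snd (reg.induced d) (x, \<omega>)" by (simp add: reg.snd_induced)
    then show "(transition c d (fst z), reg.cotangent_part c d z) \<in> coord_range (reg.induced d)"
      unfolding T coord_range_def using x by (auto simp: reg.mem_induced)
    show "KF c z = KF d (transition c d (fst z), reg.cotangent_part c d z)"
      unfolding T using x KF_app[OF c] KF_app[OF d] by simp
    show "snd z \<bullet> u = reg.cotangent_part c d z \<bullet> D (transition c d) (fst z) u" for u
      using T cotangent_spaceD[OF reg.covector_W[OF x(1)] c d x(2,3), of u] x by simp
    have "D (transition c d) (fst z) (D (transition d c) (snd d x) u) = u" for u
      using D_transition_inverse[OF d c x(3,2)] x(4) by simp
    then show "surj (D (transition c d) (fst z))" by (rule surjI)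
  qed
qed

lemma transition_laws:
  assumes c: "c \<in> A" and d: "d \<in> A" and z: "z \<in> overlap (reg.induced c) (reg.induced d)"
  defines "R \<equiv> transition (reg.induced c) (reg.induced d)"
  shows "JF d (R z) (D R z X) = D R z (JF c z X)"
    and "GF d (R z) (D R z X) (D R z Y) = GF c z X Y"
proof -
  interpret kaehler_transition "coord_range (reg.induced c)" "coord_range (reg.induced d)"
    "KF c" "KF d" "overlap (reg.induced c) (reg.induced d)" "overlap c d"
    "transition c d" "reg.cotangent_part c d" \<kappa> \<alpha> \<beta> v
    by (rule kaehler_transition_region[OF c d])
  have eq: "R y = T y" if "y \<in> overlap (reg.induced c) (reg.induced d)" for y
    unfolding R_def T_def by (rule reg.transition_induced[OF c d that])
  have "D R z = D T z" by (rule D_local[OF reg.open_overlap_induced[OF c d] z]) (rule eq)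
  then show "JF d (R z) (D R z X) = D R z (JF c z X)"
    and "GF d (R z) (D R z X) (D R z Y) = GF c z X Y"
    using J_T[OF z, of X] G_form_T[OF z, of X Y] eq[OF z] by simp_all
qed

lemma smooth_tensor_J: "smooth_tensor11 (reg.induced ` A) (J_structure \<alpha> \<beta> v K)"
  unfolding smooth_tensor11_def J_structure_eq
  using kaehler_chart.linear_J[OF kaehler_chart_region] kaehler_chart.smooth_J[OF kaehler_chart_region]
    transition_laws(1) by auto

lemma smooth_tensor_G: "smooth_tensor02 (reg.induced ` A) (G_metric \<alpha> \<beta> v K)"
  unfolding smooth_tensor02_def G_metric_eq
  using kaehler_chart.bilinear_G[OF kaehler_chart_region] kaehler_chart.smooth_G_form[OF kaehler_chart_region]
    transition_laws(2) by auto

text \<open>In every induced chart the form is the canonical one with constant coefficients, so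
  smoothness and closedness are immediate; invariance is inherited from \<open>G\<close> and
  \<open>J\<close>.\<close>

lemma closed_fundamental_form:
  "closed_2form (reg.induced ` A) (\<lambda>c z X Y. G_metric \<alpha> \<beta> v K c z X (J_structure \<alpha> \<beta> v K c z Y))"
proof -
  let ?\<Omega> = "\<lambda>c z X Y. GF c z X (JF c z Y)"
  have canonical: "?\<Omega> c z X Y = snd X \<bullet> fst Y - fst X \<bullet> snd Y"
    if "c \<in> A" "z \<in> coord_range (reg.induced c)" for c z X Y
    using kaehler_chart.fundamental_form[OF kaehler_chart_region] that by blast
  have "bilinear (?\<Omega> c z)" if "c \<in> A" "z \<in> coord_range (reg.induced c)" for c z
  proof -
    have "?\<Omega> c z = (\<lambda>X Y. snd X \<bullet> fst Y - fst X \<bullet> snd Y)" using canonical[OF that] by (intro ext)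
    then show ?thesis
      by (auto simp: bilinear_def inner_add_left inner_add_right algebra_simps intro!: linearI)
  qed
  moreover have "smooth_on (coord_range (reg.induced c)) (\<lambda>z. ?\<Omega> c z X Y)" if "c \<in> A" for c X Y
    by (rule smooth_on_cong[OF reg.open_range_induced[OF that] smooth_on_const canonical[OF that, symmetric]])
  moreover have "?\<Omega> d (T z) (D T z X) (D T z Y) = ?\<Omega> c z X Y"
    if "c \<in> A" "d \<in> A" "z \<in> overlap (reg.induced c) (reg.induced d)"
      and "T = transition (reg.induced c) (reg.induced d)" for c d z X Y T
    using transition_laws[OF that(1-3)] that(4) by simp
  moreover have "ext_deriv2 (?\<Omega> c) z X Y Z = 0" if "c \<in> A" "z \<in> coord_range (reg.induced c)" for c z X Y Z
  proof -
    have "D (\<lambda>y. ?\<Omega> c y X Y) z = D (\<lambda>y. snd X \<bullet> fst Y - fst X \<bullet> snd Y) z" for X Y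
      by (rule D_local[OF reg.open_range_induced[OF that(1)] that(2) canonical[OF that(1)]])
    then show ?thesis by (simp add: ext_deriv2_def)
  qed
  ultimately show ?thesis
    unfolding closed_2form_def smooth_tensor02_def G_metric_eq J_structure_eq
    using canonical by (auto simp: inner_commute)
qed

lemma kaehler_region:
  "kaehler_manifold (restrict_atlas (cotangent_atlas A) W) (G_metric \<alpha> \<beta> v K) (J_structure \<alpha> \<beta> v K)"
proof -
  note chart = kaehler_chart_region
  have "almost_complex_structure (reg.induced ` A) (J_structure \<alpha> \<beta> v K)"
    unfolding almost_complex_structure_def
    using smooth_tensor_J kaehler_chart.J_J[OF chart] by (auto simp: J_structure_eq)
  moreover have "J_structure \<alpha> \<beta> v K (reg.induced c) = JF c" for c
    by (intro ext) (simp add: J_structure_eq)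
  then have "integrable_structure (reg.induced ` A) (J_structure \<alpha> \<beta> v K)"
    unfolding integrable_structure_def
    using kaehler_chart.nijenhuis_J[OF chart] by auto
  moreover have "riemannian_metric (reg.induced ` A) (G_metric \<alpha> \<beta> v K)"
    unfolding riemannian_metric_def
    using smooth_tensor_G kaehler_chart.G_form_sym[OF chart] kaehler_chart.G_form_pos[OF chart]
    by (auto simp: G_metric_eq)
  moreover have "hermitian (reg.induced ` A) (G_metric \<alpha> \<beta> v K) (J_structure \<alpha> \<beta> v K)"
    unfolding hermitian_def
    using kaehler_chart.G_form_hermitian[OF chart] by (auto simp: G_metric_eq J_structure_eq)
  ultimately show ?thesis
    unfolding reg.restrict_atlas_eq kaehler_manifold_def
    using reg.manifold_induced closed_fundamental_form by blast
qed

end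

theorem theorem3p5:
  fixes A :: "('a, real^'n) chart set"
    and K :: "('a, 'n) cotangent \<Rightarrow> real"
    and c \<alpha> \<beta> v :: real
  assumes "cartan_space A K"
    and "constant_flag_curvature A K c"
    and "\<alpha> > 0" and "\<beta> > 0"
    and "v = - c * \<alpha> * \<beta>^2"
  shows "(c < 0 \<longrightarrow>
            kaehler_manifold (slit_cotangent_atlas A)
              (G_metric \<alpha> \<beta> v K) (J_structure \<alpha> \<beta> v K)) \<and>
         (c > 0 \<longrightarrow>
            kaehler_manifold
              (restrict_atlas (cotangent_atlas A)
                {u \<in> slit_cotangent_bundle A. (K u)^2 < 1 / (c * \<beta>^2)})
              (G_metric \<alpha> \<beta> v K) (J_structure \<alpha> \<beta> v K))"
proof (intro conjI impI)
  interpret cartan_manifold A K by unfold_locales (rule assms(1))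
  {
    assume c: "c < 0"
    have "flag_region A K (slit_cotangent_bundle A) c \<alpha> \<beta> v"
    proof unfold_locales
      \<comment> \<open>For negative \<open>c\<close> the left side is at most 0, so the whole slit
        bundle qualifies.\<close>
      show "c * \<beta>\<^sup>2 * (K u)\<^sup>2 < 1" for u
        using c by (smt (verit) mult_nonneg_nonneg mult_nonpos_nonneg zero_le_power2)
    qed (use assms in \<open>auto intro: slit.open_W\<close>)
    then show "kaehler_manifold (slit_cotangent_atlas A) (G_metric \<alpha> \<beta> v K) (J_structure \<alpha> \<beta> v K)"
      unfolding slit_cotangent_atlas_def by (rule flag_region.kaehler_region)
  }
  {
    assume c: "c > 0"
    have "flag_region A K {u \<in> slit_cotangent_bundle A. (K u)^2 < 1 / (c * \<beta>^2)} c \<alpha> \<beta> v"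
    proof unfold_locales
      show "c * \<beta>\<^sup>2 * (K u)\<^sup>2 < 1" if "u \<in> {u \<in> slit_cotangent_bundle A. (K u)^2 < 1 / (c * \<beta>^2)}" for u
        using that c assms(4) by (simp add: field_simps)
    qed (use assms in \<open>auto intro: tube_open\<close>)
    then show "kaehler_manifold (restrict_atlas (cotangent_atlas A)
        {u \<in> slit_cotangent_bundle A. (K u)^2 < 1 / (c * \<beta>^2)})
        (G_metric \<alpha> \<beta> v K) (J_structure \<alpha> \<beta> v K)"
      by (rule flag_region.kaehler_region)
  }
qed

end
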